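(* Let $M$ be a $\xi$-horizontal $CR$-submanifold of an $LP$-Sasakian manifold $(M',\phi,\xi,\eta,g)$ with a generalized symmetric metric connection $\overline{\nabla}$ of type $(\alpha,\beta)$. Then the distribution $D$ is integrable if and only if $$h(\phi X,Y)=h(\phi Y,X)$$ for any $X,Y\in\Gamma(D)$.
   Context: An $LP$-Sasakian manifold $(M',\phi,\xi,\eta,g)$ is a differentiable manifold with a $(1,1)$ tensor field $\phi$, a vector field $\xi$, a $1$-form $\eta$ and a Lorentzian metric $g$ with Levi-Civita connection $\nabla$ such that, for all vector fields $U,V$: $\eta(\xi)=-1$, $\phi^2U=U+\eta(U)\xi$, $g(\phi U,\phi V)=g(U,V)+\eta(U)\eta(V)$, $g(U,\xi)=\eta(U)$, $\nabla_U\xi=\phi U$, $(\nabla_U\phi)(V)=g(U,V)\xi+\eta(V)U+2\eta(U)\eta(V)\xi$. The generalized symmetric metric connection of type $(\alpha,\beta)$ on $M'$ ($\alpha,\beta$ smooth functions) is $\overline{\nabla}_UV=\nabla_UV+\alpha\{\eta(V)U-g(U,V)\xi\}+\beta\{\eta(V)\phi U-g(\phi U,V)\xi\}$. A submanifold $M$ of $M'$ (with induced metric) is a $CR$-submanifold if $\xi$ is tangent to $M$ and there is a differentiable distribution $D$ on $M$ with $\phi D\subset D$ whose orthogonal complementary distribution $D^{\bot}$ in $TM$ satisfies $\phi D^{\bot}\subset T^{\bot}M$ (so $TM=D\oplus D^{\bot}$). It is $\xi$-horizontal if $\xi\in\Gamma(D)$. $h$ denotes the second fundamental form of $M$ with respect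 to the Levi-Civita connection: $\nabla_XY=\nabla'_XY+h(X,Y)$ for $X,Y\in\Gamma(TM)$, with $\nabla'_XY$ tangent to $M$ and $h(X,Y)$ normal. *)

theory Defs
  imports "HOL-Analysis.Analysis" "HOL-Library.Function_Algebras"
begin

text \<open>Pointwise real vector space structure on functions. Tangent vectors are derivations, i.e.
  functionals, and vector fields are functions into tangent vectors, so that both inherit
  addition and scalar multiplication, and \<^const>\<open>subspace\<close>, \<^const>\<open>span\<close>, \<^const>\<open>dim\<close> apply to
  tangent vectors.\<close>

instantiation "fun" :: (type, real_vector) real_vector
begin

definition scaleR_fun :: "real \<Rightarrow> ('a \<Rightarrow> 'b) \<Rightarrow> 'a \<Rightarrow> 'b"
  where "scaleR_fun r f = (\<lambda>x. r *\<^sub>R f x)"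

instance
  by standard (simp_all add: scaleR_fun_def fun_eq_iff scaleR_add_right scaleR_add_left)

end


section \<open>Smooth manifolds\<close>

text \<open>The domains are always open. In finite dimension, \<open>f\<close> is \<open>k + 1\<close> times continuously
  differentiable iff it is differentiable and all its directional derivatives are \<open>k\<close> times
  continuously differentiable.\<close>

primrec Ck_on :: "nat \<Rightarrow> ('e::euclidean_space \<Rightarrow> 'f::real_normed_vector) \<Rightarrow> 'e set \<Rightarrow> bool"
  where
    "Ck_on 0 f S \<longleftrightarrow> continuous_on S f"
  | "Ck_on (Suc k) f S \<longleftrightarrow> (\<forall>x\<in>S. f differentiable (at x)) \<and>
       (\<forall>v. Ck_on k (\<lambda>x. frechet_derivative f (at x) v) S)"

definition smooth_on :: "('e::euclidean_space \<Rightarrow> 'f::real_normed_vector) \<Rightarrow> 'e set \<Rightarrow> bool"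
  where "smooth_on f S \<longleftrightarrow> (\<forall>k. Ck_on k f S)"

type_synonym ('a, 'e) chart = "'a set \<times> ('a \<Rightarrow> 'e)"

definition chart_inv :: "('a, 'e) chart \<Rightarrow> 'e \<Rightarrow> 'a"
  where "chart_inv c = inv_into (fst c) (snd c)"

definition is_chart :: "('a::topological_space, 'e::euclidean_space) chart \<Rightarrow> bool"
  where "is_chart c \<longleftrightarrow> open (fst c) \<and> open (snd c ` fst c) \<and>
    homeomorphism (fst c) (snd c ` fst c) (snd c) (chart_inv c)"

definition smooth_transition :: "('a, 'e::euclidean_space) chart \<Rightarrow> ('a, 'e) chart \<Rightarrow> bool"
  where "smooth_transition c d \<longleftrightarrow> smooth_on (snd d \<circ> chart_inv c) (snd c ` (fst c \<inter> fst d))"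

text \<open>A smooth manifold is a Hausdorff, second countable type (the underlying set being the whole
  type) with a smooth atlas \<open>A\<close> modelled on a Euclidean space.\<close>

definition smooth_manifold ::
    "('a::{t2_space, second_countable_topology}, 'e::euclidean_space) chart set \<Rightarrow> bool"
  where "smooth_manifold A \<longleftrightarrow> (\<forall>c\<in>A. is_chart c) \<and> (\<Union>c\<in>A. fst c) = UNIV \<and>
    (\<forall>c\<in>A. \<forall>d\<in>A. smooth_transition c d)"

text \<open>The charts of the maximal atlas generated by \<open>A\<close>.\<close>

definition admissible_chart ::
    "('a::topological_space, 'e::euclidean_space) chart set \<Rightarrow> ('a, 'e) chart \<Rightarrow> bool"
  where "admissible_chart A c \<longleftrightarrow> is_chart c \<and>
    (\<forall>d\<in>A. smooth_transition c d \<and> smooth_transition d c)"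

definition smooth_functions :: "('a, 'e::euclidean_space) chart set \<Rightarrow> ('a \<Rightarrow> real) set"
  where "smooth_functions A = {f. \<forall>c\<in>A. smooth_on (f \<circ> chart_inv c) (snd c ` fst c)}"

definition smooth_map ::
    "('b::topological_space, 'f::euclidean_space) chart set \<Rightarrow>
     ('a::topological_space, 'e::euclidean_space) chart set \<Rightarrow> ('b \<Rightarrow> 'a) \<Rightarrow> bool"
  where "smooth_map A A' \<iota> \<longleftrightarrow> continuous_on UNIV \<iota> \<and>
    (\<forall>c\<in>A. \<forall>d\<in>A'. smooth_on (snd d \<circ> \<iota> \<circ> chart_inv c) (snd c ` (fst c \<inter> \<iota> -` fst d)))"


section \<open>Tangent vectors and vector fields\<close>

type_synonym 'a tvec = "('a \<Rightarrow> real) \<Rightarrow> real"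
type_synonym 'a vfield = "'a \<Rightarrow> 'a tvec"

text \<open>Tangent vectors at \<open>p\<close> are the derivations at \<open>p\<close> of the algebra of smooth functions. The
  value on functions that are not smooth is set to \<open>0\<close>, so that equality of tangent vectors is
  equality of derivations.\<close>

definition tangent_space :: "('a, 'e::euclidean_space) chart set \<Rightarrow> 'a \<Rightarrow> 'a tvec set"
  where "tangent_space A p = {v.
    (\<forall>f\<in>smooth_functions A. \<forall>g\<in>smooth_functions A. v (\<lambda>x. f x + g x) = v f + v g) \<and>
    (\<forall>f\<in>smooth_functions A. \<forall>r. v (\<lambda>x. r * f x) = r * v f) \<and>
    (\<forall>f\<in>smooth_functions A. \<forall>g\<in>smooth_functions A.
        v (\<lambda>x. f x * g x) = f p * v g + g p * v f) \<and>
    (\<forall>f. f \<notin> smooth_functions A \<longrightarrow> v f = 0)}"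

definition vector_fields :: "('a, 'e::euclidean_space) chart set \<Rightarrow> 'a vfield set"
  where "vector_fields A = {X. (\<forall>p. X p \<in> tangent_space A p) \<and>
    (\<forall>f\<in>smooth_functions A. (\<lambda>p. X p f) \<in> smooth_functions A)}"

definition lie_bracket :: "'a vfield \<Rightarrow> 'a vfield \<Rightarrow> 'a vfield"
  where "lie_bracket X Y = (\<lambda>p f. X p (\<lambda>q. Y q f) - Y p (\<lambda>q. X q f))"

definition coord_vector ::
    "('a, 'e::euclidean_space) chart set \<Rightarrow> ('a, 'e) chart \<Rightarrow> 'a \<Rightarrow> 'e \<Rightarrow> 'a tvec"
  where "coord_vector A c p w = (\<lambda>f. if f \<in> smooth_functions A
    then frechet_derivative (f \<circ> chart_inv c) (at (snd c p)) w else 0)"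

text \<open>The differential \<open>d\<iota>\<close>; it maps tangent vectors at \<open>q\<close> to tangent vectors at \<open>\<iota> q\<close>.\<close>

definition push :: "('a, 'e::euclidean_space) chart set \<Rightarrow> ('b \<Rightarrow> 'a) \<Rightarrow> 'b tvec \<Rightarrow> 'a tvec"
  where "push A' \<iota> v = (\<lambda>f. if f \<in> smooth_functions A' then v (f \<circ> \<iota>) else 0)"

definition immersion ::
    "('b::topological_space, 'f::euclidean_space) chart set \<Rightarrow>
     ('a::topological_space, 'e::euclidean_space) chart set \<Rightarrow> ('b \<Rightarrow> 'a) \<Rightarrow> bool"
  where "immersion A A' \<iota> \<longleftrightarrow> smooth_map A A' \<iota> \<and>
    (\<forall>q. inj_on (push A' \<iota>) (tangent_space A q))"


section \<open>Tensors, metrics and connections\<close>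

definition one_form :: "('a, 'e::euclidean_space) chart set \<Rightarrow> ('a \<Rightarrow> 'a tvec \<Rightarrow> real) \<Rightarrow> bool"
  where "one_form A \<eta> \<longleftrightarrow>
    (\<forall>p. \<forall>u\<in>tangent_space A p. \<forall>v\<in>tangent_space A p. \<eta> p (u + v) = \<eta> p u + \<eta> p v) \<and>
    (\<forall>p. \<forall>u\<in>tangent_space A p. \<forall>r. \<eta> p (r *\<^sub>R u) = r * \<eta> p u) \<and>
    (\<forall>X\<in>vector_fields A. (\<lambda>p. \<eta> p (X p)) \<in> smooth_functions A)"

definition tensor_1_1 :: "('a, 'e::euclidean_space) chart set \<Rightarrow> ('a \<Rightarrow> 'a tvec \<Rightarrow> 'a tvec) \<Rightarrow> bool"
  where "tensor_1_1 A \<phi> \<longleftrightarrow>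
    (\<forall>p. \<forall>u\<in>tangent_space A p. \<phi> p u \<in> tangent_space A p) \<and>
    (\<forall>p. \<forall>u\<in>tangent_space A p. \<forall>v\<in>tangent_space A p. \<phi> p (u + v) = \<phi> p u + \<phi> p v) \<and>
    (\<forall>p. \<forall>u\<in>tangent_space A p. \<forall>r. \<phi> p (r *\<^sub>R u) = r *\<^sub>R \<phi> p u) \<and>
    (\<forall>X\<in>vector_fields A. (\<lambda>p. \<phi> p (X p)) \<in> vector_fields A)"

text \<open>A smooth symmetric bilinear form of signature \<open>(-,+,\<dots>,+)\<close> on every tangent space.\<close>

definition lorentzian_metric ::
    "('a, 'e::euclidean_space) chart set \<Rightarrow> ('a \<Rightarrow> 'a tvec \<Rightarrow> 'a tvec \<Rightarrow> real) \<Rightarrow> bool"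
  where "lorentzian_metric A g \<longleftrightarrow>
    (\<forall>p. \<forall>u\<in>tangent_space A p. \<forall>v\<in>tangent_space A p. g p u v = g p v u) \<and>
    (\<forall>p. \<forall>u\<in>tangent_space A p. \<forall>v\<in>tangent_space A p. \<forall>w\<in>tangent_space A p.
        g p (u + v) w = g p u w + g p v w) \<and>
    (\<forall>p. \<forall>u\<in>tangent_space A p. \<forall>w\<in>tangent_space A p. \<forall>r. g p (r *\<^sub>R u) w = r * g p u w) \<and>
    (\<forall>X\<in>vector_fields A. \<forall>Y\<in>vector_fields A. (\<lambda>p. g p (X p) (Y p)) \<in> smooth_functions A) \<and>
    (\<forall>p. \<exists>B. \<exists>e\<in>B. independent B \<and> span B = tangent_space A p \<and> g p e e = -1 \<and>
        (\<forall>b\<in>B - {e}. g p b b = 1) \<and> (\<forall>b\<in>B. \<forall>b'\<in>B. b \<noteq> b' \<longrightarrow> g p b b' = 0))"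

type_synonym 'a connection = "'a vfield \<Rightarrow> 'a vfield \<Rightarrow> 'a vfield"

definition affine_connection :: "('a, 'e::euclidean_space) chart set \<Rightarrow> 'a connection \<Rightarrow> bool"
  where "affine_connection A nabla \<longleftrightarrow>
    (\<forall>X\<in>vector_fields A. \<forall>Y\<in>vector_fields A. nabla X Y \<in> vector_fields A) \<and>
    (\<forall>X\<in>vector_fields A. \<forall>X'\<in>vector_fields A. \<forall>Y\<in>vector_fields A.
        nabla (X + X') Y = nabla X Y + nabla X' Y) \<and>
    (\<forall>X\<in>vector_fields A. \<forall>Y\<in>vector_fields A. \<forall>Y'\<in>vector_fields A.
        nabla X (Y + Y') = nabla X Y + nabla X Y') \<and>
    (\<forall>f\<in>smooth_functions A. \<forall>X\<in>vector_fields A. \<forall>Y\<in>vector_fields A.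
        nabla (\<lambda>p. f p *\<^sub>R X p) Y = (\<lambda>p. f p *\<^sub>R nabla X Y p)) \<and>
    (\<forall>f\<in>smooth_functions A. \<forall>X\<in>vector_fields A. \<forall>Y\<in>vector_fields A.
        nabla X (\<lambda>p. f p *\<^sub>R Y p) = (\<lambda>p. X p f *\<^sub>R Y p + f p *\<^sub>R nabla X Y p))"

definition levi_civita ::
    "('a, 'e::euclidean_space) chart set \<Rightarrow> ('a \<Rightarrow> 'a tvec \<Rightarrow> 'a tvec \<Rightarrow> real) \<Rightarrow>
     'a connection \<Rightarrow> bool"
  where "levi_civita A g nabla \<longleftrightarrow> affine_connection A nabla \<and>
    (\<forall>X\<in>vector_fields A. \<forall>Y\<in>vector_fields A. nabla X Y - nabla Y X = lie_bracket X Y) \<and>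
    (\<forall>X\<in>vector_fields A. \<forall>Y\<in>vector_fields A. \<forall>Z\<in>vector_fields A. \<forall>p.
        X p (\<lambda>q. g q (Y q) (Z q)) = g p (nabla X Y p) (Z p) + g p (Y p) (nabla X Z p))"


section \<open>LP-Sasakian manifolds\<close>

definition LP_Sasakian ::
    "('a::{t2_space, second_countable_topology}, 'e::euclidean_space) chart set \<Rightarrow>
     ('a \<Rightarrow> 'a tvec \<Rightarrow> 'a tvec) \<Rightarrow> 'a vfield \<Rightarrow> ('a \<Rightarrow> 'a tvec \<Rightarrow> real) \<Rightarrow>
     ('a \<Rightarrow> 'a tvec \<Rightarrow> 'a tvec \<Rightarrow> real) \<Rightarrow> 'a connection \<Rightarrow> bool"
  where "LP_Sasakian A \<phi> \<xi> \<eta> g nabla \<longleftrightarrow>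
    smooth_manifold A \<and> tensor_1_1 A \<phi> \<and> \<xi> \<in> vector_fields A \<and> one_form A \<eta> \<and>
    lorentzian_metric A g \<and> levi_civita A g nabla \<and>
    (\<forall>p. \<eta> p (\<xi> p) = -1) \<and>
    (\<forall>U\<in>vector_fields A. \<forall>p. \<phi> p (\<phi> p (U p)) = U p + \<eta> p (U p) *\<^sub>R \<xi> p) \<and>
    (\<forall>U\<in>vector_fields A. \<forall>V\<in>vector_fields A. \<forall>p.
        g p (\<phi> p (U p)) (\<phi> p (V p)) = g p (U p) (V p) + \<eta> p (U p) * \<eta> p (V p)) \<and>
    (\<forall>U\<in>vector_fields A. \<forall>p. g p (U p) (\<xi> p) = \<eta> p (U p)) \<and>
    (\<forall>U\<in>vector_fields A. \<forall>p. nabla U \<xi> p = \<phi> p (U p)) \<and>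
    (\<forall>U\<in>vector_fields A. \<forall>V\<in>vector_fields A. \<forall>p.
        nabla U (\<lambda>q. \<phi> q (V q)) p - \<phi> p (nabla U V p) =
          g p (U p) (V p) *\<^sub>R \<xi> p + \<eta> p (V p) *\<^sub>R U p
          + (2 * \<eta> p (U p) * \<eta> p (V p)) *\<^sub>R \<xi> p)"

definition generalized_symmetric_metric_connection ::
    "('a \<Rightarrow> 'a tvec \<Rightarrow> 'a tvec) \<Rightarrow> 'a vfield \<Rightarrow> ('a \<Rightarrow> 'a tvec \<Rightarrow> real) \<Rightarrow>
     ('a \<Rightarrow> 'a tvec \<Rightarrow> 'a tvec \<Rightarrow> real) \<Rightarrow> 'a connection \<Rightarrow>
     ('a \<Rightarrow> real) \<Rightarrow> ('a \<Rightarrow> real) \<Rightarrow> 'a connection"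
  where "generalized_symmetric_metric_connection \<phi> \<xi> \<eta> g nabla \<alpha> \<beta> = (\<lambda>U V p.
    nabla U V p
    + \<alpha> p *\<^sub>R (\<eta> p (V p) *\<^sub>R U p - g p (U p) (V p) *\<^sub>R \<xi> p)
    + \<beta> p *\<^sub>R (\<eta> p (V p) *\<^sub>R \<phi> p (U p) - g p (\<phi> p (U p)) (V p) *\<^sub>R \<xi> p))"


section \<open>Distributions\<close>

text \<open>A differentiable distribution: a subspace of each tangent space, of constant dimension,
  locally spanned by smooth vector fields.\<close>

definition distribution ::
    "('b::topological_space, 'f::euclidean_space) chart set \<Rightarrow> ('b \<Rightarrow> 'b tvec set) \<Rightarrow> bool"
  where "distribution A D \<longleftrightarrow>
    (\<forall>q. subspace (D q) \<and> D q \<subseteq> tangent_space A q) \<and>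
    (\<exists>k. \<forall>q. dim (D q) = k) \<and>
    (\<forall>q. \<exists>S F. open S \<and> q \<in> S \<and> finite F \<and> F \<subseteq> vector_fields A \<and>
        (\<forall>r\<in>S. D r = span ((\<lambda>X. X r) ` F)))"

definition sections ::
    "('b, 'f::euclidean_space) chart set \<Rightarrow> ('b \<Rightarrow> 'b tvec set) \<Rightarrow> 'b vfield set"
  where "sections A D = {X \<in> vector_fields A. \<forall>q. X q \<in> D q}"

text \<open>\<open>N\<close> is an embedded submanifold, given by slice charts, whose tangent space at each of its
  points is the value of \<open>D\<close>. In a slice chart with model subspace \<open>W\<close> the tangent space of the
  slice is spanned by the coordinate vectors in the directions of \<open>W\<close>. As immersions are locally
  embeddings, admitting only embedded integral manifolds does not restrict integrability.\<close>

definition integral_manifold ::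
    "('b::topological_space, 'f::euclidean_space) chart set \<Rightarrow> ('b \<Rightarrow> 'b tvec set) \<Rightarrow>
     'b set \<Rightarrow> bool"
  where "integral_manifold A D N \<longleftrightarrow> (\<forall>q\<in>N. \<exists>c W. admissible_chart A c \<and> q \<in> fst c \<and> subspace W \<and>
    N \<inter> fst c = {r \<in> fst c. snd c r - snd c q \<in> W} \<and>
    (\<forall>r\<in>N \<inter> fst c. D r = coord_vector A c r ` W))"

definition integrable_distribution ::
    "('b::topological_space, 'f::euclidean_space) chart set \<Rightarrow> ('b \<Rightarrow> 'b tvec set) \<Rightarrow> bool"
  where "integrable_distribution A D \<longleftrightarrow> (\<forall>q. \<exists>N. q \<in> N \<and> integral_manifold A D N)"


section \<open>Submanifolds\<close>

text \<open>A submanifold of the manifold with atlas \<open>A'\<close> is a manifold with atlas \<open>A\<close> together with an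
  immersion \<open>\<iota>\<close>; tangent vectors \<open>u\<close> of the submanifold are identified with \<open>push A' \<iota> u\<close>.\<close>

definition submanifold ::
    "('b::{t2_space, second_countable_topology}, 'f::euclidean_space) chart set \<Rightarrow>
     ('a::{t2_space, second_countable_topology}, 'e::euclidean_space) chart set \<Rightarrow>
     ('b \<Rightarrow> 'a) \<Rightarrow> bool"
  where "submanifold A A' \<iota> \<longleftrightarrow> smooth_manifold A \<and> smooth_manifold A' \<and> immersion A A' \<iota>"

definition normal_space ::
    "('b, 'f::euclidean_space) chart set \<Rightarrow> ('a, 'e::euclidean_space) chart set \<Rightarrow> ('b \<Rightarrow> 'a) \<Rightarrow>
     ('a \<Rightarrow> 'a tvec \<Rightarrow> 'a tvec \<Rightarrow> real) \<Rightarrow> 'b \<Rightarrow> 'a tvec set"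
  where "normal_space A A' \<iota> g q = {n \<in> tangent_space A' (\<iota> q).
    \<forall>u\<in>tangent_space A q. g (\<iota> q) n (push A' \<iota> u) = 0}"

definition orthogonal_complement ::
    "('b, 'f::euclidean_space) chart set \<Rightarrow> ('a, 'e::euclidean_space) chart set \<Rightarrow> ('b \<Rightarrow> 'a) \<Rightarrow>
     ('a \<Rightarrow> 'a tvec \<Rightarrow> 'a tvec \<Rightarrow> real) \<Rightarrow> ('b \<Rightarrow> 'b tvec set) \<Rightarrow> 'b \<Rightarrow> 'b tvec set"
  where "orthogonal_complement A A' \<iota> g D q = {u \<in> tangent_space A q.
    \<forall>v\<in>D q. g (\<iota> q) (push A' \<iota> u) (push A' \<iota> v) = 0}"

definition CR_submanifold ::
    "('b::{t2_space, second_countable_topology}, 'f::euclidean_space) chart set \<Rightarrow>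
     ('a::{t2_space, second_countable_topology}, 'e::euclidean_space) chart set \<Rightarrow>
     ('b \<Rightarrow> 'a) \<Rightarrow> ('a \<Rightarrow> 'a tvec \<Rightarrow> 'a tvec) \<Rightarrow> 'a vfield \<Rightarrow>
     ('a \<Rightarrow> 'a tvec \<Rightarrow> 'a tvec \<Rightarrow> real) \<Rightarrow> ('b \<Rightarrow> 'b tvec set) \<Rightarrow> bool"
  where "CR_submanifold A A' \<iota> \<phi> \<xi> g D \<longleftrightarrow>
    submanifold A A' \<iota> \<and>
    (\<forall>q. \<xi> (\<iota> q) \<in> push A' \<iota> ` tangent_space A q) \<and>
    distribution A D \<and>
    (\<forall>q. \<forall>u\<in>D q. \<phi> (\<iota> q) (push A' \<iota> u) \<in> push A' \<iota> ` D q) \<and>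
    (\<forall>q. D q \<inter> orthogonal_complement A A' \<iota> g D q = {0} \<and>
         {u + w | u w. u \<in> D q \<and> w \<in> orthogonal_complement A A' \<iota> g D q} = tangent_space A q) \<and>
    (\<forall>q. \<forall>w\<in>orthogonal_complement A A' \<iota> g D q.
         \<phi> (\<iota> q) (push A' \<iota> w) \<in> normal_space A A' \<iota> g q)"

definition xi_horizontal ::
    "('a, 'e::euclidean_space) chart set \<Rightarrow> ('b \<Rightarrow> 'a) \<Rightarrow> 'a vfield \<Rightarrow> ('b \<Rightarrow> 'b tvec set) \<Rightarrow> bool"
  where "xi_horizontal A' \<iota> \<xi> D \<longleftrightarrow> (\<forall>q. \<xi> (\<iota> q) \<in> push A' \<iota> ` D q)"

definition extends_near ::
    "('a, 'e::euclidean_space) chart set \<Rightarrow> ('b::topological_space \<Rightarrow> 'a) \<Rightarrow> 'b \<Rightarrow>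
     'b vfield \<Rightarrow> 'a vfield \<Rightarrow> bool"
  where "extends_near A' \<iota> q X X' \<longleftrightarrow> X' \<in> vector_fields A' \<and>
    (\<exists>S. open S \<and> q \<in> S \<and> (\<forall>r\<in>S. X' (\<iota> r) = push A' \<iota> (X r)))"

text \<open>Gauss formula: \<open>h(X,Y)\<close> at \<open>q\<close> is the normal component of \<open>\<nabla>\<^sub>X Y\<close>, computed with any extensions
  of \<open>X\<close> and \<open>Y\<close> from a neighbourhood of \<open>q\<close> in the submanifold to the ambient manifold. Only when
  the induced metric is nondegenerate is the normal component determined.\<close>

definition second_fundamental_form ::
    "('b::topological_space, 'f::euclidean_space) chart set \<Rightarrow>
     ('a, 'e::euclidean_space) chart set \<Rightarrow> ('b \<Rightarrow> 'a) \<Rightarrow>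
     ('a \<Rightarrow> 'a tvec \<Rightarrow> 'a tvec \<Rightarrow> real) \<Rightarrow> 'a connection \<Rightarrow>
     'b vfield \<Rightarrow> 'b vfield \<Rightarrow> 'b \<Rightarrow> 'a tvec"
  where "second_fundamental_form A A' \<iota> g nabla X Y q = (THE n. n \<in> normal_space A A' \<iota> g q \<and>
    (\<exists>X' Y'. extends_near A' \<iota> q X X' \<and> extends_near A' \<iota> q Y Y' \<and>
       nabla X' Y' (\<iota> q) - n \<in> push A' \<iota> ` tangent_space A q))"

text \<open>\<open>\<phi>X\<close> as a vector field on the submanifold, for \<open>X\<close> with \<open>\<phi>X\<close> tangent to it.\<close>

definition phi_field ::
    "('b, 'f::euclidean_space) chart set \<Rightarrow> ('a, 'e::euclidean_space) chart set \<Rightarrow> ('b \<Rightarrow> 'a) \<Rightarrow>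
     ('a \<Rightarrow> 'a tvec \<Rightarrow> 'a tvec) \<Rightarrow> 'b vfield \<Rightarrow> 'b vfield"
  where "phi_field A A' \<iota> \<phi> X = (\<lambda>q.
    inv_into (tangent_space A q) (push A' \<iota>) (\<phi> (\<iota> q) (push A' \<iota> (X q))))"

end

theory Submission
  imports Defs
begin

text \<open>By the LP-Sasakian identity, \<open>\<nabla>\<^sub>X(\<phi>Y) - \<nabla>\<^sub>Y(\<phi>X) = \<phi>[X,Y] + \<eta>(Y)X - \<eta>(X)Y\<close>, so for \<open>X, Y\<close> in \<open>D\<close> the vector
  \<open>h(\<phi>X,Y) - h(\<phi>Y,X)\<close> is, up to sign, the normal component of \<open>\<phi>[X,Y]\<close>. As \<open>\<phi>\<close> maps \<open>D\<close> to \<open>D\<close> and the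
  orthogonal complement of \<open>D\<close> injectively to the normal space, it vanishes iff \<open>[X,Y]\<close> lies in \<open>D\<close>.
  Involutivity is equivalent to integrability by the Frobenius theorem. For its nontrivial half the
  leaf through a point is the graph of the solution \<open>u\<close> of a total differential equation
  \<open>Du(t) = E(u(t))\<close>; solving it along the rays through the origin suffices, since involutivity makes
  the solution differentiable with the right derivative in the other directions as well.\<close>

section \<open>Calculus of smooth functions\<close>

text \<open>The metric is indefinite, so the tangent spaces of a submanifold could be degenerate and
  \<open>h\<close> undetermined. The timelike tangent vector \<xi> excludes this: its orthogonal
  complement is positive definite, so normal components exist and only 0 is both normal and tangent.
  That \<xi> lies in \<open>D\<close> has a further effect: \<eta> vanishes on the complement of
  \<open>D\<close>, where \<phi> applied twice is then the identity; hence the injectivity.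

  Tangent vectors act on global smooth functions and connections on global fields, while charts,
  frames and slices are local. Bump functions mediate, which explains the many statements that some
  global object agrees with a given one near a point. As \<iota> is only an immersion, functions and
  fields on the submanifold extend to the ambient manifold only near a point, so \<open>h\<close> is
  treated one point at a time.

  Solving along rays confines the analysis to one contraction and one Gronwall type estimate; flows
  and smooth dependence on initial values do not enter.\<close>

lemma Ck_on_subset: "Ck_on k f S \<Longrightarrow> T \<subseteq> S \<Longrightarrow> Ck_on k f T"
  by (induction k arbitrary: f) (auto intro: continuous_on_subset)

text \<open>\<open>Ck_on\<close> refers to full derivatives at the points of S, and these see a
  neighbourhood of each point; hence the openness.\<close>

lemma Ck_on_cong_open:
  assumes "open S" and "\<And>x. x \<in> S \<Longrightarrow> f x = g x" and "Ck_on k f S"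
  shows "Ck_on k g S"
  using assms
proof (induction k arbitrary: f g)
  case 0
  then show ?case by (auto cong: continuous_on_cong)
next
  case (Suc k)
  have d: "(g has_derivative frechet_derivative f (at x)) (at x)" if "x \<in> S" for x
    using has_derivative_transform_within_open[of f _ x UNIV S g] Suc.prems that
    by (metis Ck_on.simps(2) frechet_derivative_works)
  then have e: "frechet_derivative g (at x) = frechet_derivative f (at x)" if "x \<in> S" for x
    using frechet_derivative_at that by metis
  show ?case
    using d e Suc.prems Suc.IH[of "\<lambda>x. frechet_derivative f (at x) v" "\<lambda>x. frechet_derivative g (at x) v" for v]
    by (auto simp: differentiable_def)
qed

text \<open>Allows an explicit derivative in place of \<open>frechet_derivative\<close>. Most
  inductions on k below compute such a derivative and treat its terms by the induction
  hypothesis.\<close>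

lemma Ck_on_SucI:
  assumes "open S" and "\<And>x. x \<in> S \<Longrightarrow> (f has_derivative f' x) (at x)"
    and "\<And>v. Ck_on k (\<lambda>x. f' x v) S"
  shows "Ck_on (Suc k) f S"
proof -
  have e: "f' x v = frechet_derivative f (at x) v" if "x \<in> S" for x v
    using frechet_derivative_at[OF assms(2)[OF that]] by metis
  have "Ck_on k (\<lambda>x. frechet_derivative f (at x) v) S" for v
    by (rule Ck_on_cong_open[OF assms(1) _ assms(3)]) (rule e)
  then show ?thesis using assms(2) by (auto simp: differentiable_def)
qed

lemma Ck_on_Suc_has_derivative:
  "Ck_on (Suc k) f S \<Longrightarrow> x \<in> S \<Longrightarrow> (f has_derivative frechet_derivative f (at x)) (at x)"
  by (simp add: frechet_derivative_works)

lemma Ck_on_SucD: "Ck_on (Suc k) f S \<Longrightarrow> Ck_on k f S"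
proof (induction k arbitrary: f)
  case 0
  then show ?case
    by (auto intro!: continuous_at_imp_continuous_on differentiable_imp_continuous_within)
next
  case (Suc k)
  then show ?case by (metis Ck_on.simps(2))
qed

lemma Ck_on_mono: "Ck_on k f S \<Longrightarrow> j \<le> k \<Longrightarrow> Ck_on j f S"
  by (induction k) (auto simp: le_Suc_eq simp del: Ck_on.simps dest: Ck_on_SucD)

lemma Ck_on_local:
  assumes "\<And>x. x \<in> S \<Longrightarrow> \<exists>U. open U \<and> x \<in> U \<and> Ck_on k f U"
  shows "Ck_on k f S"
  using assms
proof (induction k arbitrary: f)
  case 0
  show ?case unfolding Ck_on.simps
  proof (rule continuous_at_imp_continuous_on, rule ballI)
    fix x assume "x \<in> S"
    with 0 show "isCont f x" by (metis Ck_on.simps(1) continuous_on_eq_continuous_at)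
  qed
next
  case (Suc k)
  then show ?case by (metis Ck_on.simps(2))
qed

lemma Ck_on_const [simp]: "Ck_on k (\<lambda>x. c) S"
proof (induction k arbitrary: c)
  case (Suc k)
  then show ?case by (simp add: frechet_derivative_const)
qed simp

lemma Ck_on_bounded_linear:
  assumes "open S" "bounded_linear L"
  shows "Ck_on k L S"
proof (cases k)
  case 0
  then show ?thesis using assms by (simp add: linear_continuous_on)
next
  case (Suc j)
  then show ?thesis
    using Ck_on_SucI[of S L "\<lambda>_. L" j] assms bounded_linear_imp_has_derivative by auto
qed

lemma Ck_on_id: "open S \<Longrightarrow> Ck_on k (\<lambda>x. x) S"
  by (rule Ck_on_bounded_linear) (auto intro: bounded_linear_ident)

lemma Ck_on_compose_bounded_linear:
  assumes "open S" "bounded_linear L" "Ck_on k f S"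
  shows "Ck_on k (\<lambda>x. L (f x)) S"
  using assms(3)
proof (induction k arbitrary: f)
  case 0
  then show ?case using assms(2)
    by (auto intro: bounded_linear.continuous_on)
next
  case (Suc k)
  show ?case
  proof (rule Ck_on_SucI[OF assms(1)])
    fix x assume "x \<in> S"
    then show "((\<lambda>x. L (f x)) has_derivative (\<lambda>v. L (frechet_derivative f (at x) v))) (at x)"
      using Suc.prems assms(2) bounded_linear.has_derivative Ck_on_Suc_has_derivative by metis
  qed (use Suc in auto)
qed

lemma Ck_on_add:
  assumes "open S" "Ck_on k f S" "Ck_on k g S"
  shows "Ck_on k (\<lambda>x. f x + g x) S"
  using assms(2,3)
proof (induction k arbitrary: f g)
  case 0
  then show ?case by (auto intro: continuous_on_add)
next
  case (Suc k)
  show ?case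
  proof (rule Ck_on_SucI[OF assms(1)])
    fix x assume "x \<in> S"
    then show "((\<lambda>x. f x + g x) has_derivative
       (\<lambda>v. frechet_derivative f (at x) v + frechet_derivative g (at x) v)) (at x)"
      using Suc.prems Ck_on_Suc_has_derivative has_derivative_add by metis
  qed (use Suc in auto)
qed

lemma Ck_on_sum:
  assumes "open S" "\<And>i. i \<in> I \<Longrightarrow> Ck_on k (f i) S"
  shows "Ck_on k (\<lambda>x. \<Sum>i\<in>I. f i x) S"
  using assms(2)
  by (induction I rule: infinite_finite_induct) (auto intro!: Ck_on_add assms(1))

lemma Ck_on_bilinear:
  assumes "bounded_bilinear B" "open S" "Ck_on k f S" "Ck_on k g S"
  shows "Ck_on k (\<lambda>x. B (f x) (g x)) S"
  using assms(3,4)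
proof (induction k arbitrary: f g)
  case 0
  then show ?case using bounded_bilinear.continuous_on[OF assms(1)] by auto
next
  case (Suc k)
  have "Ck_on k f S" "Ck_on k g S" using Suc.prems Ck_on_SucD by blast+
  moreover have "Ck_on k (\<lambda>x. frechet_derivative f (at x) v) S"
    "Ck_on k (\<lambda>x. frechet_derivative g (at x) v) S" for v
    using Suc.prems by auto
  ultimately have "Ck_on k (\<lambda>x. B (f x) (frechet_derivative g (at x) v) +
      B (frechet_derivative f (at x) v) (g x)) S" for v
    by (intro Ck_on_add Suc.IH assms(2))
  moreover have "((\<lambda>x. B (f x) (g x)) has_derivative
      (\<lambda>v. B (f x) (frechet_derivative g (at x) v) + B (frechet_derivative f (at x) v) (g x))) (at x)"
    if "x \<in> S" for x
    using Suc.prems that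
    by (intro bounded_bilinear.FDERIV[OF assms(1)] Ck_on_Suc_has_derivative)
  ultimately show ?case by (rule Ck_on_SucI[OF assms(2), rotated])
qed

text \<open>The chain rule evaluates the derivative of f in the varying direction
  \<open>?g' x v\<close>, whereas \<open>Ck_on\<close> speaks of fixed directions only. Expanding
  that direction in the basis leaves a finite sum of products, to which the induction hypothesis
  applies.\<close>

lemma Ck_on_compose:
  fixes f :: "'f::euclidean_space \<Rightarrow> 'g::real_normed_vector" and g :: "'e::euclidean_space \<Rightarrow> 'f"
  assumes "open S" "Ck_on k g S" "Ck_on k f T" "g ` S \<subseteq> T"
  shows "Ck_on k (\<lambda>x. f (g x)) S"
  using assms(2,3)
proof (induction k arbitrary: f)
  case 0
  then show ?case using assms(4) by (auto intro: continuous_on_compose2)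
next
  case (Suc k)
  let ?f' = "\<lambda>x. frechet_derivative f (at x)" and ?g' = "\<lambda>x. frechet_derivative g (at x)"
  have f': "(f has_derivative ?f' (g x)) (at (g x))" if "x \<in> S" for x
    using Ck_on_Suc_has_derivative Suc.prems that assms(4) by blast
  have g': "(g has_derivative ?g' x) (at x)" if "x \<in> S" for x
    using Ck_on_Suc_has_derivative Suc.prems that by blast
  have "((\<lambda>x. f (g x)) has_derivative (\<lambda>v. \<Sum>b\<in>Basis. (?g' x v \<bullet> b) *\<^sub>R ?f' (g x) b)) (at x)"
    if "x \<in> S" for x
  proof -
    interpret linear "?f' (g x)" using f'[OF that] by (rule has_derivative_linear)
    have "?f' (g x) (?g' x v) = (\<Sum>b\<in>Basis. (?g' x v \<bullet> b) *\<^sub>R ?f' (g x) b)" for v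
      by (subst euclidean_representation[symmetric, of "?g' x v"], simp only: sum scale)
    then show ?thesis
      using has_derivative_compose[OF g'[OF that] f'[OF that]] by simp
  qed
  moreover have "Ck_on k (\<lambda>x. \<Sum>b\<in>Basis. (?g' x v \<bullet> b) *\<^sub>R ?f' (g x) b) S" for v
  proof (intro Ck_on_sum assms(1) Ck_on_bilinear[OF bounded_bilinear_scaleR])
    fix b :: 'f assume "b \<in> Basis"
    show "Ck_on k (\<lambda>x. ?g' x v \<bullet> b) S"
      using Suc.prems by (intro Ck_on_compose_bounded_linear[OF assms(1) bounded_linear_inner_left]) auto
    show "Ck_on k (\<lambda>x. ?f' (g x) b) S"
      using Suc.prems Ck_on_SucD by (intro Suc.IH) auto
  qed
  ultimately show ?case by (rule Ck_on_SucI[OF assms(1)])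
qed

lemma Ck_on_inverse:
  fixes f :: "'e::euclidean_space \<Rightarrow> real"
  assumes "open S" "Ck_on k f S" "\<And>x. x \<in> S \<Longrightarrow> f x \<noteq> 0"
  shows "Ck_on k (\<lambda>x. inverse (f x)) S"
  using assms(2)
proof (induction k)
  case 0
  then show ?case using assms(3) by (auto intro: continuous_on_inverse)
next
  case (Suc k)
  note I = Suc.IH[OF Ck_on_SucD[OF Suc.prems]]
  have "Ck_on k (\<lambda>x. - (inverse (f x) * frechet_derivative f (at x) v * inverse (f x))) S" for v
    using Suc.prems
    by (intro Ck_on_compose_bounded_linear[OF assms(1) bounded_linear_minus[OF bounded_linear_ident]]
        Ck_on_bilinear[OF bounded_bilinear_mult] I assms(1)) auto
  moreover have "((\<lambda>x. inverse (f x)) has_derivative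
      (\<lambda>v. - (inverse (f x) * frechet_derivative f (at x) v * inverse (f x)))) (at x)" if "x \<in> S" for x
    by (rule Deriv.has_derivative_inverse[OF assms(3)[OF that] Ck_on_Suc_has_derivative[OF Suc.prems that]])
  ultimately show ?case by (rule Ck_on_SucI[OF assms(1), rotated])
qed

section \<open>Closure properties of smooth maps\<close>

lemma smooth_on_subset: "smooth_on f S \<Longrightarrow> T \<subseteq> S \<Longrightarrow> smooth_on f T"
  by (auto simp: smooth_on_def intro: Ck_on_subset)

lemma smooth_on_cong_open:
  "open S \<Longrightarrow> (\<And>x. x \<in> S \<Longrightarrow> f x = g x) \<Longrightarrow> smooth_on f S \<Longrightarrow> smooth_on g S"
  unfolding smooth_on_def by (blast intro: Ck_on_cong_open)

lemma smooth_on_local: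
  "(\<And>x. x \<in> S \<Longrightarrow> \<exists>U. open U \<and> x \<in> U \<and> smooth_on f U) \<Longrightarrow> smooth_on f S"
  unfolding smooth_on_def by (meson Ck_on_local)

lemma smooth_on_const [simp]: "smooth_on (\<lambda>x. c) S"
  by (simp add: smooth_on_def)

lemma smooth_on_bounded_linear: "open S \<Longrightarrow> bounded_linear L \<Longrightarrow> smooth_on L S"
  by (simp add: smooth_on_def Ck_on_bounded_linear)

lemma smooth_on_id: "open S \<Longrightarrow> smooth_on (\<lambda>x. x) S"
  by (simp add: smooth_on_def Ck_on_id)

lemma smooth_on_compose_bounded_linear:
  "open S \<Longrightarrow> bounded_linear L \<Longrightarrow> smooth_on f S \<Longrightarrow> smooth_on (\<lambda>x. L (f x)) S"
  by (simp add: smooth_on_def Ck_on_compose_bounded_linear)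

lemma smooth_on_inner_const: "open S \<Longrightarrow> smooth_on f S \<Longrightarrow> smooth_on (\<lambda>x. f x \<bullet> b) S"
  by (intro smooth_on_compose_bounded_linear[OF _ bounded_linear_inner_left])

lemma smooth_on_add:
  "open S \<Longrightarrow> smooth_on f S \<Longrightarrow> smooth_on g S \<Longrightarrow> smooth_on (\<lambda>x. f x + g x) S"
  by (simp add: smooth_on_def Ck_on_add)

lemma smooth_on_minus: "open S \<Longrightarrow> smooth_on f S \<Longrightarrow> smooth_on (\<lambda>x. - f x) S"
  by (intro smooth_on_compose_bounded_linear[OF _ bounded_linear_minus[OF bounded_linear_ident]])

lemma smooth_on_diff:
  "open S \<Longrightarrow> smooth_on f S \<Longrightarrow> smooth_on g S \<Longrightarrow> smooth_on (\<lambda>x. f x - g x) S"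
  using smooth_on_add[of S f "\<lambda>x. - g x"] smooth_on_minus[of S g] by simp

lemma smooth_on_sum:
  "open S \<Longrightarrow> (\<And>i. i \<in> I \<Longrightarrow> smooth_on (f i) S) \<Longrightarrow> smooth_on (\<lambda>x. \<Sum>i\<in>I. f i x) S"
  by (simp add: smooth_on_def Ck_on_sum)

lemma smooth_on_bilinear:
  "bounded_bilinear B \<Longrightarrow> open S \<Longrightarrow> smooth_on f S \<Longrightarrow> smooth_on g S \<Longrightarrow>
    smooth_on (\<lambda>x. B (f x) (g x)) S"
  by (simp add: smooth_on_def Ck_on_bilinear)

lemmas smooth_on_mult = smooth_on_bilinear[OF bounded_bilinear_mult]
lemmas smooth_on_scaleR = smooth_on_bilinear[OF bounded_bilinear_scaleR]

lemma smooth_on_compose: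
  "open S \<Longrightarrow> smooth_on g S \<Longrightarrow> smooth_on f T \<Longrightarrow> g ` S \<subseteq> T \<Longrightarrow> smooth_on (\<lambda>x. f (g x)) S"
  by (auto simp: smooth_on_def intro: Ck_on_compose)

lemma smooth_on_inverse:
  fixes f :: "'e::euclidean_space \<Rightarrow> real"
  shows "open S \<Longrightarrow> smooth_on f S \<Longrightarrow> (\<And>x. x \<in> S \<Longrightarrow> f x \<noteq> 0) \<Longrightarrow> smooth_on (\<lambda>x. inverse (f x)) S"
  by (simp add: smooth_on_def Ck_on_inverse)

lemma smooth_on_has_derivative:
  "smooth_on f S \<Longrightarrow> x \<in> S \<Longrightarrow> (f has_derivative frechet_derivative f (at x)) (at x)"
  by (meson smooth_on_def Ck_on_Suc_has_derivative)

lemma smooth_on_continuous_on: "smooth_on f S \<Longrightarrow> continuous_on S f"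
  by (meson smooth_on_def Ck_on.simps(1))

lemma smooth_on_frechet_derivative:
  "smooth_on f S \<Longrightarrow> smooth_on (\<lambda>x. frechet_derivative f (at x) v) S"
  unfolding smooth_on_def by (metis Ck_on.simps(2))

lemma frechet_derivative_cong_open:
  assumes "open S" "x \<in> S" "\<And>y. y \<in> S \<Longrightarrow> f y = g y"
  shows "frechet_derivative f (at x) = frechet_derivative g (at x)"
proof -
  have "(f has_derivative D) (at x) \<longleftrightarrow> (g has_derivative D) (at x)" for D
    using has_derivative_transform_within_open[of f D x UNIV S g]
      has_derivative_transform_within_open[of g D x UNIV S f] assms by auto
  then show ?thesis by (simp add: frechet_derivative_def)
qed

subsection \<open>Bump functions\<close>

lemma smooth_on_exp_inverse:
  "smooth_on (\<lambda>t::real. if t > 0 then exp (- inverse t) else 0) UNIV"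
proof -
  \<comment> \<open>The powers of \<open>inverse t\<close> make the family closed under
    differentiation, so that the induction on k can run over all n at once.\<close>
  define \<psi> where "\<psi> n t = (if t > 0 then inverse t ^ n * exp (- inverse t) else 0 :: real)" for n t
  have lim: "((\<lambda>t. inverse t ^ n * exp (- inverse t)) \<longlongrightarrow> 0) (at_right (0::real))" for n
  proof -
    have "((\<lambda>x. x ^ n / exp x) \<longlongrightarrow> 0) (at_top :: real filter)"
      by (rule tendsto_power_div_exp_0)
    then have "((\<lambda>t. inverse t ^ n / exp (inverse t)) \<longlongrightarrow> 0) (at_right (0::real))"
      by (rule filterlim_compose[OF _ filterlim_inverse_at_top_right])
    then show ?thesis by (simp add: exp_minus divide_inverse)
  qed
  have deriv: "(\<psi> n has_real_derivative (- real n * \<psi> (Suc n) t + \<psi> (n + 2) t)) (at t)" for n t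
  proof -
    consider "t > 0" | "t < 0" | "t = 0" by linarith
    then show ?thesis
    proof cases
      case 1
      have "((\<lambda>t. inverse t ^ n * exp (- inverse t)) has_real_derivative
          (- real n * \<psi> (Suc n) t + \<psi> (n + 2) t)) (at t)"
      proof -
        have i: "(inverse has_real_derivative - (inverse t ^ 2)) (at t)"
          using DERIV_inverse[of t UNIV] 1 by (simp add: power2_eq_square)
        have "((\<lambda>t. inverse t ^ n) has_real_derivative - real n * inverse t ^ Suc n) (at t)"
        proof (cases n)
          case (Suc m)
          then show ?thesis
            using DERIV_power[OF i, of "Suc m"] by (simp add: power2_eq_square algebra_simps)
        qed simp
        moreover have "((\<lambda>t. exp (- inverse t)) has_real_derivative exp (- inverse t) * (inverse t ^ 2)) (at t)"
          using DERIV_fun_exp[OF DERIV_minus[OF i]] by simp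
        ultimately show ?thesis
          using DERIV_mult 1 by (fastforce simp: \<psi>_def power2_eq_square algebra_simps)
      qed
      then show ?thesis
        by (rule has_field_derivative_transform_within_open[where S="{0<..}"]) (use 1 in \<open>auto simp: \<psi>_def\<close>)
    next
      case 2
      have "((\<lambda>t. 0) has_real_derivative (- real n * \<psi> (Suc n) t + \<psi> (n + 2) t)) (at t)"
        using 2 by (auto simp: \<psi>_def)
      then show ?thesis
        by (rule has_field_derivative_transform_within_open[where S="{..<0}"]) (use 2 in \<open>auto simp: \<psi>_def\<close>)
    next
      case 3
      \<comment> \<open>At 0 the difference quotient is \<open>\<psi> (Suc n)\<close> from the right
        and 0 from the left, so the derivative is the limit \<open>lim\<close> for the next
        exponent.\<close>
      have "((\<lambda>h. \<psi> n h / h) \<longlongrightarrow> 0) (at_right 0)"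
        by (rule Lim_transform_eventually[OF lim[of "Suc n"]])
          (auto simp: eventually_at_filter \<psi>_def field_simps)
      moreover have "((\<lambda>h. \<psi> n h / h) \<longlongrightarrow> 0) (at_left 0)"
        by (rule Lim_transform_eventually[OF tendsto_const]) (auto simp: eventually_at_filter \<psi>_def)
      ultimately have "((\<lambda>h. \<psi> n h / h) \<longlongrightarrow> 0) (at 0)"
        by (simp add: filterlim_split_at)
      then show ?thesis using 3 by (simp add: DERIV_def \<psi>_def)
    qed
  qed
  have "Ck_on k (\<psi> n) UNIV" for k n
  proof (induction k arbitrary: n)
    case 0
    show ?case using deriv by (auto intro!: continuous_at_imp_continuous_on DERIV_isCont)
  next
    case (Suc k)
    show ?case
    proof (rule Ck_on_SucI)
      show "(\<psi> n has_derivative (\<lambda>v. (- real n * \<psi> (Suc n) t + \<psi> (n + 2) t) * v)) (at t)" for t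
        using deriv has_field_derivative_imp_has_derivative by (metis (no_types))
      show "Ck_on k (\<lambda>x. (- real n * \<psi> (Suc n) x + \<psi> (n + 2) x) * v) UNIV" for v
        by (intro Ck_on_bilinear[OF bounded_bilinear_mult] Ck_on_add Suc.IH) auto
    qed simp
  qed
  then have "smooth_on (\<psi> 0) UNIV" by (simp add: smooth_on_def)
  moreover have "\<psi> 0 = (\<lambda>t. if t > 0 then exp (- inverse t) else 0)"
    by (auto simp: \<psi>_def fun_eq_iff)
  ultimately show ?thesis by simp
qed

text \<open>The function is a / (a + b), where a lives inside radius s and b outside radius r. As r
  < s, they have no common zero. Using the squared distance keeps both smooth at the centre.\<close>

lemma plateau_function:
  fixes p :: "'e::euclidean_space"
  assumes "0 < r" "r < s"
  obtains \<theta> :: "'e \<Rightarrow> real"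
  where "smooth_on \<theta> UNIV" "\<And>x. x \<in> cball p r \<Longrightarrow> \<theta> x = 1" "\<And>x. x \<notin> ball p s \<Longrightarrow> \<theta> x = 0"
proof -
  define \<psi> :: "real \<Rightarrow> real" where "\<psi> t = (if t > 0 then exp (- inverse t) else 0)" for t
  define q where "q x = (x - p) \<bullet> (x - p)" for x
  have q: "q x = (dist p x)\<^sup>2" for x
    by (simp add: q_def dist_norm norm_minus_commute flip: power2_norm_eq_inner)
  have sq: "smooth_on (\<lambda>x. q x) UNIV"
    unfolding q_def
    by (intro smooth_on_bilinear[OF bounded_bilinear_inner] smooth_on_diff smooth_on_id) auto
  have \<psi>: "smooth_on \<psi> UNIV" using smooth_on_exp_inverse by (simp add: \<psi>_def [abs_def])
  define a where "a x = \<psi> (s\<^sup>2 - q x)" for x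
  define b where "b x = \<psi> (q x - r\<^sup>2)" for x
  have sm: "smooth_on a UNIV" "smooth_on b UNIV"
    unfolding a_def b_def by (auto intro!: smooth_on_compose[OF _ _ \<psi>] smooth_on_diff sq)
  have rs: "r\<^sup>2 < s\<^sup>2" using assms by (simp add: power_strict_mono)
  have pos: "a x + b x \<noteq> 0" for x
    using rs by (auto simp: a_def b_def \<psi>_def add_nonneg_eq_0_iff add_eq_0_iff not_less) (smt (verit) exp_gt_zero)+
  show ?thesis
  proof (rule that[of "\<lambda>x. a x * inverse (a x + b x)"])
    show "smooth_on (\<lambda>x. a x * inverse (a x + b x)) UNIV"
      by (intro smooth_on_mult smooth_on_inverse smooth_on_add sm pos) auto
    show "a x * inverse (a x + b x) = 1" if "x \<in> cball p r" for x
    proof -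
      have "q x \<le> r\<^sup>2" using that assms by (simp add: q power_mono)
      then have "b x = 0" by (simp add: b_def \<psi>_def)
      then show ?thesis using pos[of x] by simp
    qed
    show "a x * inverse (a x + b x) = 0" if "x \<notin> ball p s" for x
    proof -
      have "q x \<ge> s\<^sup>2" using that assms by (simp add: q power_mono)
      then show ?thesis by (simp add: a_def \<psi>_def)
    qed
  qed
qed

subsection \<open>Hadamard's lemma\<close>

text \<open>Bundling the derivative as a bounded operator gives it a norm, so that its continuity,
  its smoothness and its integral over a parameter make sense.\<close>

definition Dblinfun :: "('e::euclidean_space \<Rightarrow> 'f::real_normed_vector) \<Rightarrow> 'e \<Rightarrow> 'e \<Rightarrow>\<^sub>L 'f"
  where "Dblinfun f x = Blinfun (frechet_derivative f (at x))"

lemma Dblinfun_apply: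
  "f differentiable (at x) \<Longrightarrow> Dblinfun f x v = frechet_derivative f (at x) v"
  unfolding Dblinfun_def
  by (simp add: bounded_linear_Blinfun_apply frechet_derivative_works has_derivative_bounded_linear)

text \<open>An operator is the sum of rank one operators depending linearly on its columns. This
  reduces smoothness of operator valued maps to that of their columns.\<close>

lemma blinfun_eq_sum_Basis:
  fixes T :: "'e::euclidean_space \<Rightarrow>\<^sub>L 'f::real_normed_vector"
  shows "T = (\<Sum>b\<in>Basis. blinfun_scaleR_left (T b) o\<^sub>L blinfun_inner_left b)"
proof (rule blinfun_eqI)
  fix v
  have "T v = T (\<Sum>b\<in>Basis. (v \<bullet> b) *\<^sub>R b)" by (simp add: euclidean_representation)
  also have "\<dots> = (\<Sum>b\<in>Basis. (v \<bullet> b) *\<^sub>R T b)" by (simp add: blinfun.sum_right blinfun.scaleR_right)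
  finally show "T v = (\<Sum>b\<in>Basis. blinfun_scaleR_left (T b) o\<^sub>L blinfun_inner_left b) v"
    by (simp add: blinfun.sum_left)
qed

lemma Ck_on_blinfun_componentwise:
  fixes F :: "'e::euclidean_space \<Rightarrow> 'g::euclidean_space \<Rightarrow>\<^sub>L 'f::real_normed_vector"
  assumes "open S" "\<And>b. b \<in> Basis \<Longrightarrow> Ck_on k (\<lambda>x. F x b) S"
  shows "Ck_on k F S"
proof -
  have "bounded_linear (\<lambda>w. blinfun_scaleR_left w o\<^sub>L blinfun_inner_left b)" for b :: 'g
    by (intro bounded_linear_compose[OF bounded_bilinear.bounded_linear_left[OF bounded_bilinear_blinfun_compose]
        bounded_linear_blinfun_scaleR_left])
  then have "Ck_on k (\<lambda>x. \<Sum>b\<in>Basis. blinfun_scaleR_left (F x b) o\<^sub>L blinfun_inner_left b) S"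
    using assms Ck_on_compose_bounded_linear by (intro Ck_on_sum) blast+
  then show ?thesis by (simp flip: blinfun_eq_sum_Basis)
qed

lemma smooth_on_blinfun_componentwise:
  fixes F :: "'e::euclidean_space \<Rightarrow> 'g::euclidean_space \<Rightarrow>\<^sub>L 'f::real_normed_vector"
  assumes "open S" "\<And>b. b \<in> Basis \<Longrightarrow> smooth_on (\<lambda>x. F x b) S"
  shows "smooth_on F S"
  using assms unfolding smooth_on_def by (blast intro: Ck_on_blinfun_componentwise)

lemma smooth_on_differentiable: "smooth_on f S \<Longrightarrow> x \<in> S \<Longrightarrow> f differentiable (at x)"
  using smooth_on_has_derivative differentiable_def by blast

lemma smooth_on_has_derivative_Dblinfun:
  assumes "smooth_on f S" "x \<in> S"
  shows "(f has_derivative blinfun_apply (Dblinfun f x)) (at x)"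
proof -
  have "blinfun_apply (Dblinfun f x) = frechet_derivative f (at x)"
    using Dblinfun_apply[OF smooth_on_differentiable[OF assms]] by blast
  then show ?thesis using smooth_on_has_derivative[OF assms] by simp
qed

lemma Ck_on_Dblinfun:
  assumes "open S" "Ck_on (Suc k) f S"
  shows "Ck_on k (Dblinfun f) S"
  using assms
  by (intro Ck_on_blinfun_componentwise Ck_on_cong_open[OF assms(1) Dblinfun_apply[symmetric]]) auto

lemma smooth_on_Dblinfun: "open S \<Longrightarrow> smooth_on f S \<Longrightarrow> smooth_on (Dblinfun f) S"
  unfolding smooth_on_def by (blast intro: Ck_on_Dblinfun)

text \<open>Differentiating under the integral sign produces a factor t. The weight
  \<open>t ^ m\<close> with arbitrary m absorbs it, which closes the induction.\<close>

lemma Ck_on_segment_integral: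
  fixes \<phi> :: "'e::euclidean_space \<Rightarrow> real"
  assumes S: "open S" "convex S" "x0 \<in> S" and "Ck_on k \<phi> S"
  shows "Ck_on k (\<lambda>x. integral (cbox 0 1) (\<lambda>t. t ^ m * \<phi> (x0 + t *\<^sub>R (x - x0)))) S"
  using assms(4)
proof (induction k arbitrary: \<phi> m)
  case (0 \<phi>)
  have seg: "x0 + t *\<^sub>R (x - x0) \<in> S" if "x \<in> S" "t \<in> cbox 0 1" for x and t :: real
    using convexD_alt[OF S(2) S(3) that(1), of t] that(2) by (simp add: algebra_simps)
  have c\<phi>: "continuous_on S \<phi>" using 0 by simp
  have "continuous_on (S \<times> cbox 0 1) (\<lambda>(x, t). t ^ m * \<phi> (x0 + t *\<^sub>R (x - x0)))"
    unfolding split_beta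
  proof (rule continuous_on_mult)
    show "continuous_on (S \<times> cbox 0 1) (\<lambda>z. \<phi> (x0 + snd z *\<^sub>R (fst z - x0)))"
      by (rule continuous_on_compose2[OF c\<phi>]) (use seg in \<open>auto intro!: continuous_intros\<close>)
  qed (intro continuous_intros)
  from integral_continuous_on_param[OF this] show ?case by simp
next
  case (Suc k)
  have seg: "x0 + t *\<^sub>R (x - x0) \<in> S" if "x \<in> S" "t \<in> cbox 0 1" for x and t :: real
    using convexD_alt[OF S(2) S(3) that(1), of t] that(2) by (simp add: algebra_simps)
  define F where "F x t = t ^ Suc m *\<^sub>R Dblinfun \<phi> (x0 + t *\<^sub>R (x - x0))" for x and t :: real
  have cD: "continuous_on S (Dblinfun \<phi>)"
    using Ck_on_mono[OF Ck_on_Dblinfun[OF S(1) Suc.prems], of 0] by simp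
  have c\<phi>: "continuous_on S \<phi>"
    using Ck_on_mono[OF Suc.prems, of 0] by simp
  have contF: "continuous_on (S \<times> cbox 0 1) (\<lambda>(x, t). F x t)"
    unfolding F_def using seg
    by (auto simp: split_beta intro!: continuous_intros continuous_on_compose2[OF cD])
  have diff: "\<phi> differentiable (at x)" if "x \<in> S" for x
    using Suc.prems that by simp
  have F_apply: "F x t v = t ^ Suc m * frechet_derivative \<phi> (at (x0 + t *\<^sub>R (x - x0))) v"
    if "x \<in> S" "t \<in> cbox 0 1" for x t v
    using Dblinfun_apply[OF diff[OF seg[OF that]]] by (simp add: F_def blinfun.scaleR_left)
  have Fd: "((\<lambda>x. t ^ m * \<phi> (x0 + t *\<^sub>R (x - x0))) has_derivative blinfun_apply (F x t)) (at x within S)"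
    if "x \<in> S" "t \<in> cbox 0 1" for x t
  proof -
    have 1: "(\<phi> has_derivative frechet_derivative \<phi> (at (x0 + t *\<^sub>R (x - x0)))) (at (x0 + t *\<^sub>R (x - x0)))"
      using diff[OF seg[OF that]] frechet_derivative_works by blast
    have 2: "((\<lambda>x. x0 + t *\<^sub>R (x - x0)) has_derivative (\<lambda>v. t *\<^sub>R v)) (at x)"
      by (auto intro!: derivative_eq_intros)
    have "((\<lambda>x. t ^ m * \<phi> (x0 + t *\<^sub>R (x - x0))) has_derivative
        (\<lambda>v. t ^ m * frechet_derivative \<phi> (at (x0 + t *\<^sub>R (x - x0))) (t *\<^sub>R v))) (at x)"
      by (rule has_derivative_mult_right[OF has_derivative_compose[OF 2 1]])
    moreover have "t ^ m * frechet_derivative \<phi> (at (x0 + t *\<^sub>R (x - x0))) (t *\<^sub>R v) = F x t v" for v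
      using F_apply[OF that] linear_cmul[OF has_derivative_linear[OF 1]] by simp
    ultimately show ?thesis by (simp add: has_derivative_at_withinI)
  qed
  have int: "(\<lambda>t. t ^ m * \<phi> (x0 + t *\<^sub>R (x - x0))) integrable_on cbox 0 1" if "x \<in> S" for x
    using that seg by (intro integrable_continuous continuous_intros continuous_on_compose2[OF c\<phi>]) auto
  have intF: "F x integrable_on cbox 0 1" if "x \<in> S" for x
    unfolding F_def
    using that seg by (intro integrable_continuous continuous_intros continuous_on_compose2[OF cD]) auto
  have D: "((\<lambda>x. integral (cbox 0 1) (\<lambda>t. t ^ m * \<phi> (x0 + t *\<^sub>R (x - x0)))) has_derivative
      blinfun_apply (integral (cbox 0 1) (F x))) (at x)" if "x \<in> S" for x
    using leibniz_rule[OF Fd int contF that S(2)] at_within_open[OF that S(1)] by simp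
  show ?case
  proof (rule Ck_on_SucI[OF S(1) D])
    fix v
    have "Ck_on k (\<lambda>x. integral (cbox 0 1)
        (\<lambda>t. t ^ Suc m * frechet_derivative \<phi> (at (x0 + t *\<^sub>R (x - x0))) v)) S"
      using Suc.prems by (intro Suc.IH) simp
    moreover have "integral (cbox 0 1) (\<lambda>t. t ^ Suc m * frechet_derivative \<phi> (at (x0 + t *\<^sub>R (x - x0))) v) =
        integral (cbox 0 1) (F x) v" if "x \<in> S" for x
      unfolding blinfun_apply_integral[OF intF[OF that]]
      by (rule Henstock_Kurzweil_Integration.integral_cong) (simp add: F_apply that)
    ultimately show "Ck_on k (\<lambda>x. integral (cbox 0 1) (F x) v) S"
      by (rule Ck_on_cong_open[OF S(1), rotated])
  qed
qed

text \<open>The fundamental theorem of calculus along the segment from x0 to x, with the derivative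
  in direction \<open>x - x0\<close> expanded in the basis. The remainder is kept as smooth
  coefficients, not as an estimate, so that derivations can be applied to it.\<close>

lemma Hadamard_lemma:
  fixes f :: "'e::euclidean_space \<Rightarrow> real"
  assumes S: "open S" "convex S" "x0 \<in> S" and f: "smooth_on f S"
  obtains G where "\<And>b. smooth_on (G b) S" "\<And>b. G b x0 = frechet_derivative f (at x0) b"
    "\<And>x. x \<in> S \<Longrightarrow> f x = f x0 + (\<Sum>b\<in>Basis. ((x - x0) \<bullet> b) * G b x)"
proof
  let ?f' = "\<lambda>x. frechet_derivative f (at x)"
  \<comment> \<open>The factor \<open>t ^ 0\<close> only brings the integral into the form of
    \<open>Ck_on_segment_integral\<close>.\<close>
  define G where "G b x = integral (cbox 0 1) (\<lambda>t. t ^ 0 * ?f' (x0 + t *\<^sub>R (x - x0)) b)" for b x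
  show "smooth_on (G b) S" for b
    using smooth_on_frechet_derivative[OF f, of b] unfolding smooth_on_def G_def
    by (intro allI Ck_on_segment_integral[OF S]) auto
  show "G b x0 = ?f' x0 b" for b by (simp add: G_def)
  fix x assume x: "x \<in> S"
  have seg: "x0 + t *\<^sub>R (x - x0) \<in> S" if "t \<in> cbox 0 1" for t :: real
    using convexD_alt[OF S(2) S(3) x, of t] that by (simp add: algebra_simps)
  have lin: "?f' y v = (\<Sum>b\<in>Basis. (v \<bullet> b) * ?f' y b)" if "y \<in> S" for y v
  proof -
    interpret linear "?f' y" using smooth_on_has_derivative[OF f that] by (rule has_derivative_linear)
    show ?thesis
      by (subst euclidean_representation[symmetric, of v], simp only: sum scale real_scaleR_def)
  qed
  have cont: "continuous_on (cbox 0 1) (\<lambda>t::real. ?f' (x0 + t *\<^sub>R (x - x0)) b)" for b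
    using seg by (intro continuous_on_compose2[OF smooth_on_continuous_on[OF smooth_on_frechet_derivative[OF f]]]
        continuous_intros) auto
  have "((\<lambda>t. f (x0 + t *\<^sub>R (x - x0))) has_vector_derivative ?f' (x0 + t *\<^sub>R (x - x0)) (x - x0)) (at t within {0..1})"
    if "t \<in> {0..1}" for t
  proof -
    have 1: "(f has_derivative ?f' (x0 + t *\<^sub>R (x - x0))) (at (x0 + t *\<^sub>R (x - x0)))"
      using seg that by (intro smooth_on_has_derivative[OF f]) auto
    have 2: "((\<lambda>t. x0 + t *\<^sub>R (x - x0)) has_derivative (\<lambda>s. s *\<^sub>R (x - x0))) (at t within {0..1})"
      by (auto intro!: derivative_eq_intros)
    show ?thesis
      unfolding has_vector_derivative_def
      using has_derivative_compose[OF 2 1] linear_cmul[OF has_derivative_linear[OF 1]] by simp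
  qed
  then have "((\<lambda>t. ?f' (x0 + t *\<^sub>R (x - x0)) (x - x0)) has_integral
      f (x0 + 1 *\<^sub>R (x - x0)) - f (x0 + 0 *\<^sub>R (x - x0))) {0..1}"
    by (intro fundamental_theorem_of_calculus) auto
  then have "f x - f x0 = integral (cbox 0 1) (\<lambda>t. ?f' (x0 + t *\<^sub>R (x - x0)) (x - x0))"
    by (simp add: integral_unique)
  also have "\<dots> = integral (cbox 0 1) (\<lambda>t. \<Sum>b\<in>Basis. ((x - x0) \<bullet> b) * ?f' (x0 + t *\<^sub>R (x - x0)) b)"
    using lin seg by (intro Henstock_Kurzweil_Integration.integral_cong) blast
  also have "\<dots> = (\<Sum>b\<in>Basis. integral (cbox 0 1) (\<lambda>t. ((x - x0) \<bullet> b) * ?f' (x0 + t *\<^sub>R (x - x0)) b))"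
    by (intro integral_sum finite_Basis integrable_continuous continuous_intros cont)
  also have "\<dots> = (\<Sum>b\<in>Basis. ((x - x0) \<bullet> b) * G b x)"
    by (simp add: G_def)
  finally show "f x = f x0 + (\<Sum>b\<in>Basis. ((x - x0) \<bullet> b) * G b x)" by simp
qed

subsection \<open>Smoothness of operator inverses and of inverse functions\<close>

text \<open>A product rule in which the first factor is merely continuous. This suffices because the
  other factor vanishes at x, so that the variation of the first one contributes only to second
  order.\<close>

lemma bilinear_has_derivative_zero_factor:
  assumes B: "bounded_bilinear B" and c: "isCont c x" and d: "(\<delta> has_derivative \<delta>') (at x)" "\<delta> x = 0"
  shows "((\<lambda>y. B (c y) (\<delta> y)) has_derivative (\<lambda>v. B (c x) (\<delta>' v))) (at x)"
proof -
  interpret bounded_bilinear B by fact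
  have bl: "bounded_linear \<delta>'" using d has_derivative_bounded_linear by blast
  have 1: "((\<lambda>y. B (c x) (\<delta> y)) has_derivative (\<lambda>v. B (c x) (\<delta>' v))) (at x)"
    by (rule bounded_linear.has_derivative[OF bounded_linear_right d(1)])
  obtain K where K: "K > 0" "\<And>a b. norm (B a b) \<le> norm a * norm b * K"
    using pos_bounded by blast
  obtain M where M: "M > 0" "\<And>v. norm (\<delta>' v) \<le> norm v * M"
    using bounded_linear.pos_bounded[OF bl] by blast
  have 2: "((\<lambda>y. B (c y - c x) (\<delta> y)) has_derivative (\<lambda>v. 0)) (at x)"
    unfolding has_derivative_at_alt
  proof (intro conjI allI impI)
    fix e :: real assume e: "e > 0"
    obtain d1 where d1: "d1 > 0" "\<And>y. norm (y - x) < d1 \<Longrightarrow> norm (\<delta> y - \<delta> x - \<delta>' (y - x)) \<le> 1 * norm (y - x)"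
      using d(1) unfolding has_derivative_at_alt using zero_less_one by blast
    have "e / (K * (1 + M)) > 0" using e K M by simp
    then obtain d2 where d2: "d2 > 0" "\<And>y. dist y x < d2 \<Longrightarrow> dist (c y) (c x) < e / (K * (1 + M))"
      using c unfolding continuous_at_eps_delta by meson
    show "\<exists>d>0. \<forall>y. norm (y - x) < d \<longrightarrow>
        norm (B (c y - c x) (\<delta> y) - B (c x - c x) (\<delta> x) - 0) \<le> e * norm (y - x)"
    proof (intro exI[of _ "min d1 d2"] conjI allI impI)
      fix y assume y: "norm (y - x) < min d1 d2"
      have "norm (\<delta> y) \<le> norm (\<delta> y - \<delta> x - \<delta>' (y - x)) + norm (\<delta>' (y - x))"
        using norm_triangle_ineq[of "\<delta> y - \<delta> x - \<delta>' (y - x)" "\<delta>' (y - x)"] d(2) by simp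
      also have "\<dots> \<le> (1 + M) * norm (y - x)"
        using d1(2)[of y] M(2)[of "y - x"] y by (simp add: algebra_simps)
      finally have n\<delta>: "norm (\<delta> y) \<le> (1 + M) * norm (y - x)" .
      have nc: "norm (c y - c x) \<le> e / (K * (1 + M))"
        using d2(2)[of y] y by (simp add: dist_norm)
      have "norm (B (c y - c x) (\<delta> y)) \<le> norm (c y - c x) * norm (\<delta> y) * K" by (rule K)
      also have "\<dots> \<le> (e / (K * (1 + M))) * ((1 + M) * norm (y - x)) * K"
        using nc n\<delta> K M e by (intro mult_right_mono mult_mono) auto
      also have "\<dots> = e * norm (y - x)" using K M by simp
      finally show "norm (B (c y - c x) (\<delta> y) - B (c x - c x) (\<delta> x) - 0) \<le> e * norm (y - x)"
        by (simp add: zero_left)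
    qed (use d1 d2 in auto)
  qed simp
  from has_derivative_add[OF 1 2] show ?thesis by (simp add: diff_left)
qed

text \<open>The resolvent identity \<open>G y - G x = G y (F x - F y) G x\<close> has a middle
  factor that vanishes at y = x, so continuity of G already yields its derivative. That derivative
  is a product of G and the derivative of F, and the regularity of G rises step by step.\<close>

lemma Ck_on_operator_inverse:
  fixes F :: "'e::euclidean_space \<Rightarrow> 'f::euclidean_space \<Rightarrow>\<^sub>L 'f"
  assumes S: "open S" and F: "Ck_on k F S" and G: "continuous_on S G"
    and inv: "\<And>x. x \<in> S \<Longrightarrow> F x o\<^sub>L G x = id_blinfun" "\<And>x. x \<in> S \<Longrightarrow> G x o\<^sub>L F x = id_blinfun"
  shows "Ck_on k G S"
  using F
proof (induction k)
  case 0
  then show ?case using G by simp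
next
  case (Suc k)
  let ?F' = "\<lambda>x. frechet_derivative F (at x)"
  note I = Suc.IH[OF Ck_on_SucD[OF Suc.prems]]
  have "Ck_on k (\<lambda>x. G x o\<^sub>L (- ?F' x v o\<^sub>L G x)) S" for v
    using Suc.prems
    by (intro Ck_on_bilinear[OF bounded_bilinear_blinfun_compose S] I
        Ck_on_compose_bounded_linear[OF S bounded_linear_minus[OF bounded_linear_ident]]) simp
  moreover have "(G has_derivative (\<lambda>v. G x o\<^sub>L (- ?F' x v o\<^sub>L G x))) (at x)" if x: "x \<in> S" for x
  proof -
    have "((\<lambda>y. F x - F y) has_derivative (\<lambda>v. - ?F' x v)) (at x)"
      using has_derivative_diff[OF has_derivative_const Ck_on_Suc_has_derivative[OF Suc.prems x]] by simp
    then have "((\<lambda>y. (F x - F y) o\<^sub>L G x) has_derivative (\<lambda>v. - ?F' x v o\<^sub>L G x)) (at x)"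
      by (rule bounded_linear.has_derivative[OF
          bounded_bilinear.bounded_linear_left[OF bounded_bilinear_blinfun_compose]])
    then have "((\<lambda>y. G y o\<^sub>L ((F x - F y) o\<^sub>L G x)) has_derivative (\<lambda>v. G x o\<^sub>L (- ?F' x v o\<^sub>L G x))) (at x)"
      using G x S by (intro bilinear_has_derivative_zero_factor[OF bounded_bilinear_blinfun_compose])
        (auto simp: continuous_on_eq_continuous_at)
    then have "((\<lambda>y. G x + (G y o\<^sub>L ((F x - F y) o\<^sub>L G x))) has_derivative (\<lambda>v. G x o\<^sub>L (- ?F' x v o\<^sub>L G x))) (at x)"
      using has_derivative_add[OF has_derivative_const[of "G x" "at x"]] by simp
    moreover have "G x + (G y o\<^sub>L ((F x - F y) o\<^sub>L G x)) = G y" if "y \<in> S" for y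
    proof (rule blinfun_eqI)
      fix v
      have "F x (G x v) = v" "G y (F y (G x v)) = G x v"
        using inv(1)[OF x] inv(2)[OF that] by (metis blinfun_apply_blinfun_compose blinfun_apply_id_blinfun)+
      then show "(G x + (G y o\<^sub>L ((F x - F y) o\<^sub>L G x))) v = G y v"
        by (simp add: blinfun.add_left blinfun.diff_left blinfun.diff_right)
    qed
    ultimately show ?thesis
      using has_derivative_transform_within_open[OF _ S x] by blast
  qed
  ultimately show ?case by (rule Ck_on_SucI[OF S, rotated])
qed

text \<open>Distance at most 1/2 from the identity gives \<open>norm v \<le> 2 * norm (T v)\<close>.
  This yields injectivity, hence bijectivity in finite dimension, and also bounds the inverse by
  2.\<close>

lemma operator_near_id_inverse:
  fixes T :: "'f::euclidean_space \<Rightarrow>\<^sub>L 'f"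
  assumes "norm (T - id_blinfun) \<le> 1/2"
  obtains R where "T o\<^sub>L R = id_blinfun" "R o\<^sub>L T = id_blinfun" "norm R \<le> 2"
proof -
  have lb: "norm v \<le> 2 * norm (T v)" for v
  proof -
    have "norm ((T - id_blinfun) v) \<le> 1/2 * norm v"
      using norm_blinfun[of "T - id_blinfun" v] assms
      by (meson mult_right_mono norm_ge_zero order_trans)
    then have "norm (T v - v) \<le> 1/2 * norm v" by (simp add: blinfun.diff_left)
    then show ?thesis using norm_triangle_ineq2[of v "v - T v"] by (simp add: norm_minus_commute)
  qed
  have lin: "linear T" by (simp add: bounded_linear.linear blinfun.bounded_linear_right)
  have inj: "inj T"
    unfolding linear_injective_0[OF lin]
    using lb by (metis mult_zero_right norm_le_zero_iff norm_zero)
  then have surj: "surj T" using lin linear_inj_imp_surj by blast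
  have li: "linear (inv T)" using lin inj surj by (simp add: bij_betw_def inj_linear_imp_inv_linear)
  have ap: "blinfun_apply (Blinfun (inv T)) = inv T"
    by (rule bounded_linear_Blinfun_apply) (simp add: li linear_conv_bounded_linear[symmetric])
  show ?thesis
  proof (rule that[of "Blinfun (inv T)"])
    show "T o\<^sub>L Blinfun (inv T) = id_blinfun"
      by (rule blinfun_eqI) (simp add: ap surj_f_inv_f surj)
    show "Blinfun (inv T) o\<^sub>L T = id_blinfun"
      by (rule blinfun_eqI) (simp add: ap inj)
    show "norm (Blinfun (inv T)) \<le> 2"
      by (rule norm_blinfun_bound) (use lb[of "inv T _"] in \<open>auto simp: ap surj_f_inv_f surj\<close>)
  qed
qed

lemma smooth_operator_inverse:
  fixes F :: "'e::euclidean_space \<Rightarrow> 'f::euclidean_space \<Rightarrow>\<^sub>L 'f"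
  assumes S: "open S" and F: "smooth_on F S" and "\<And>x. x \<in> S \<Longrightarrow> norm (F x - id_blinfun) \<le> 1/2"
  obtains G where "smooth_on G S"
    "\<And>x. x \<in> S \<Longrightarrow> F x o\<^sub>L G x = id_blinfun" "\<And>x. x \<in> S \<Longrightarrow> G x o\<^sub>L F x = id_blinfun"
proof -
  have "\<forall>x\<in>S. \<exists>R. F x o\<^sub>L R = id_blinfun \<and> R o\<^sub>L F x = id_blinfun \<and> norm R \<le> 2"
    using operator_near_id_inverse[OF assms(3)] by metis
  then obtain G where G: "\<And>x. x \<in> S \<Longrightarrow> F x o\<^sub>L G x = id_blinfun"
      "\<And>x. x \<in> S \<Longrightarrow> G x o\<^sub>L F x = id_blinfun" "\<And>x. x \<in> S \<Longrightarrow> norm (G x) \<le> 2"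
    by metis
  \<comment> \<open>The resolvent identity again; the bound 2 on both inverses gives the constant 4,
    hence continuity of G although its values were chosen pointwise.\<close>
  have lip: "dist (G y) (G x) \<le> 4 * dist (F y) (F x)" if "x \<in> S" "y \<in> S" for x y
  proof -
    have "G y - G x = G y o\<^sub>L ((F x - F y) o\<^sub>L G x)"
    proof (rule blinfun_eqI)
      fix v
      have "F x (G x v) = v" "G y (F y (G x v)) = G x v"
        using G that by (metis blinfun_apply_blinfun_compose blinfun_apply_id_blinfun)+
      then show "(G y - G x) v = (G y o\<^sub>L ((F x - F y) o\<^sub>L G x)) v"
        by (simp add: blinfun.diff_left blinfun.diff_right)
    qed
    also have "norm \<dots> \<le> norm (G y) * (norm (F x - F y) * norm (G x))"
      by (meson norm_blinfun_compose order_trans mult_left_mono norm_ge_zero)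
    also have "\<dots> \<le> 2 * (norm (F x - F y) * 2)"
      using G that by (intro mult_mono) auto
    finally show ?thesis by (simp add: dist_norm norm_minus_commute)
  qed
  have "continuous_on S G"
    unfolding continuous_on_iff
  proof (intro ballI allI impI)
    fix x and e :: real assume x: "x \<in> S" and "e > 0"
    then obtain d where d: "d > 0" "\<And>y. y \<in> S \<Longrightarrow> dist y x < d \<Longrightarrow> dist (F y) (F x) < e / 4"
      using smooth_on_continuous_on[OF F] unfolding continuous_on_iff
      by (metis zero_less_divide_iff zero_less_numeral)
    show "\<exists>d>0. \<forall>x'\<in>S. dist x' x < d \<longrightarrow> dist (G x') (G x) < e"
      using d(1)
    proof (intro exI[of _ d] conjI ballI impI)
      fix y assume y: "y \<in> S" "dist y x < d"
      show "dist (G y) (G x) < e" using d(2)[OF y] lip[OF x y(1)] by simp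
    qed
  qed
  then have "smooth_on G S"
    using F G Ck_on_operator_inverse[OF S] unfolding smooth_on_def by blast
  with G show ?thesis using that by blast
qed

text \<open>The inverse g has derivative \<open>G (g y)\<close>, where G inverts the derivative of
  f; so if g is of class k, it is of class k + 1. The normalisation of the derivative at x0 puts
  nearby derivatives within the range of \<open>smooth_operator_inverse\<close>.\<close>

lemma smooth_inverse_function:
  fixes f :: "'e::euclidean_space \<Rightarrow> 'e"
  assumes S: "open S" "x0 \<in> S" and f: "smooth_on f S" and id: "frechet_derivative f (at x0) = (\<lambda>v. v)"
  obtains U V g where "open U" "U \<subseteq> S" "x0 \<in> U" "open V" "homeomorphism U V f g" "smooth_on g V"
proof -
  have id': "Dblinfun f x0 = id_blinfun"
    by (rule blinfun_eqI) (simp add: Dblinfun_apply smooth_on_differentiable[OF f S(2)] id)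
  note sD = smooth_on_Dblinfun[OF S(1) f]
  define S' where "S' = S \<inter> Dblinfun f -` ball id_blinfun (1/2)"
  have S': "open S'" "x0 \<in> S'" "S' \<subseteq> S"
    using continuous_open_preimage[OF smooth_on_continuous_on[OF sD] S(1) open_ball] S(2)
    by (auto simp: S'_def id')
  have near: "norm (Dblinfun f x - id_blinfun) \<le> 1/2" if "x \<in> S'" for x
    using that by (auto simp: S'_def dist_norm norm_minus_commute)
  obtain G where G: "smooth_on G S'" "\<And>x. x \<in> S' \<Longrightarrow> Dblinfun f x o\<^sub>L G x = id_blinfun"
     "\<And>x. x \<in> S' \<Longrightarrow> G x o\<^sub>L Dblinfun f x = id_blinfun"
    using smooth_operator_inverse[OF S'(1) smooth_on_subset[OF sD S'(3)] near] by blast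
  have d: "(f has_derivative blinfun_apply (Dblinfun f x)) (at x)" if "x \<in> S'" for x
    using that S'(3) by (intro smooth_on_has_derivative_Dblinfun[OF f]) auto
  have inv0: "id_blinfun o\<^sub>L Dblinfun f x0 = id_blinfun"
    by (rule blinfun_eqI) (simp add: id')
  obtain U V g g' where *: "open U" "U \<subseteq> S'" "x0 \<in> U" "open V" "f x0 \<in> V" "homeomorphism U V f g"
    and g': "\<And>y. y \<in> V \<Longrightarrow> (g has_derivative (g' y)) (at y)"
    "\<And>y. y \<in> V \<Longrightarrow> g' y = inv (blinfun_apply (Dblinfun f (g y)))"
    "\<And>y. y \<in> V \<Longrightarrow> bij (blinfun_apply (Dblinfun f (g y)))"
    using inverse_function_theorem[OF S'(1) d
        continuous_on_subset[OF smooth_on_continuous_on[OF sD] S'(3)] S'(2) inv0] by blast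
  have gV: "g y \<in> S'" if "y \<in> V" for y
    using *(2,6) that by (auto simp: homeomorphism_def)
  have g'': "g' y v = G (g y) v" if "y \<in> V" for y v
  proof -
    have "Dblinfun f (g y) (G (g y) v) = v"
      using G(2)[OF gV[OF that]] by (metis blinfun_apply_blinfun_compose blinfun_apply_id_blinfun)
    then have "inv (Dblinfun f (g y)) v = inv (Dblinfun f (g y)) (Dblinfun f (g y) (G (g y) v))" by simp
    also have "\<dots> = G (g y) v" by (rule inv_f_f[OF bij_is_inj[OF g'(3)[OF that]]])
    finally show ?thesis using g'(2)[OF that] by simp
  qed
  have "Ck_on k g V" for k
  proof (induction k)
    case 0
    then show ?case using * by (simp add: homeomorphism_def)
  next
    case (Suc k)
    have "Ck_on k (\<lambda>y. G (g y)) V"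
      using G(1) gV unfolding smooth_on_def by (intro Ck_on_compose[OF *(4) Suc]) auto
    then have "Ck_on k (\<lambda>y. G (g y) v) V" for v
      by (rule Ck_on_compose_bounded_linear[OF *(4) blinfun.bounded_linear_left])
    from Ck_on_cong_open[OF *(4) g''[symmetric] this] have "Ck_on k (\<lambda>y. g' y v) V" for v .
    from Ck_on_SucI[OF *(4) g'(1) this] show ?case .
  qed
  then have "smooth_on g V" by (simp add: smooth_on_def)
  then show ?thesis using that * S'(3) by blast
qed

section \<open>Total differential equations\<close>

text \<open>A Gronwall estimate on the unit interval. If M is the maximum of the norm of w, the mean
  value inequality gives M \<le> M / 2 + C.\<close>

lemma norm_le_of_derivative_bound:
  fixes w :: "real \<Rightarrow> 'f::real_normed_vector"
  assumes w0: "w 0 = 0"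
    and d: "\<And>s. s \<in> {0..1} \<Longrightarrow> (w has_vector_derivative w' s) (at s within {0..1})"
    and b: "\<And>s. s \<in> {0..1} \<Longrightarrow> norm (w' s) \<le> norm (w s) / 2 + C"
    and s: "s \<in> {0..1}"
  shows "norm (w s) \<le> 2 * C"
proof -
  have "continuous_on {0..1} w"
    unfolding continuous_on_eq_continuous_within using has_vector_derivative_continuous[OF d] by blast
  then have "\<exists>m\<in>{0..1}. \<forall>s\<in>{0..1}. norm (w s) \<le> norm (w m)"
    by (intro continuous_attains_sup continuous_on_norm) auto
  then obtain m where m: "m \<in> {0..1}" "\<And>s. s \<in> {0..1} \<Longrightarrow> norm (w s) \<le> norm (w m)" by blast
  have B: "norm (w' s) \<le> norm (w m) / 2 + C" if "s \<in> {0..1}" for s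
    using b[OF that] m(2)[OF that] by simp
  have "norm (w m - w 0) \<le> (norm (w m) / 2 + C) * norm (m - 0)"
  proof (rule differentiable_bound[of "{0..1}" w "\<lambda>s v. v *\<^sub>R w' s"])
    show "(w has_derivative (\<lambda>v. v *\<^sub>R w' s)) (at s within {0..1})" if "s \<in> {0..1}" for s
      using d[OF that] by (simp add: has_vector_derivative_def)
    show "onorm (\<lambda>v. v *\<^sub>R w' s) \<le> norm (w m) / 2 + C" if "s \<in> {0..1}" for s
      using B[OF that] by (intro onorm_le) (simp add: mult.commute mult_left_mono)
  qed (use m in auto)
  also have "\<dots> \<le> (norm (w m) / 2 + C) * 1"
    using m(1) order_trans[OF norm_ge_zero B[of 0]] by (intro mult_left_mono) auto
  finally have "norm (w m) \<le> 2 * C" using w0 by simp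
  then show ?thesis using m(2)[OF s] by linarith
qed

text \<open>The solution along the rays through the origin, as a Banach fixed point in the space of
  continuous functions on a ball; precomposition with the projection to the ball makes these
  functions on the whole space.\<close>

lemma radial_ode_solution:
  fixes E :: "'f::euclidean_space \<Rightarrow> 'g::euclidean_space \<Rightarrow>\<^sub>L 'f"
  assumes \<rho>: "\<rho> > 0" and r: "r > 0" "r * K \<le> \<rho>" "r * L \<le> 1/2" and "L \<ge> 0"
    and E: "continuous_on (cball x0 \<rho>) E" and K: "\<And>x. x \<in> cball x0 \<rho> \<Longrightarrow> norm (E x) \<le> K"
    and L: "\<And>x y. x \<in> cball x0 \<rho> \<Longrightarrow> y \<in> cball x0 \<rho> \<Longrightarrow> norm (E x - E y) \<le> L * norm (x - y)"
  obtains u :: "'g \<Rightarrow> 'f" where "u 0 = x0" "\<And>t. t \<in> cball 0 r \<Longrightarrow> u t \<in> cball x0 \<rho>"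
    "\<And>t s. t \<in> cball 0 r \<Longrightarrow> s \<in> {0..1} \<Longrightarrow>
      ((\<lambda>s. u (s *\<^sub>R t)) has_vector_derivative E (u (s *\<^sub>R t)) t) (at s within {0..1})"
proof -
  define c :: "'g \<Rightarrow> 'g" where "c = closest_point (cball 0 r)"
  have c_in: "c t \<in> cball 0 r" for t
    unfolding c_def using r by (intro closest_point_in_set) auto
  have c_id: "c t = t" if "t \<in> cball 0 r" for t
    unfolding c_def by (rule closest_point_self[OF that])
  have c_cont: "continuous_on T c" for T
    unfolding c_def using r by (intro continuous_on_closest_point) auto
  have K0: "K \<ge> 0" using K[of x0] \<rho> order_trans[OF norm_ge_zero] by force
  define X where "X = {w :: 'g \<Rightarrow>\<^sub>C 'f. \<forall>t. w t \<in> cball x0 \<rho>}"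
  \<comment> \<open>On the ray through t the equation is equivalent to u(t) = x0 plus this integral.
    \<open>r * K \<le> \<rho>\<close> keeps the values in the ball around x0, and
    \<open>r * L \<le> 1/2\<close> makes T a contraction.\<close>
  define T where "T w t = x0 + integral (cbox 0 1) (\<lambda>s::real. E (apply_bcontfun w (s *\<^sub>R c t)) (c t))" for w t
  have contE: "continuous_on (UNIV \<times> cbox 0 1) (\<lambda>(t, s::real). E (apply_bcontfun w (s *\<^sub>R c t)) (c t))"
    if "w \<in> X" for w
    unfolding split_beta
  proof (intro continuous_intros)
    show "continuous_on (UNIV \<times> cbox 0 1) (\<lambda>z. E (apply_bcontfun w (snd z *\<^sub>R c (fst z))))"
      by (rule continuous_on_compose2[OF E])
        (use that in \<open>auto simp: X_def intro!: continuous_intros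
          continuous_on_compose2[OF continuous_on_apply_bcontfun[of UNIV]]
          continuous_on_compose2[OF c_cont[of UNIV]]\<close>)
    show "continuous_on (UNIV \<times> cbox 0 1) (\<lambda>z. c (fst z))"
      by (intro continuous_on_compose2[OF c_cont[of UNIV]] continuous_intros) auto
  qed
  have int: "(\<lambda>s::real. E (apply_bcontfun w (s *\<^sub>R c t)) (c t)) integrable_on cbox 0 1" if "w \<in> X" for w t
  proof (rule integrable_continuous)
    have "continuous_on (cbox 0 1) (\<lambda>s. (\<lambda>(t, s::real). E (apply_bcontfun w (s *\<^sub>R c t)) (c t)) (t, s))"
      by (rule continuous_on_compose2[OF contE[OF that]]) (auto intro!: continuous_intros)
    then show "continuous_on (cbox 0 1) (\<lambda>s::real. E (apply_bcontfun w (s *\<^sub>R c t)) (c t))" by simp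
  qed
  have bound: "norm (E (apply_bcontfun w (s *\<^sub>R c t)) (c t)) \<le> K * r" if "w \<in> X" for w t s
  proof -
    have "norm (E (apply_bcontfun w (s *\<^sub>R c t)) (c t)) \<le> norm (E (apply_bcontfun w (s *\<^sub>R c t))) * norm (c t)"
      by (rule norm_blinfun)
    also have "\<dots> \<le> K * r"
      using that c_in[of t] K0 by (intro mult_mono K) (auto simp: X_def)
    finally show ?thesis .
  qed
  have T_in: "T w t \<in> cball x0 \<rho>" if "w \<in> X" for w t
  proof -
    have "norm (integral (cbox 0 1) (\<lambda>s::real. E (apply_bcontfun w (s *\<^sub>R c t)) (c t))) \<le> K * r * measure lborel (cbox 0 (1::real))"
      using K0 r bound[OF that] by (intro integrable_bound int[OF that]) auto
    then show ?thesis using r by (simp add: T_def dist_norm mult.commute)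
  qed
  have T_cont: "continuous_on UNIV (T w)" if "w \<in> X" for w
    unfolding T_def using integral_continuous_on_param[OF contE[OF that]] by (intro continuous_intros)
  have T_b: "T w \<in> bcontfun" if "w \<in> X" for w
  proof -
    have "range (T w) \<subseteq> cball x0 \<rho>" using T_in[OF that] by blast
    then show ?thesis
      using T_cont[OF that] bounded_subset[OF bounded_cball] unfolding bcontfun_def by blast
  qed
  have ap: "apply_bcontfun (Bcontfun (T w)) = T w" if "w \<in> X" for w
    using Bcontfun_inverse[OF T_b[OF that]] .
  have "\<exists>!w\<in>X. Bcontfun (T w) = w"
  proof (rule Banach_fix)
    have "X = PiC UNIV (\<lambda>_. cball x0 \<rho>)" by (auto simp: X_def mem_PiC_iff Pi_iff)
    then show "complete X" by (simp add: complete_eq_closed closed_PiC)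
    have "const_bcontfun x0 \<in> X" using \<rho> by (simp add: X_def const_bcontfun.rep_eq)
    then show "X \<noteq> {}" by blast
    show "(0::real) \<le> 1/2" "1/2 < (1::real)" by auto
    show "(\<lambda>w. Bcontfun (T w)) ` X \<subseteq> X" using T_in ap by (auto simp: X_def)
    fix v w assume vw: "v \<in> X" "w \<in> X"
    show "dist (Bcontfun (T v)) (Bcontfun (T w)) \<le> 1/2 * dist v w"
    proof (rule dist_bound)
      fix t
      have b: "norm (E (v (s *\<^sub>R c t)) (c t) - E (w (s *\<^sub>R c t)) (c t)) \<le> L * dist v w * r" for s
      proof -
        have "norm ((E (v (s *\<^sub>R c t)) - E (w (s *\<^sub>R c t))) (c t)) \<le>
            norm (E (v (s *\<^sub>R c t)) - E (w (s *\<^sub>R c t))) * norm (c t)"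
          by (rule norm_blinfun)
        also have "\<dots> \<le> (L * norm (v (s *\<^sub>R c t) - w (s *\<^sub>R c t))) * r"
          using vw c_in[of t] \<open>L \<ge> 0\<close> by (intro mult_mono L) (auto simp: X_def)
        also have "\<dots> \<le> L * dist v w * r"
          using \<open>L \<ge> 0\<close> r dist_bounded[of v _ w] by (intro mult_right_mono mult_left_mono) (auto simp: dist_norm)
        finally show ?thesis by (simp add: blinfun.diff_left)
      qed
      have "dist (T v t) (T w t) = norm (integral (cbox 0 1)
          (\<lambda>s::real. E (v (s *\<^sub>R c t)) (c t) - E (w (s *\<^sub>R c t)) (c t)))"
        using int[OF vw(1), of t] int[OF vw(2), of t]
        by (simp add: T_def dist_norm Henstock_Kurzweil_Integration.integral_diff)
      also have "\<dots> \<le> L * dist v w * r * measure lborel (cbox 0 (1::real))"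
        using \<open>L \<ge> 0\<close> r b by (intro integrable_bound integrable_diff int vw) auto
      also have "\<dots> = r * L * dist v w" by simp
      also have "\<dots> \<le> 1/2 * dist v w" using r by (intro mult_right_mono) auto
      finally show "dist (Bcontfun (T v) t) (Bcontfun (T w) t) \<le> 1/2 * dist v w"
        by (simp add: ap vw)
    qed
  qed
  then obtain w where w: "w \<in> X" "Bcontfun (T w) = w" by blast
  have fixp: "w t = x0 + integral {0..1} (\<lambda>s. E (w (s *\<^sub>R t)) t)" if "t \<in> cball 0 r" for t
  proof -
    have "w t = T w t" using ap[OF w(1)] by (simp only: w(2))
    also have "\<dots> = x0 + integral {0..1} (\<lambda>s. E (w (s *\<^sub>R t)) t)"
      by (simp add: T_def c_id[OF that])
    finally show ?thesis .
  qed
  have wX: "w t \<in> cball x0 \<rho>" for t using w(1) by (simp add: X_def)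
  show ?thesis
  proof (rule that[of w])
    show "w 0 = x0" using fixp[of 0] r by (simp add: blinfun.zero_right)
    show "w t \<in> cball x0 \<rho>" for t by (rule wX)
    fix t :: 'g and s :: real assume t: "t \<in> cball 0 r" and s: "s \<in> {0..1}"
    have cE: "continuous_on {0..1} (\<lambda>s. E (w (s *\<^sub>R t)) t)"
      using wX by (intro continuous_intros continuous_on_compose2[OF E]
        continuous_on_compose2[OF continuous_on_apply_bcontfun[of UNIV]]) auto
    \<comment> \<open>The fixed point equation at the point \<open>s *\<^sub>R t\<close> integrates
      over the whole unit interval. Rescaling the parameter by s turns this into an integral with
      upper limit s, which can be differentiated; s = 0 is separate because the substitution
      degenerates.\<close>
    have ray: "w (s *\<^sub>R t) = x0 + integral {0..s} (\<lambda>s. E (w (s *\<^sub>R t)) t)" if s: "s \<in> {0..1}" for s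
    proof -
      have st: "s *\<^sub>R t \<in> cball 0 r"
        using s t mult_left_le_one_le[of "norm t" s] by auto
      have "((\<lambda>\<sigma>. E (w (\<sigma> *\<^sub>R t)) t) has_integral integral {0..s} (\<lambda>\<sigma>. E (w (\<sigma> *\<^sub>R t)) t)) {0..s}"
        using s by (intro integrable_integral integrable_continuous_real continuous_on_subset[OF cE]) auto
      then have I: "((\<lambda>\<sigma>. E (w (\<sigma> *\<^sub>R t)) t) has_integral integral {0..s} (\<lambda>\<sigma>. E (w (\<sigma> *\<^sub>R t)) t)) (cbox 0 s)"
        by simp
      have "integral {0..1} (\<lambda>\<sigma>. E (w (\<sigma> *\<^sub>R s *\<^sub>R t)) (s *\<^sub>R t)) = integral {0..s} (\<lambda>\<sigma>. E (w (\<sigma> *\<^sub>R t)) t)"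
      proof (cases "s = 0")
        case False
        then have s0: "s > 0" using s by simp
        have img: "(\<lambda>x. (1 / s) *\<^sub>R x + - ((1 / s) *\<^sub>R 0)) ` cbox 0 s = cbox (0::real) 1"
          using s0 by (auto simp: image_iff field_simps intro!: bexI[of _ "s * _"])
        have "((\<lambda>x. E (w ((s *\<^sub>R x + 0) *\<^sub>R t)) t) has_integral
            (1 / \<bar>s\<bar> ^ DIM(real)) *\<^sub>R integral {0..s} (\<lambda>\<sigma>. E (w (\<sigma> *\<^sub>R t)) t)) (cbox 0 1)"
          using has_integral_affinity[OF I False, of 0] unfolding img .
        then have "((\<lambda>x. s *\<^sub>R E (w ((x * s) *\<^sub>R t)) t) has_integral
            s *\<^sub>R (1 / s) *\<^sub>R integral {0..s} (\<lambda>\<sigma>. E (w (\<sigma> *\<^sub>R t)) t)) {0..1}"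
          using s0 by (intro has_integral_cmul) (simp add: mult.commute)
        then have "integral {0..1} (\<lambda>x. s *\<^sub>R E (w ((x * s) *\<^sub>R t)) t) =
            integral {0..s} (\<lambda>\<sigma>. E (w (\<sigma> *\<^sub>R t)) t)"
          using s0 by (simp only: integral_unique) simp
        then show ?thesis by (simp only: blinfun.scaleR_right scaleR_scaleR)
      qed (simp add: blinfun.zero_right)
      then show ?thesis using fixp[OF st] by simp
    qed
    have "((\<lambda>s. x0 + integral {0..s} (\<lambda>s. E (w (s *\<^sub>R t)) t)) has_vector_derivative
        0 + E (w (s *\<^sub>R t)) t) (at s within {0..1})"
      by (intro has_vector_derivative_add has_vector_derivative_const integral_has_vector_derivative cE s)
    from has_vector_derivative_transform[OF s ray this]
    show "((\<lambda>s. w (s *\<^sub>R t)) has_vector_derivative E (w (s *\<^sub>R t)) t) (at s within {0..1})"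
      by simp
  qed
qed


text \<open>The mean value inequality for f minus its linear part at a.\<close>

lemma blinfun_linearization_bound:
  fixes f :: "'f::real_normed_vector \<Rightarrow> 'h::real_normed_vector"
  assumes "\<And>x. x \<in> closed_segment a b \<Longrightarrow> (f has_derivative blinfun_apply (f' x)) (at x)"
    and "\<And>x. x \<in> closed_segment a b \<Longrightarrow> norm (f' x - f' a) \<le> B"
  shows "norm (f b - f a - f' a (b - a)) \<le> B * norm (b - a)"
proof -
  have "norm ((f b - f' a b) - (f a - f' a a)) \<le> B * norm (b - a)"
  proof (rule differentiable_bound[of "closed_segment a b" "\<lambda>z. f z - f' a z" "\<lambda>x. blinfun_apply (f' x - f' a)"])
    fix x assume x: "x \<in> closed_segment a b"
    have "((\<lambda>z. f z - f' a z) has_derivative (\<lambda>v. f' x v - f' a v)) (at x)"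
      by (intro has_derivative_diff assms(1) x bounded_linear_imp_has_derivative blinfun.bounded_linear_right)
    then show "((\<lambda>z. f z - f' a z) has_derivative blinfun_apply (f' x - f' a)) (at x within closed_segment a b)"
      by (simp add: has_derivative_at_withinI minus_blinfun.rep_eq)
    show "onorm (blinfun_apply (f' x - f' a)) \<le> B"
      using assms(2)[OF x] by (simp add: norm_blinfun.rep_eq)
  qed auto
  then show ?thesis by (simp add: blinfun.diff_right algebra_simps)
qed

text \<open>The deviation \<open>w s = u (s (t + h)) - u (s t) - s E(u(s t)) h\<close> from the expected first order
  increment solves a linear differential equation along the ray, in which the symmetry hypothesis
  cancels every term that is not \<open>o(h)\<close>.\<close>

lemma total_differential_equation:
  fixes E :: "'f::euclidean_space \<Rightarrow> 'g::euclidean_space \<Rightarrow>\<^sub>L 'f"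
  assumes V: "open V" "x0 \<in> V" and E: "smooth_on E V"
    and sym: "\<And>x h t. x \<in> V \<Longrightarrow> frechet_derivative E (at x) (E x h) t = frechet_derivative E (at x) (E x t) h"
  obtains r u where "r > 0" "u 0 = x0" "u ` ball 0 r \<subseteq> V"
    "\<And>t. t \<in> ball 0 r \<Longrightarrow> (u has_derivative E (u t)) (at t)" "smooth_on u (ball 0 r)"
proof -
  obtain \<rho> where \<rho>: "\<rho> > 0" "cball x0 \<rho> \<subseteq> V" using V open_contains_cball by blast
  define E' where "E' = Dblinfun E"
  have E': "(E has_derivative blinfun_apply (E' x)) (at x)" if "x \<in> V" for x
    unfolding E'_def by (rule smooth_on_has_derivative_Dblinfun[OF E that])
  have cE: "continuous_on (cball x0 \<rho>) E"
    by (rule continuous_on_subset[OF smooth_on_continuous_on[OF E] \<rho>(2)])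
  have cE': "continuous_on (cball x0 \<rho>) E'"
    unfolding E'_def by (rule continuous_on_subset[OF smooth_on_continuous_on[OF smooth_on_Dblinfun[OF V(1) E]] \<rho>(2)])
  obtain K where K: "K > 0" "\<And>x. x \<in> cball x0 \<rho> \<Longrightarrow> norm (E x) \<le> K"
    using compact_imp_bounded[OF compact_continuous_image[OF cE compact_cball]] by (auto simp: bounded_pos)
  obtain L where L: "L > 0" "\<And>x. x \<in> cball x0 \<rho> \<Longrightarrow> norm (E' x) \<le> L"
    using compact_imp_bounded[OF compact_continuous_image[OF cE' compact_cball]] by (auto simp: bounded_pos)
  have lip: "norm (E x - E y) \<le> L * norm (x - y)" if "x \<in> cball x0 \<rho>" "y \<in> cball x0 \<rho>" for x y
    using \<rho>(2) L that
    by (intro differentiable_bound[of "cball x0 \<rho>" E "\<lambda>x. blinfun_apply (E' x)"])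
      (auto simp: norm_blinfun.rep_eq[symmetric] intro!: has_derivative_at_withinI E')
  \<comment> \<open>The first entry keeps the solution in the ball around x0. The second gives the
    contraction and also the coefficient 1/2 required by
    \<open>norm_le_of_derivative_bound\<close>.\<close>
  define r where "r = min (\<rho> / K) (1 / (2 * L))"
  have r: "r > 0" "r * K \<le> \<rho>" "r * L \<le> 1/2"
    using \<rho> K(1) L(1) by (auto simp: r_def min_def field_simps split: if_splits)
  obtain u where u: "u 0 = x0" "\<And>t. t \<in> cball 0 r \<Longrightarrow> u t \<in> cball x0 \<rho>"
    "\<And>t s. t \<in> cball 0 r \<Longrightarrow> s \<in> {0..1} \<Longrightarrow>
      ((\<lambda>s. u (s *\<^sub>R t)) has_vector_derivative E (u (s *\<^sub>R t)) t) (at s within {0..1})"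
    using radial_ode_solution[OF \<rho>(1) r less_imp_le[OF L(1)] cE K(2) lip] by blast
  have ray: "s *\<^sub>R t \<in> cball 0 r" if "t \<in> cball 0 r" "s \<in> {0..1}" for s and t :: 'g
    using that mult_left_le_one_le[of "norm t" s] by auto
  have deriv: "(u has_derivative E (u t)) (at t)" if t: "t \<in> ball 0 r" for t
    unfolding has_derivative_at_alt
  proof (intro conjI allI impI)
    show "bounded_linear (E (u t))" by (rule blinfun.bounded_linear_right)
    fix e :: real assume e: "e > 0"
    \<comment> \<open>Chosen so that the linearisation error of E accounts for half of the final
      bound \<open>e * norm h\<close>. The last entry of \<epsilon> below makes the term quadratic
      in h account for the other half; the entry with \<delta> keeps the two solutions so close that
      \<zeta> bounds the variation of \<open>E'\<close>.\<close>
    define \<zeta> where "\<zeta> = e / (8 * K * r)"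
    have \<zeta>: "\<zeta> > 0" using e K r by (simp add: \<zeta>_def)
    obtain \<delta> where \<delta>: "\<delta> > 0" "\<And>x y. x \<in> cball x0 \<rho> \<Longrightarrow> y \<in> cball x0 \<rho> \<Longrightarrow> dist y x < \<delta> \<Longrightarrow> dist (E' y) (E' x) < \<zeta>"
      using compact_uniformly_continuous[OF cE' compact_cball] \<zeta> unfolding uniformly_continuous_on_def by metis
    define \<epsilon> where "\<epsilon> = min (r - norm t) (min (\<delta> / (2 * K)) (e / (8 * L * K)))"
    have "\<epsilon> > 0" using t \<delta> K L e by (simp add: \<epsilon>_def)
    moreover have "norm (u q - u t - E (u t) (q - t)) \<le> e * norm (q - t)" if q: "norm (q - t) < \<epsilon>" for q
    proof -
      define h where "h = q - t"
      have qh: "q = t + h" by (simp add: h_def)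
      have h: "norm h < r - norm t" "2 * K * norm h < \<delta>" "8 * L * K * norm h < e"
        using q K L by (auto simp: h_def \<epsilon>_def field_simps)
      have tr: "t \<in> cball 0 r" "t + h \<in> cball 0 r"
        using t h(1) norm_triangle_ineq[of t h] by auto
      define y where "y s = u (s *\<^sub>R t)" for s
      define z where "z s = u (s *\<^sub>R (t + h))" for s
      have yV: "y s \<in> cball x0 \<rho>" and zV: "z s \<in> cball x0 \<rho>" if "s \<in> {0..1}" for s
        using u(2) ray tr that by (auto simp: y_def z_def)
      have dy: "(y has_vector_derivative E (y s) t) (at s within {0..1})"
        and dz: "(z has_vector_derivative E (z s) (t + h)) (at s within {0..1})" if "s \<in> {0..1}" for s
        using u(3)[OF tr(1) that] u(3)[OF tr(2) that] by (simp_all add: y_def[abs_def] z_def[abs_def])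
      \<comment> \<open>A first, crude estimate: neighbouring rays separate by O(h). It feeds the
        quadratic terms in the estimate of w.\<close>
      have d: "norm (z s - y s) \<le> 2 * (K * norm h)" if "s \<in> {0..1}" for s
      proof (rule norm_le_of_derivative_bound[OF _ _ _ that])
        show "z 0 - y 0 = 0" by (simp add: y_def z_def)
        show "((\<lambda>s. z s - y s) has_vector_derivative E (z s) (t + h) - E (y s) t) (at s within {0..1})"
          if "s \<in> {0..1}" for s
          by (intro has_vector_derivative_diff dy dz that)
        fix s :: real assume s: "s \<in> {0..1}"
        have "norm (E (z s) (t + h) - E (y s) t) = norm ((E (z s) - E (y s)) (t + h) + E (y s) h)"
          by (simp add: blinfun.diff_left blinfun.add_right algebra_simps)
        also have "\<dots> \<le> norm (E (z s) - E (y s)) * norm (t + h) + norm (E (y s)) * norm h"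
          by (intro norm_triangle_le add_mono norm_blinfun)
        also have "\<dots> \<le> L * norm (z s - y s) * r + K * norm h"
          using tr(2) L(1) K(1) by (intro add_mono mult_mono lip yV zV s K) auto
        also have "L * norm (z s - y s) * r = (r * L) * norm (z s - y s)" by simp
        also have "(r * L) * norm (z s - y s) \<le> (1/2) * norm (z s - y s)"
          using r(3) by (intro mult_right_mono) auto
        finally show "norm (E (z s) (t + h) - E (y s) t) \<le> norm (z s - y s) / 2 + K * norm h"
          by simp
      qed
      define C where "C = \<zeta> * (2 * (K * norm h)) * r + L * (2 * (K * norm h)) * norm h"
      define w where "w s = z s - y s - s *\<^sub>R E (y s) h" for s
      define w' where "w' s = E (z s) (t + h) - E (y s) t - (s *\<^sub>R E' (y s) (E (y s) t) h + E (y s) h)" for s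
      have "norm (w 1) \<le> 2 * C"
      proof (rule norm_le_of_derivative_bound[of w w' C])
        show "w 0 = 0" by (simp add: w_def y_def z_def)
        fix s :: real assume s: "s \<in> {0..1}"
        have "(E has_derivative blinfun_apply (E' (y s))) (at (y s))"
          using yV[OF s] \<rho>(2) by (intro E') auto
        then have "((\<lambda>s. E (y s)) has_derivative (\<lambda>v. E' (y s) (v *\<^sub>R E (y s) t))) (at s within {0..1})"
          using dy[OF s] unfolding has_vector_derivative_def by (rule has_derivative_compose[rotated])
        then have "((\<lambda>s. E (y s) h) has_derivative (\<lambda>v. E' (y s) (v *\<^sub>R E (y s) t) h)) (at s within {0..1})"
          by (rule bounded_linear.has_derivative[OF blinfun.bounded_linear_left])
        then have "((\<lambda>s. E (y s) h) has_vector_derivative E' (y s) (E (y s) t) h) (at s within {0..1})"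
          by (simp add: has_vector_derivative_def blinfun.scaleR_right blinfun.scaleR_left)
        then have "((\<lambda>s. s *\<^sub>R E (y s) h) has_vector_derivative s *\<^sub>R E' (y s) (E (y s) t) h + 1 *\<^sub>R E (y s) h)
            (at s within {0..1})"
          by (intro has_vector_derivative_scaleR DERIV_ident)
        then show "(w has_vector_derivative w' s) (at s within {0..1})"
          unfolding w_def[abs_def] w'_def using dy[OF s] dz[OF s]
          by (intro has_vector_derivative_diff) simp_all
        define R where "R = E (z s) - E (y s) - E' (y s) (z s - y s)"
        have sub: "x \<in> cball x0 \<rho>" if "x \<in> closed_segment (y s) (z s)" for x
          using that closed_segment_subset[OF yV[OF s] zV[OF s] convex_cball] by blast
        have R: "norm R \<le> \<zeta> * norm (z s - y s)"
          unfolding R_def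
        proof (rule blinfun_linearization_bound)
          fix x assume x: "x \<in> closed_segment (y s) (z s)"
          show "(E has_derivative blinfun_apply (E' x)) (at x)"
            using sub[OF x] \<rho>(2) by (intro E') auto
          have "dist x (y s) \<le> norm (z s - y s)"
            using segment_bound(1)[OF x] by (simp add: dist_norm norm_minus_commute)
          also have "\<dots> < \<delta>" using d[OF s] h(2) by simp
          finally show "norm (E' x - E' (y s)) \<le> \<zeta>"
            using \<delta>(2)[OF yV[OF s] sub[OF x]] by (simp add: dist_norm less_imp_le)
        qed
        \<comment> \<open>Differentiating \<open>s *\<^sub>R E (y s) h\<close> produces h and t in
          the wrong order. Exchanging them merges this term into \<open>E' (y s) (w s) t\<close>,
          which the estimate can absorb; the two other terms are small compared with h.\<close>
        have symy: "E' (y s) (E (y s) h) t = E' (y s) (E (y s) t) h"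
          using sym[of "y s"] yV[OF s] \<rho>(2) Dblinfun_apply[OF smooth_on_differentiable[OF E]]
          by (auto simp: E'_def)
        have "w' s = R (t + h) + E' (y s) (w s) t + E' (y s) (z s - y s) h"
          unfolding w'_def R_def w_def
          by (simp add: blinfun.diff_left blinfun.diff_right blinfun.add_right blinfun.add_left
              blinfun.scaleR_right blinfun.scaleR_left symy)
        then have "norm (w' s) \<le> norm (R (t + h)) + norm (E' (y s) (w s) t) + norm (E' (y s) (z s - y s) h)"
          by (simp add: norm_triangle_le norm_triangle_ineq add_mono)
        also have "norm (R (t + h)) \<le> \<zeta> * (2 * (K * norm h)) * r"
        proof -
          have "norm R * norm (t + h) \<le> \<zeta> * (2 * (K * norm h)) * r"
            using R d[OF s] \<zeta> K(1) tr(2) by (intro mult_mono) (auto intro: order_trans[OF R] mult_left_mono)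
          then show ?thesis using norm_blinfun[of R "t + h"] by simp
        qed
        also have "norm (E' (y s) (z s - y s) h) \<le> L * (2 * (K * norm h)) * norm h"
        proof -
          have "norm (E' (y s) (z s - y s)) * norm h \<le> L * (2 * (K * norm h)) * norm h"
            using norm_blinfun[of "E' (y s)" "z s - y s"] mult_mono[OF L(2)[OF yV[OF s]] d[OF s]] L(1)
            by (intro mult_right_mono) auto
          then show ?thesis using norm_blinfun[of "E' (y s) (z s - y s)" h] by simp
        qed
        also have "norm (E' (y s) (w s) t) \<le> norm (w s) / 2"
        proof -
          have "norm (E' (y s) (w s) t) \<le> norm (E' (y s) (w s)) * norm t" by (rule norm_blinfun)
          also have "\<dots> \<le> (L * norm (w s)) * r"
            using norm_blinfun[of "E' (y s)" "w s"] mult_right_mono[OF L(2)[OF yV[OF s]], of "norm (w s)"] L(1) tr(1)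
            by (intro mult_mono) auto
          also have "\<dots> = (r * L) * norm (w s)" by simp
          also have "\<dots> \<le> (1/2) * norm (w s)" using r(3) by (intro mult_right_mono) auto
          finally show ?thesis by simp
        qed
        finally show "norm (w' s) \<le> norm (w s) / 2 + C" by (simp add: C_def)
      qed simp
      also have "2 * C = e / 2 * norm h + (8 * L * K * norm h) / 2 * norm h"
        using K(1) r(1) by (simp add: C_def \<zeta>_def field_simps)
      also have "\<dots> \<le> e / 2 * norm h + e / 2 * norm h"
        using h(3) by (intro add_left_mono mult_right_mono divide_right_mono) auto
      also have "\<dots> = e * norm h" by simp
      finally show ?thesis by (simp add: w_def y_def z_def qh)
    qed
    ultimately show "\<exists>d>0. \<forall>q. norm (q - t) < d \<longrightarrow> norm (u q - u t - E (u t) (q - t)) \<le> e * norm (q - t)"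
      by blast
  qed
  have uV: "u ` ball 0 r \<subseteq> V" using u(2) \<rho>(2) by (auto simp: subset_iff)
  \<comment> \<open>The derivative of u is E composed with u, so each class of u gives the next
    one.\<close>
  have "Ck_on k u (ball 0 r)" for k
  proof (induction k)
    case 0
    then show ?case
      using deriv by (auto intro!: continuous_at_imp_continuous_on has_derivative_continuous)
  next
    case (Suc k)
    have "Ck_on k (\<lambda>t. E (u t)) (ball 0 r)"
      using E uV unfolding smooth_on_def by (intro Ck_on_compose[OF open_ball Suc]) auto
    then have "Ck_on k (\<lambda>t. E (u t) v) (ball 0 r)" for v
      by (rule Ck_on_compose_bounded_linear[OF open_ball blinfun.bounded_linear_left])
    from Ck_on_SucI[OF open_ball deriv this] show ?case .
  qed
  then have "smooth_on u (ball 0 r)" by (simp add: smooth_on_def)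
  then show ?thesis using that r(1) u(1) uV deriv by blast
qed

section \<open>Smooth functions and tangent vectors on manifolds\<close>

lemma
  assumes "is_chart c"
  shows chart_open: "open (fst c)" "open (snd c ` fst c)"
    and chart_continuous: "continuous_on (fst c) (snd c)" "continuous_on (snd c ` fst c) (chart_inv c)"
    and chart_inv_chart: "\<And>p. p \<in> fst c \<Longrightarrow> chart_inv c (snd c p) = p"
    and chart_chart_inv: "\<And>x. x \<in> snd c ` fst c \<Longrightarrow> snd c (chart_inv c x) = x"
    and chart_inv_mem: "\<And>x. x \<in> snd c ` fst c \<Longrightarrow> chart_inv c x \<in> fst c"
  using assms by (auto simp: is_chart_def homeomorphism_def)

lemma chart_vimage_open:
  assumes "is_chart c" "open U"
  shows "open {p \<in> fst c. snd c p \<in> U}"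
proof -
  have "{p \<in> fst c. snd c p \<in> U} = fst c \<inter> snd c -` U" by auto
  then show ?thesis
    using continuous_open_preimage[OF chart_continuous(1) chart_open(1) assms(2)] assms(1) by simp
qed

lemma chart_image_open:
  assumes "is_chart c" "open S" "S \<subseteq> fst c"
  shows "open (snd c ` S)"
proof -
  have "snd c ` S = snd c ` fst c \<inter> chart_inv c -` S"
    using chart_inv_chart[OF assms(1)] chart_chart_inv[OF assms(1)] chart_inv_mem[OF assms(1)] assms(3)
    by (auto simp: image_iff)
  then show ?thesis
    using continuous_open_preimage[OF chart_continuous(2) chart_open(2) assms(2)] assms(1) by simp
qed

section \<open>Tangent spaces as vector spaces of derivations\<close>

lemma subspace_tangent_space: "subspace (tangent_space A p)"
  unfolding subspace_def tangent_space_def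
  by (auto simp: plus_fun_def scaleR_fun_def zero_fun_def algebra_simps)

lemmas tangent_space_add = subspace_add[OF subspace_tangent_space]
lemmas tangent_space_scale = subspace_scale[OF subspace_tangent_space]
lemmas tangent_space_diff = subspace_diff[OF subspace_tangent_space]
lemmas tangent_space_0 = subspace_0[OF subspace_tangent_space]
lemmas tangent_space_sum = subspace_sum[OF subspace_tangent_space]

lemma
  assumes "v \<in> tangent_space A p"
  shows tangent_vector_add: "\<And>f g. f \<in> smooth_functions A \<Longrightarrow> g \<in> smooth_functions A \<Longrightarrow>
      v (\<lambda>x. f x + g x) = v f + v g"
    and tangent_vector_scale: "\<And>f r. f \<in> smooth_functions A \<Longrightarrow> v (\<lambda>x. r * f x) = r * v f"
    and tangent_vector_mult: "\<And>f g. f \<in> smooth_functions A \<Longrightarrow> g \<in> smooth_functions A \<Longrightarrow>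
      v (\<lambda>x. f x * g x) = f p * v g + g p * v f"
    and tangent_vector_not_smooth: "\<And>f. f \<notin> smooth_functions A \<Longrightarrow> v f = 0"
  using assms by (auto simp: tangent_space_def)

lemma
  assumes "X \<in> vector_fields A"
  shows vector_field_tangent: "X p \<in> tangent_space A p"
    and vector_field_smooth: "f \<in> smooth_functions A \<Longrightarrow> (\<lambda>p. X p f) \<in> smooth_functions A"
  using assms by (auto simp: vector_fields_def)

text \<open>Smoothness at one point, tested in a single chart of the maximal atlas;
  \<open>smooth_near_chart\<close> shows that the chart does not matter. Functions glued from local
  pieces are checked in this form, since a different chart may be taken at each point.\<close>

definition smooth_near :: "('a::topological_space, 'e::euclidean_space) chart set \<Rightarrow> ('a \<Rightarrow> real) \<Rightarrow> 'a \<Rightarrow> bool"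
  where "smooth_near A f p \<longleftrightarrow> (\<exists>c S. admissible_chart A c \<and> open S \<and> p \<in> S \<and> S \<subseteq> fst c \<and>
    smooth_on (f \<circ> chart_inv c) (snd c ` S))"

lemma smooth_nearI:
  "admissible_chart A c \<Longrightarrow> open S \<Longrightarrow> p \<in> S \<Longrightarrow> S \<subseteq> fst c \<Longrightarrow>
    smooth_on (f \<circ> chart_inv c) (snd c ` S) \<Longrightarrow> smooth_near A f p"
  unfolding smooth_near_def by blast

locale manifold =
  fixes A :: "('a::{t2_space, second_countable_topology}, 'e::euclidean_space) chart set"
  assumes manifold: "smooth_manifold A"
begin

lemma atlas_admissible: "c \<in> A \<Longrightarrow> admissible_chart A c"
  using manifold by (auto simp: smooth_manifold_def admissible_chart_def)

lemma admissible_is_chart: "admissible_chart A c \<Longrightarrow> is_chart c"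
  by (simp add: admissible_chart_def)

lemma atlas_cover: obtains c where "c \<in> A" "admissible_chart A c" "p \<in> fst c"
proof -
  have "p \<in> (\<Union>c\<in>A. fst c)" using manifold by (simp add: smooth_manifold_def)
  then show ?thesis using that atlas_admissible by blast
qed

text \<open>Near each point the transition factors through a chart of the atlas, with which both
  charts are compatible by definition.\<close>

lemma admissible_transition:
  assumes "admissible_chart A c" "admissible_chart A d"
  shows "smooth_transition c d"
  unfolding smooth_transition_def
proof (rule smooth_on_local)
  note ch = admissible_is_chart[OF assms(1)] admissible_is_chart[OF assms(2)]
  fix x assume "x \<in> snd c ` (fst c \<inter> fst d)"
  then obtain p where p: "p \<in> fst c" "p \<in> fst d" "x = snd c p" by auto
  obtain b where b: "b \<in> A" "admissible_chart A b" "p \<in> fst b" using atlas_cover .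
  let ?S = "fst c \<inter> fst d \<inter> fst b"
  have S: "open ?S"
    using chart_open(1)[OF ch(1)] chart_open(1)[OF ch(2)] chart_open(1)[OF admissible_is_chart[OF b(2)]]
    by (intro open_Int)
  have cb: "smooth_on (snd b \<circ> chart_inv c) (snd c ` (fst c \<inter> fst b))"
    using assms(1) b by (auto simp: admissible_chart_def smooth_transition_def)
  have bd: "smooth_on (snd d \<circ> chart_inv b) (snd b ` (fst b \<inter> fst d))"
    using assms(2) b by (auto simp: admissible_chart_def smooth_transition_def)
  have o: "open (snd c ` ?S)" by (rule chart_image_open[OF ch(1) S]) auto
  have "smooth_on (\<lambda>x. (snd d \<circ> chart_inv b) ((snd b \<circ> chart_inv c) x)) (snd c ` ?S)"
    by (rule smooth_on_compose[OF o smooth_on_subset[OF cb] bd])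
      (auto simp: chart_inv_chart[OF ch(1)])
  then have "smooth_on (snd d \<circ> chart_inv c) (snd c ` ?S)"
    by (rule smooth_on_cong_open[OF o, rotated])
      (auto simp: chart_inv_chart[OF ch(1)] chart_inv_chart[OF admissible_is_chart[OF b(2)]])
  then show "\<exists>U. open U \<and> x \<in> U \<and> smooth_on (snd d \<circ> chart_inv c) U"
    using o p b by blast
qed

lemma smooth_near_chart:
  assumes "smooth_near A f p" "admissible_chart A d" "p \<in> fst d"
  obtains S where "open S" "p \<in> S" "S \<subseteq> fst d" "smooth_on (f \<circ> chart_inv d) (snd d ` S)"
proof -
  obtain c S where c: "admissible_chart A c" "open S" "p \<in> S" "S \<subseteq> fst c"
      "smooth_on (f \<circ> chart_inv c) (snd c ` S)"
    using assms(1) by (auto simp: smooth_near_def)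
  note ch = admissible_is_chart[OF c(1)] admissible_is_chart[OF assms(2)]
  let ?T = "S \<inter> fst d"
  have T: "open ?T" using c chart_open(1)[OF ch(2)] by auto
  have o: "open (snd d ` ?T)" by (rule chart_image_open[OF ch(2) T]) auto
  have dc: "smooth_on (snd c \<circ> chart_inv d) (snd d ` (fst d \<inter> fst c))"
    using admissible_transition[OF assms(2) c(1)] by (simp add: smooth_transition_def)
  have "smooth_on (\<lambda>x. (f \<circ> chart_inv c) ((snd c \<circ> chart_inv d) x)) (snd d ` ?T)"
    by (rule smooth_on_compose[OF o smooth_on_subset[OF dc] c(5)])
      (use c(4) in \<open>auto simp: chart_inv_chart[OF ch(2)]\<close>)
  then have "smooth_on (f \<circ> chart_inv d) (snd d ` ?T)"
    by (rule smooth_on_cong_open[OF o, rotated])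
      (use c(4) in \<open>auto simp: chart_inv_chart[OF ch(2)] chart_inv_chart[OF ch(1)] subset_iff\<close>)
  then show ?thesis using that T assms(3) c(3) by blast
qed

lemma smooth_functions_iff: "f \<in> smooth_functions A \<longleftrightarrow> (\<forall>p. smooth_near A f p)"
proof
  assume f: "f \<in> smooth_functions A"
  show "\<forall>p. smooth_near A f p"
  proof
    fix p obtain c where c: "c \<in> A" "admissible_chart A c" "p \<in> fst c" using atlas_cover .
    then show "smooth_near A f p"
      using f chart_open(1)[OF admissible_is_chart[OF c(2)]] unfolding smooth_near_def smooth_functions_def by blast
  qed
next
  assume f: "\<forall>p. smooth_near A f p"
  show "f \<in> smooth_functions A"
    unfolding smooth_functions_def
  proof (intro CollectI ballI smooth_on_local)
    fix c x assume c: "c \<in> A" and "x \<in> snd c ` fst c"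
    then obtain p where p: "p \<in> fst c" "x = snd c p" by blast
    obtain S where "open S" "p \<in> S" "S \<subseteq> fst c" "smooth_on (f \<circ> chart_inv c) (snd c ` S)"
      using smooth_near_chart[OF f[rule_format] atlas_admissible[OF c] p(1)] .
    then show "\<exists>U. open U \<and> x \<in> U \<and> smooth_on (f \<circ> chart_inv c) U"
      using p chart_image_open[OF admissible_is_chart[OF atlas_admissible[OF c]]] by blast
  qed
qed

lemma smooth_near: "f \<in> smooth_functions A \<Longrightarrow> smooth_near A f p"
  by (simp add: smooth_functions_iff)

lemma smooth_functions_chart:
  assumes "f \<in> smooth_functions A" "admissible_chart A c"
  shows "smooth_on (f \<circ> chart_inv c) (snd c ` fst c)"
proof (rule smooth_on_local)
  fix x assume "x \<in> snd c ` fst c"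
  then obtain p where p: "p \<in> fst c" "x = snd c p" by blast
  obtain S where "open S" "p \<in> S" "S \<subseteq> fst c" "smooth_on (f \<circ> chart_inv c) (snd c ` S)"
    using smooth_near_chart[OF smooth_near[OF assms(1)] assms(2) p(1)] .
  then show "\<exists>U. open U \<and> x \<in> U \<and> smooth_on (f \<circ> chart_inv c) U"
    using p chart_image_open[OF admissible_is_chart[OF assms(2)]] by blast
qed

lemma smooth_near_cong:
  assumes "smooth_near A f p" "open S" "p \<in> S" "\<And>q. q \<in> S \<Longrightarrow> f q = g q"
  shows "smooth_near A g p"
proof -
  obtain c T where c: "admissible_chart A c" "open T" "p \<in> T" "T \<subseteq> fst c"
      "smooth_on (f \<circ> chart_inv c) (snd c ` T)"
    using assms(1) by (auto simp: smooth_near_def)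
  note ch = admissible_is_chart[OF c(1)]
  have o: "open (snd c ` (S \<inter> T))" using c assms by (intro chart_image_open[OF ch]) auto
  have "smooth_on (f \<circ> chart_inv c) (snd c ` (S \<inter> T))"
    by (rule smooth_on_subset[OF c(5)]) auto
  then have "smooth_on (g \<circ> chart_inv c) (snd c ` (S \<inter> T))"
    by (rule smooth_on_cong_open[OF o, rotated]) (use c(4) assms(4) in \<open>auto simp: chart_inv_chart[OF ch] subset_iff\<close>)
  then show ?thesis
    unfolding smooth_near_def using c assms by blast
qed

lemma smooth_near_const [simp]: "smooth_near A (\<lambda>q. k) p"
proof -
  obtain c where "c \<in> A" "admissible_chart A c" "p \<in> fst c" using atlas_cover .
  then show ?thesis
    unfolding smooth_near_def using chart_open(1)[OF admissible_is_chart] by (fastforce simp: comp_def)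
qed

lemma smooth_near_binary:
  assumes "smooth_near A f p" "smooth_near A g p"
    and H: "\<And>U (f'::'e \<Rightarrow> real) g'. open U \<Longrightarrow> smooth_on f' U \<Longrightarrow> smooth_on g' U \<Longrightarrow> smooth_on (\<lambda>x. H (f' x) (g' x)) U"
  shows "smooth_near A (\<lambda>q. H (f q) (g q)) p"
proof -
  obtain c where c: "c \<in> A" "admissible_chart A c" "p \<in> fst c" using atlas_cover .
  obtain S where S: "open S" "p \<in> S" "S \<subseteq> fst c" "smooth_on (f \<circ> chart_inv c) (snd c ` S)"
    using smooth_near_chart[OF assms(1) c(2,3)] .
  obtain T where T: "open T" "p \<in> T" "T \<subseteq> fst c" "smooth_on (g \<circ> chart_inv c) (snd c ` T)"
    using smooth_near_chart[OF assms(2) c(2,3)] .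
  have o: "open (snd c ` (S \<inter> T))" using S T by (intro chart_image_open[OF admissible_is_chart[OF c(2)]]) auto
  have "smooth_on (\<lambda>x. H ((f \<circ> chart_inv c) x) ((g \<circ> chart_inv c) x)) (snd c ` (S \<inter> T))"
    by (rule H[OF o smooth_on_subset[OF S(4)] smooth_on_subset[OF T(4)]]) auto
  then have "smooth_on ((\<lambda>q. H (f q) (g q)) \<circ> chart_inv c) (snd c ` (S \<inter> T))" by (simp add: comp_def)
  then show ?thesis
    unfolding smooth_near_def using c S T by blast
qed

lemma smooth_near_add: "smooth_near A f p \<Longrightarrow> smooth_near A g p \<Longrightarrow> smooth_near A (\<lambda>q. f q + g q) p"
  by (rule smooth_near_binary) (auto intro: smooth_on_add)

lemma smooth_near_mult: "smooth_near A f p \<Longrightarrow> smooth_near A g p \<Longrightarrow> smooth_near A (\<lambda>q. f q * g q) p"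
  by (rule smooth_near_binary) (auto intro: smooth_on_mult)

lemma smooth_functions_const [simp]: "(\<lambda>q. k) \<in> smooth_functions A"
  by (simp add: smooth_functions_iff)

lemma smooth_functions_add:
  "f \<in> smooth_functions A \<Longrightarrow> g \<in> smooth_functions A \<Longrightarrow> (\<lambda>q. f q + g q) \<in> smooth_functions A"
  by (simp add: smooth_functions_iff smooth_near_add)

lemma smooth_functions_mult:
  "f \<in> smooth_functions A \<Longrightarrow> g \<in> smooth_functions A \<Longrightarrow> (\<lambda>q. f q * g q) \<in> smooth_functions A"
  by (simp add: smooth_functions_iff smooth_near_mult)

lemma smooth_functions_diff:
  assumes "f \<in> smooth_functions A" "g \<in> smooth_functions A"
  shows "(\<lambda>q. f q - g q) \<in> smooth_functions A"
  using smooth_functions_add[OF assms(1) smooth_functions_mult[OF smooth_functions_const assms(2)], of "-1"] by simp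

lemma smooth_functions_sum:
  "(\<And>i. i \<in> I \<Longrightarrow> f i \<in> smooth_functions A) \<Longrightarrow> (\<lambda>q. \<Sum>i\<in>I. f i q) \<in> smooth_functions A"
  by (induction I rule: infinite_finite_induct) (auto intro: smooth_functions_add)

section \<open>Bump functions and global extensions of local functions and fields\<close>

lemma bump_function:
  assumes "open W" "p \<in> W"
  obtains \<theta> S K where "\<theta> \<in> smooth_functions A" "open S" "p \<in> S" "S \<subseteq> K" "closed K" "K \<subseteq> W"
    "\<And>q. q \<in> S \<Longrightarrow> \<theta> q = 1" "\<And>q. q \<notin> K \<Longrightarrow> \<theta> q = 0"
proof -
  obtain c where c: "c \<in> A" "admissible_chart A c" "p \<in> fst c" using atlas_cover .
  note ch = admissible_is_chart[OF c(2)]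
  have "open (snd c ` (fst c \<inter> W))" using assms chart_open[OF ch] by (intro chart_image_open[OF ch]) auto
  moreover have "snd c p \<in> snd c ` (fst c \<inter> W)" using c(3) assms(2) by blast
  ultimately obtain s where s: "s > 0" "cball (snd c p) s \<subseteq> snd c ` (fst c \<inter> W)"
    unfolding open_contains_cball by blast
  obtain \<theta>0 :: "'e \<Rightarrow> real" where \<theta>0: "smooth_on \<theta>0 UNIV" "\<And>x. x \<in> cball (snd c p) (s / 2) \<Longrightarrow> \<theta>0 x = 1"
    "\<And>x. x \<notin> ball (snd c p) s \<Longrightarrow> \<theta>0 x = 0"
    using plateau_function[of "s / 2" s "snd c p"] s(1) by auto
  define \<theta> where "\<theta> q = (if q \<in> fst c then \<theta>0 (snd c q) else 0)" for q
  define K where "K = chart_inv c ` cball (snd c p) s"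
  define S where "S = {q \<in> fst c. snd c q \<in> ball (snd c p) (s / 2)}"
  have sub: "cball (snd c p) s \<subseteq> snd c ` fst c" using s by auto
  \<comment> \<open>The Hausdorff property turns compactness of K into closedness. This is what
    makes the extension by 0 smooth outside the chart domain.\<close>
  have "compact K"
    unfolding K_def by (intro compact_continuous_image continuous_on_subset[OF chart_continuous(2)[OF ch] sub] compact_cball)
  then have K: "closed K" by (rule compact_imp_closed)
  have memK: "q \<in> K" if "q \<in> fst c" "snd c q \<in> cball (snd c p) s" for q
    unfolding K_def using that chart_inv_chart[OF ch that(1)] by (metis imageI)
  have z: "\<theta> q = 0" if "q \<notin> K" for q
    using that memK[of q] \<theta>0(3)[of "snd c q"]
    by (cases "snd c q \<in> ball (snd c p) s") (auto simp: \<theta>_def)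
  have "smooth_near A \<theta> q" for q
  proof (cases "q \<in> fst c")
    case True
    have "smooth_on (\<theta> \<circ> chart_inv c) (snd c ` fst c)"
      by (rule smooth_on_cong_open[OF chart_open(2)[OF ch] _ smooth_on_subset[OF \<theta>0(1)]])
        (auto simp: \<theta>_def chart_inv_chart[OF ch])
    then show ?thesis unfolding smooth_near_def using c True chart_open[OF ch] by blast
  next
    case False
    have "K \<subseteq> fst c" unfolding K_def using sub chart_inv_mem[OF ch] by blast
    then have "q \<in> - K" using False by auto
    then show ?thesis
      by (rule smooth_near_cong[OF smooth_near_const[of 0] open_Compl[OF K]]) (simp add: z)
  qed
  then have "\<theta> \<in> smooth_functions A" by (simp add: smooth_functions_iff)
  moreover have "open S" unfolding S_def by (rule chart_vimage_open[OF ch open_ball])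
  moreover have "p \<in> S" using c s by (simp add: S_def)
  moreover have "S \<subseteq> K" using memK s(1) by (auto simp: S_def)
  moreover have "K \<subseteq> W" using s(2) chart_inv_chart[OF ch] by (auto simp: K_def subset_iff image_iff)
  moreover have "\<theta> q = 1" if "q \<in> S" for q using that \<theta>0(2)[of "snd c q"] by (auto simp: S_def \<theta>_def)
  ultimately show ?thesis using that K z by blast
qed

lemma smooth_function_extension:
  assumes "open W" "p \<in> W" "\<And>q. q \<in> W \<Longrightarrow> smooth_near A f q"
  obtains f' S where "f' \<in> smooth_functions A" "open S" "p \<in> S" "S \<subseteq> W" "\<And>q. q \<in> S \<Longrightarrow> f' q = f q"
proof -
  obtain \<theta> S K where b: "\<theta> \<in> smooth_functions A" "open S" "p \<in> S" "S \<subseteq> K" "closed K" "K \<subseteq> W"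
    "\<And>q. q \<in> S \<Longrightarrow> \<theta> q = 1" "\<And>q. q \<notin> K \<Longrightarrow> \<theta> q = 0"
    using bump_function[OF assms(1,2)] by blast
  have "smooth_near A (\<lambda>q. \<theta> q * f q) r" for r
  proof (cases "r \<in> W")
    case True
    then show ?thesis by (intro smooth_near_mult smooth_near[OF b(1)] assms(3))
  next
    case False
    then show ?thesis using b(5,6,8)
      by (intro smooth_near_cong[OF smooth_near_const[of 0] open_Compl[OF b(5)]]) auto
  qed
  then have "(\<lambda>q. \<theta> q * f q) \<in> smooth_functions A" by (simp add: smooth_functions_iff)
  then show ?thesis using that[of "\<lambda>q. \<theta> q * f q" S] b by auto
qed

text \<open>The last conclusion controls the extension away from p as well: pointwise it is 0 or a
  multiple of X. Thus a local section of a distribution extends to a global section.\<close>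

lemma vector_field_extension:
  assumes W: "open W" "p \<in> W" and X: "\<And>q. q \<in> W \<Longrightarrow> X q \<in> tangent_space A q"
    "\<And>q f. q \<in> W \<Longrightarrow> f \<in> smooth_functions A \<Longrightarrow> smooth_near A (\<lambda>r. X r f) q"
  obtains X' S where "X' \<in> vector_fields A" "open S" "p \<in> S" "S \<subseteq> W" "\<And>q. q \<in> S \<Longrightarrow> X' q = X q"
    "\<And>q. X' q = 0 \<or> q \<in> W \<and> X' q \<in> span {X q}"
proof -
  obtain \<theta> S K where b: "\<theta> \<in> smooth_functions A" "open S" "p \<in> S" "S \<subseteq> K" "closed K" "K \<subseteq> W"
    "\<And>q. q \<in> S \<Longrightarrow> \<theta> q = 1" "\<And>q. q \<notin> K \<Longrightarrow> \<theta> q = 0"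
    using bump_function[OF W] by blast
  define X' where "X' q = \<theta> q *\<^sub>R X q" for q
  have z: "X' q = 0" if "q \<notin> K" for q using b(8)[OF that] by (simp add: X'_def)
  have "X' \<in> vector_fields A"
    unfolding vector_fields_def
  proof (intro CollectI conjI allI ballI)
    show "X' q \<in> tangent_space A q" for q
    proof (cases "q \<in> K")
      case True
      then show ?thesis using X(1)[of q] b(6) by (auto simp: X'_def intro: tangent_space_scale)
    qed (simp add: z tangent_space_0)
    fix f assume f: "f \<in> smooth_functions A"
    have "smooth_near A (\<lambda>q. X' q f) r" for r
    proof (cases "r \<in> W")
      case True
      have "smooth_near A (\<lambda>q. \<theta> q * X q f) r" by (intro smooth_near_mult smooth_near[OF b(1)] X(2) True f)
      then show ?thesis by (simp add: X'_def scaleR_fun_def)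
    next
      case False
      then show ?thesis using b(5,6) z
        by (intro smooth_near_cong[OF smooth_near_const[of 0] open_Compl[OF b(5)]]) (auto simp: zero_fun_def)
    qed
    then show "(\<lambda>q. X' q f) \<in> smooth_functions A" by (simp add: smooth_functions_iff)
  qed
  moreover have "X' q = 0 \<or> q \<in> W \<and> X' q \<in> span {X q}" for q
    using z[of q] b(6) by (cases "q \<in> K") (auto simp: X'_def span_singleton)
  ultimately show ?thesis using that[of X' S] b by (auto simp: X'_def)
qed

lemma tangent_vector_const:
  assumes "v \<in> tangent_space A p"
  shows "v (\<lambda>q. k) = 0"
proof -
  have "v (\<lambda>q. 1) = 0"
    using tangent_vector_mult[OF assms smooth_functions_const[of 1] smooth_functions_const[of 1]] by simp
  then show ?thesis using tangent_vector_scale[OF assms smooth_functions_const[of 1], of k] by simp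
qed

lemma tangent_vector_sum:
  assumes v: "v \<in> tangent_space A p" and f: "\<And>i. i \<in> I \<Longrightarrow> f i \<in> smooth_functions A"
  shows "v (\<lambda>q. \<Sum>i\<in>I. f i q) = (\<Sum>i\<in>I. v (f i))"
  using f
proof (induction I rule: infinite_finite_induct)
  case (insert i I)
  then show ?case using tangent_vector_add[OF v, of "f i" "\<lambda>q. \<Sum>i\<in>I. f i q"] smooth_functions_sum[of I f] by simp
qed (simp_all add: tangent_vector_const[OF v])

lemma tangent_vector_diff:
  assumes v: "v \<in> tangent_space A p" and f: "f \<in> smooth_functions A" "g \<in> smooth_functions A"
  shows "v (\<lambda>q. f q - g q) = v f - v g"
  using tangent_vector_add[OF v f(1) smooth_functions_mult[OF smooth_functions_const f(2)], of "-1"]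
    tangent_vector_scale[OF v f(2), of "-1"] by simp

text \<open>With a bump function \<theta> supported in S, the product of \<theta> and f - g is 0. At
  p, where \<theta> is 1 and f - g is 0, the Leibniz rule reduces its derivative to that of f -
  g.\<close>

lemma tangent_vector_local:
  assumes v: "v \<in> tangent_space A p" and f: "f \<in> smooth_functions A" "g \<in> smooth_functions A"
    and S: "open S" "p \<in> S" "\<And>q. q \<in> S \<Longrightarrow> f q = g q"
  shows "v f = v g"
proof -
  obtain \<theta> T K where b: "\<theta> \<in> smooth_functions A" "open T" "p \<in> T" "T \<subseteq> K" "closed K" "K \<subseteq> S"
    "\<And>q. q \<in> T \<Longrightarrow> \<theta> q = 1" "\<And>q. q \<notin> K \<Longrightarrow> \<theta> q = 0"
    using bump_function[OF S(1,2)] by blast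
  let ?h = "\<lambda>q. f q - g q"
  have h: "?h \<in> smooth_functions A" by (rule smooth_functions_diff[OF f])
  have "(\<lambda>q. \<theta> q * ?h q) = (\<lambda>q. 0)" using b(6,8) S(3) by (auto simp: fun_eq_iff)
  then have "v (\<lambda>q. \<theta> q * ?h q) = 0" using tangent_vector_const[OF v] by simp
  then have "v ?h = 0"
    using tangent_vector_mult[OF v b(1) h] b(3,7) S(2,3) by simp
  then show ?thesis using tangent_vector_diff[OF v f] by simp
qed

section \<open>Coordinate vectors span the tangent space\<close>

lemma coord_vector_tangent:
  assumes c: "admissible_chart A c" "p \<in> fst c"
  shows "coord_vector A c p w \<in> tangent_space A p"
proof -
  have d: "((\<lambda>x. f (chart_inv c x)) has_derivative frechet_derivative (f \<circ> chart_inv c) (at (snd c p))) (at (snd c p))"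
    if "f \<in> smooth_functions A" for f
    using smooth_on_has_derivative[OF smooth_functions_chart[OF that c(1)]] c(2) by (simp add: comp_def)
  note i = chart_inv_chart[OF admissible_is_chart[OF c(1)] c(2)]
  show ?thesis
    unfolding tangent_space_def
  proof (intro CollectI conjI ballI allI impI)
    fix f g :: "'a \<Rightarrow> real" and r :: real assume f: "f \<in> smooth_functions A"
    have "frechet_derivative ((\<lambda>x. r * f x) \<circ> chart_inv c) (at (snd c p)) =
        (\<lambda>w. r * frechet_derivative (f \<circ> chart_inv c) (at (snd c p)) w)"
      using frechet_derivative_at[OF has_derivative_mult_right[OF d[OF f], of r]] by (simp add: comp_def)
    then show "coord_vector A c p w (\<lambda>x. r * f x) = r * coord_vector A c p w f"
      using f smooth_functions_mult[OF smooth_functions_const f] by (simp add: coord_vector_def)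
    assume g: "g \<in> smooth_functions A"
    have "frechet_derivative ((\<lambda>x. f x + g x) \<circ> chart_inv c) (at (snd c p)) =
        (\<lambda>w. frechet_derivative (f \<circ> chart_inv c) (at (snd c p)) w + frechet_derivative (g \<circ> chart_inv c) (at (snd c p)) w)"
      using frechet_derivative_at[OF has_derivative_add[OF d[OF f] d[OF g]]] by (simp add: comp_def)
    then show "coord_vector A c p w (\<lambda>x. f x + g x) = coord_vector A c p w f + coord_vector A c p w g"
      using f g smooth_functions_add by (simp add: coord_vector_def)
    have "frechet_derivative ((\<lambda>x. f x * g x) \<circ> chart_inv c) (at (snd c p)) =
        (\<lambda>w. f p * frechet_derivative (g \<circ> chart_inv c) (at (snd c p)) w + frechet_derivative (f \<circ> chart_inv c) (at (snd c p)) w * g p)"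
      using frechet_derivative_at[OF has_derivative_mult[OF d[OF f] d[OF g]]] by (simp add: comp_def i)
    then show "coord_vector A c p w (\<lambda>x. f x * g x) = f p * coord_vector A c p w g + g p * coord_vector A c p w f"
      using f g smooth_functions_mult by (simp add: coord_vector_def)
  qed (auto simp: coord_vector_def)
qed

lemma linear_coord_vector:
  assumes c: "admissible_chart A c" "p \<in> fst c"
  shows "linear (coord_vector A c p)"
proof -
  have l: "linear (frechet_derivative (f \<circ> chart_inv c) (at (snd c p)))" if "f \<in> smooth_functions A" for f
    using smooth_on_has_derivative[OF smooth_functions_chart[OF that c(1)]] c(2) has_derivative_linear by blast
  show ?thesis
    by (rule linearI)
      (auto simp: coord_vector_def fun_eq_iff plus_fun_def scaleR_fun_def linear_add[OF l] linear_cmul[OF l])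
qed

text \<open>A derivation accepts only global functions, so the coordinates are cut off. One bump
  function serves for all b, which gives a common neighbourhood S.\<close>

lemma coordinate_functions:
  assumes c: "admissible_chart A c" "p \<in> fst c"
  shows "\<exists>y S. (\<forall>b. y b \<in> smooth_functions A) \<and> open S \<and> p \<in> S \<and> S \<subseteq> fst c \<and>
    (\<forall>q\<in>S. \<forall>b. y b q = snd c q \<bullet> b)"
proof -
  note ch = admissible_is_chart[OF c(1)]
  obtain \<theta> S K where b: "\<theta> \<in> smooth_functions A" "open S" "p \<in> S" "S \<subseteq> K" "closed K" "K \<subseteq> fst c"
    "\<And>q. q \<in> S \<Longrightarrow> \<theta> q = 1" "\<And>q. q \<notin> K \<Longrightarrow> \<theta> q = 0"
    using bump_function[OF chart_open(1)[OF ch] c(2)] by blast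
  have cn: "smooth_near A (\<lambda>q. snd c q \<bullet> b) r" if "r \<in> fst c" for r b
  proof -
    have "smooth_on ((\<lambda>q. snd c q \<bullet> b) \<circ> chart_inv c) (snd c ` fst c)"
      by (rule smooth_on_cong_open[OF chart_open(2)[OF ch] _
          smooth_on_inner_const[OF chart_open(2)[OF ch] smooth_on_id[OF chart_open(2)[OF ch]]]])
        (auto simp: chart_inv_chart[OF ch])
    then show ?thesis unfolding smooth_near_def using c that chart_open(1)[OF ch] by blast
  qed
  have "smooth_near A (\<lambda>q. \<theta> q * (snd c q \<bullet> b)) r" for r b
  proof (cases "r \<in> fst c")
    case True
    then show ?thesis using b(1) by (intro smooth_near_mult smooth_near cn) auto
  next
    case False
    then show ?thesis using b(6,8)
      by (intro smooth_near_cong[OF smooth_near_const[of 0] open_Compl[OF b(5)]]) auto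
  qed
  then have "(\<lambda>q. \<theta> q * (snd c q \<bullet> b)) \<in> smooth_functions A" for b by (simp add: smooth_functions_iff)
  then show ?thesis using b by (intro exI[of _ "\<lambda>b q. \<theta> q * (snd c q \<bullet> b)"] exI[of _ S]) auto
qed

lemma coord_vector_coordinate_function:
  assumes c: "admissible_chart A c" and y: "y \<in> smooth_functions A"
    and S: "open S" "p \<in> S" "S \<subseteq> fst c" "\<And>q. q \<in> S \<Longrightarrow> y q = snd c q \<bullet> b"
  shows "coord_vector A c p w y = w \<bullet> b"
proof -
  note ch = admissible_is_chart[OF c]
  have "frechet_derivative (y \<circ> chart_inv c) (at (snd c p)) = frechet_derivative (\<lambda>x. x \<bullet> b) (at (snd c p))"
    by (rule frechet_derivative_cong_open[OF chart_image_open[OF ch S(1,3)]])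
      (use S in \<open>auto simp: chart_inv_chart[OF ch] subset_iff\<close>)
  also have "\<dots> = (\<lambda>w. w \<bullet> b)"
    using frechet_derivative_at[OF bounded_linear_imp_has_derivative[OF bounded_linear_inner_left]] by metis
  finally show ?thesis using y by (simp add: coord_vector_def)
qed

text \<open>In the expansion of Hadamard's lemma each summand has a factor vanishing at p. The
  Leibniz rule therefore leaves only the derivative of that factor times the value of the other,
  which is a partial derivative of f.\<close>

lemma tangent_vector_coordinates:
  assumes c: "admissible_chart A c" and y: "\<And>b. y b \<in> smooth_functions A"
    and S: "open S" "p \<in> S" "S \<subseteq> fst c" "\<And>q b. q \<in> S \<Longrightarrow> y b q = snd c q \<bullet> b"
    and v: "v \<in> tangent_space A p"
  shows "v = coord_vector A c p (\<Sum>b\<in>Basis. v (y b) *\<^sub>R b)"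
proof
  note ch = admissible_is_chart[OF c]
  fix f
  show "v f = coord_vector A c p (\<Sum>b\<in>Basis. v (y b) *\<^sub>R b) f"
  proof (cases "f \<in> smooth_functions A")
    case f: True
    let ?h = "f \<circ> chart_inv c" and ?x = "snd c p"
    have sh: "smooth_on ?h (snd c ` fst c)" by (rule smooth_functions_chart[OF f c])
    obtain s where s: "s > 0" "ball ?x s \<subseteq> snd c ` S"
      using openE[OF chart_image_open[OF ch S(1,3)] imageI[OF S(2)]] by blast
    then have sh': "smooth_on ?h (ball ?x s)" using S(3) by (intro smooth_on_subset[OF sh]) auto
    obtain G where G: "\<And>b. smooth_on (G b) (ball ?x s)" "\<And>b. G b ?x = frechet_derivative ?h (at ?x) b"
      "\<And>x. x \<in> ball ?x s \<Longrightarrow> ?h x = ?h ?x + (\<Sum>b\<in>Basis. ((x - ?x) \<bullet> b) * G b x)"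
      by (rule Hadamard_lemma[OF open_ball convex_ball _ sh']) (use s(1) in auto)
    define W where "W = {q \<in> fst c. snd c q \<in> ball ?x s}"
    have W: "open W" "p \<in> W" using chart_vimage_open[OF ch open_ball] S s(1) by (auto simp: W_def)
    have sn: "smooth_near A (\<lambda>q. G b (snd c q)) r" if "r \<in> W" for r b
    proof -
      have o: "open (snd c ` W)" by (rule chart_image_open[OF ch W(1)]) (auto simp: W_def)
      have "smooth_on ((\<lambda>q. G b (snd c q)) \<circ> chart_inv c) (snd c ` W)"
        by (rule smooth_on_cong_open[OF o _ smooth_on_subset[OF G(1)[of b]]])
          (auto simp: W_def chart_inv_chart[OF ch])
      then show ?thesis by (rule smooth_nearI[OF c W(1) that, rotated]) (auto simp: W_def)
    qed
    have "\<exists>g T. g \<in> smooth_functions A \<and> open T \<and> p \<in> T \<and> T \<subseteq> W \<and> (\<forall>q\<in>T. g q = G b (snd c q))" for b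
      using smooth_function_extension[OF W sn] by metis
    then obtain g T where g: "\<And>b. g b \<in> smooth_functions A" "\<And>b. open (T b)" "\<And>b. p \<in> T b"
      "\<And>b. T b \<subseteq> W" "\<And>b q. q \<in> T b \<Longrightarrow> g b q = G b (snd c q)" by metis
    define R where "R = S \<inter> W \<inter> (\<Inter>b\<in>Basis. T b)"
    have R: "open R" "p \<in> R" using S W g by (auto simp: R_def intro!: open_Int open_INT)
    \<comment> \<open>A global function that agrees with f near p by Hadamard's lemma; the
      coefficients G b, smooth only on a ball, have been replaced by global extensions g b.\<close>
    define k where "k q = f p + (\<Sum>b\<in>Basis. (y b q - y b p) * g b q)" for q
    have yd: "(\<lambda>q. y b q - y b p) \<in> smooth_functions A" for b
      by (rule smooth_functions_diff[OF y smooth_functions_const])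
    have "v f = v k"
    proof (rule tangent_vector_local[OF v f _ R])
      show "k \<in> smooth_functions A"
        unfolding k_def by (intro smooth_functions_add smooth_functions_const smooth_functions_sum smooth_functions_mult yd g)
      fix q assume q: "q \<in> R"
      then have qc: "q \<in> fst c" "p \<in> fst c" using S by (auto simp: R_def)
      have "f q = ?h (snd c q)" using chart_inv_chart[OF ch qc(1)] by simp
      also have "\<dots> = ?h ?x + (\<Sum>b\<in>Basis. ((snd c q - ?x) \<bullet> b) * G b (snd c q))"
        by (rule G(3)) (use q in \<open>auto simp: R_def W_def\<close>)
      also have "\<dots> = k q"
        unfolding k_def using q g(5) S(4)[of q] S(4)[OF S(2)] chart_inv_chart[OF ch qc(2)]
        by (simp add: R_def inner_diff_left)
      finally show "f q = k q" .
    qed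
    also have "v k = (\<Sum>b\<in>Basis. v (\<lambda>q. (y b q - y b p) * g b q))"
      unfolding k_def using tangent_vector_add[OF v smooth_functions_const
          smooth_functions_sum[of Basis "\<lambda>b q. (y b q - y b p) * g b q"], of "f p"]
        tangent_vector_sum[OF v, of Basis "\<lambda>b q. (y b q - y b p) * g b q"] smooth_functions_mult[OF yd g(1)]
      by (simp add: tangent_vector_const[OF v])
    also have "\<dots> = (\<Sum>b\<in>Basis. frechet_derivative ?h (at ?x) b * v (y b))"
    proof (rule sum.cong[OF refl])
      fix b :: 'e assume "b \<in> Basis"
      have "v (\<lambda>q. y b q - y b p) = v (y b)"
        using tangent_vector_diff[OF v y smooth_functions_const] tangent_vector_const[OF v] by simp
      then show "v (\<lambda>q. (y b q - y b p) * g b q) = frechet_derivative ?h (at ?x) b * v (y b)"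
        using tangent_vector_mult[OF v yd g(1), of b b] g(5)[OF g(3), of b] G(2)[of b] by simp
    qed
    also have "\<dots> = coord_vector A c p (\<Sum>b\<in>Basis. v (y b) *\<^sub>R b) f"
    proof -
      have "linear (frechet_derivative ?h (at ?x))"
        using smooth_on_has_derivative[OF sh] S(2,3) has_derivative_linear by blast
      then show ?thesis using f by (simp add: coord_vector_def linear_sum linear_cmul mult.commute)
    qed
    finally show ?thesis .
  next
    case False
    then show ?thesis using tangent_vector_not_smooth[OF v] by (simp add: coord_vector_def)
  qed
qed

lemma tangent_space_eq_coord_vectors:
  assumes c: "admissible_chart A c" "p \<in> fst c"
  shows "tangent_space A p = range (coord_vector A c p)"
proof -
  obtain y S where "\<And>b. y b \<in> smooth_functions A" "open S" "p \<in> S" "S \<subseteq> fst c"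
    "\<And>q b. q \<in> S \<Longrightarrow> y b q = snd c q \<bullet> b" using coordinate_functions[OF c] by blast
  then have "v = coord_vector A c p (\<Sum>b\<in>Basis. v (y b) *\<^sub>R b)" if "v \<in> tangent_space A p" for v
    using tangent_vector_coordinates[where y=y, OF c(1)] that by blast
  then show ?thesis using coord_vector_tangent[OF c] by blast
qed

lemma inj_coord_vector:
  assumes c: "admissible_chart A c" "p \<in> fst c"
  shows "inj (coord_vector A c p)"
proof (rule injI)
  fix v w assume e: "coord_vector A c p v = coord_vector A c p w"
  obtain y S where y: "\<And>b. y b \<in> smooth_functions A" and S: "open S" "p \<in> S" "S \<subseteq> fst c"
    "\<And>q b. q \<in> S \<Longrightarrow> y b q = snd c q \<bullet> b" using coordinate_functions[OF c] by blast
  have "u \<bullet> b = coord_vector A c p u (y b)" for u b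
    using coord_vector_coordinate_function[OF c(1) y S(1-3), of b b] S(4) by simp
  from this[of v] this[of w] have "v \<bullet> b = w \<bullet> b" for b by (simp only: e)
  then show "v = w" by (rule euclidean_eqI)
qed

lemma coord_vector_smooth_near:
  assumes c: "admissible_chart A c" and U: "open U" "smooth_on a U" "p \<in> fst c" "snd c p \<in> U"
    and f: "f \<in> smooth_functions A"
  shows "smooth_near A (\<lambda>q. coord_vector A c q (a (snd c q)) f) p"
proof -
  note ch = admissible_is_chart[OF c]
  let ?h = "f \<circ> chart_inv c"
  define W where "W = {q \<in> fst c. snd c q \<in> U}"
  have W: "open W" "p \<in> W" "W \<subseteq> fst c" using chart_vimage_open[OF ch U(1)] U by (auto simp: W_def)
  have o: "open (snd c ` W)" by (rule chart_image_open[OF ch W(1,3)])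
  have sh: "smooth_on ?h (snd c ` W)"
    using W(3) by (intro smooth_on_subset[OF smooth_functions_chart[OF f c]]) auto
  have sa: "smooth_on a (snd c ` W)" by (rule smooth_on_subset[OF U(2)]) (auto simp: W_def)
  have "smooth_on (\<lambda>x. \<Sum>b\<in>Basis. (a x \<bullet> b) * frechet_derivative ?h (at x) b) (snd c ` W)"
    by (intro smooth_on_sum smooth_on_mult smooth_on_inner_const smooth_on_frechet_derivative sh sa o)
  then have "smooth_on ((\<lambda>q. coord_vector A c q (a (snd c q)) f) \<circ> chart_inv c) (snd c ` W)"
  proof (rule smooth_on_cong_open[OF o, rotated])
    fix x assume "x \<in> snd c ` W"
    then have x: "snd c (chart_inv c x) = x" using W(3) chart_chart_inv[OF ch] by blast
    have "linear (frechet_derivative ?h (at x))"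
      using smooth_on_has_derivative[OF sh \<open>x \<in> snd c ` W\<close>] has_derivative_linear by blast
    then have "frechet_derivative ?h (at x) (\<Sum>b\<in>Basis. (a x \<bullet> b) *\<^sub>R b) = (\<Sum>b\<in>Basis. (a x \<bullet> b) * frechet_derivative ?h (at x) b)"
      by (simp add: linear_sum linear_cmul)
    then show "(\<Sum>b\<in>Basis. (a x \<bullet> b) * frechet_derivative ?h (at x) b) =
        ((\<lambda>q. coord_vector A c q (a (snd c q)) f) \<circ> chart_inv c) x"
      using f by (simp add: coord_vector_def x euclidean_representation)
  qed
  then show ?thesis unfolding smooth_near_def using c W by blast
qed

lemma local_vector_field:
  assumes c: "admissible_chart A c" "p \<in> fst c" and U: "open U" "smooth_on a U" "snd c p \<in> U"
  shows "\<exists>X S. X \<in> vector_fields A \<and> open S \<and> p \<in> S \<and> S \<subseteq> {q \<in> fst c. snd c q \<in> U} \<and>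
    (\<forall>q\<in>S. X q = coord_vector A c q (a (snd c q))) \<and>
    (\<forall>q. X q = 0 \<or> q \<in> fst c \<and> snd c q \<in> U \<and> X q \<in> span {coord_vector A c q (a (snd c q))})"
proof -
  note ch = admissible_is_chart[OF c(1)]
  let ?W = "{q \<in> fst c. snd c q \<in> U}"
  have W: "open ?W" "p \<in> ?W" using chart_vimage_open[OF ch U(1)] U c by auto
  have 1: "coord_vector A c q (a (snd c q)) \<in> tangent_space A q" if "q \<in> ?W" for q
    using coord_vector_tangent[OF c(1)] that by blast
  have 2: "smooth_near A (\<lambda>r. coord_vector A c r (a (snd c r)) f) q"
    if "q \<in> ?W" "f \<in> smooth_functions A" for q f
    using coord_vector_smooth_near[OF c(1) U(1,2)] that by blast
  obtain X S where "X \<in> vector_fields A" "open S" "p \<in> S" "S \<subseteq> ?W"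
    "\<And>q. q \<in> S \<Longrightarrow> X q = coord_vector A c q (a (snd c q))"
    "\<And>q. X q = 0 \<or> q \<in> ?W \<and> X q \<in> span {coord_vector A c q (a (snd c q))}"
    using vector_field_extension[where X="\<lambda>q. coord_vector A c q (a (snd c q))", OF W 1 2] by blast
  then show ?thesis by blast
qed

text \<open>Lets identities that are assumed for vector fields be applied to single tangent
  vectors.\<close>

lemma tangent_vector_extension:
  assumes v: "v \<in> tangent_space A p"
  obtains X where "X \<in> vector_fields A" "X p = v"
proof -
  obtain c where c: "c \<in> A" "admissible_chart A c" "p \<in> fst c" using atlas_cover .
  obtain w where w: "v = coord_vector A c p w" using v tangent_space_eq_coord_vectors[OF c(2,3)] by blast
  obtain X S where "X \<in> vector_fields A" "p \<in> S" "\<forall>q\<in>S. X q = coord_vector A c q w"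
    using local_vector_field[OF c(2,3) open_UNIV smooth_on_const[of w] UNIV_I] by blast
  then show ?thesis using that w by blast
qed

section \<open>Algebra of vector fields and Lie brackets\<close>

lemma vector_fields_add: "X \<in> vector_fields A \<Longrightarrow> Y \<in> vector_fields A \<Longrightarrow> X + Y \<in> vector_fields A"
  by (auto simp: vector_fields_def tangent_space_add smooth_functions_add)

lemma vector_fields_mult:
  "f \<in> smooth_functions A \<Longrightarrow> X \<in> vector_fields A \<Longrightarrow> (\<lambda>p. f p *\<^sub>R X p) \<in> vector_fields A"
  unfolding vector_fields_def
  by (auto intro: tangent_space_scale) (simp add: scaleR_fun_def smooth_functions_mult)

lemma vector_fields_0: "0 \<in> vector_fields A"
  by (auto simp: vector_fields_def tangent_space_0 zero_fun_def[symmetric])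
    (simp add: zero_fun_def)

lemma vector_fields_diff:
  assumes "X \<in> vector_fields A" "Y \<in> vector_fields A"
  shows "X - Y \<in> vector_fields A"
proof -
  have "X - Y = X + (\<lambda>p. (\<lambda>_. -1) p *\<^sub>R Y p)" by (simp add: fun_eq_iff)
  then show ?thesis using vector_fields_add[OF assms(1) vector_fields_mult[OF smooth_functions_const assms(2)]] by metis
qed

lemma vector_fields_sum: "(\<And>i. i \<in> I \<Longrightarrow> X i \<in> vector_fields A) \<Longrightarrow> (\<Sum>i\<in>I. X i) \<in> vector_fields A"
  by (induction I rule: infinite_finite_induct) (auto intro: vector_fields_add vector_fields_0)

lemma lie_bracket_vector_field:
  assumes X: "X \<in> vector_fields A" and Y: "Y \<in> vector_fields A"
  shows "lie_bracket X Y \<in> vector_fields A"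
  unfolding vector_fields_def
proof (intro CollectI conjI allI ballI)
  note t = vector_field_tangent[OF X] vector_field_tangent[OF Y]
  note s = vector_field_smooth[OF X] vector_field_smooth[OF Y]
  fix p
  show "lie_bracket X Y p \<in> tangent_space A p"
    unfolding tangent_space_def
  proof (intro CollectI conjI ballI allI impI)
    fix f g :: "'a \<Rightarrow> real" and r :: real assume f: "f \<in> smooth_functions A"
    show "lie_bracket X Y p (\<lambda>x. r * f x) = r * lie_bracket X Y p f"
      using f s(1)[OF f] s(2)[OF f] tangent_vector_scale[OF t(1)] tangent_vector_scale[OF t(2)]
      by (simp add: lie_bracket_def right_diff_distrib)
    assume g: "g \<in> smooth_functions A"
    show "lie_bracket X Y p (\<lambda>x. f x + g x) = lie_bracket X Y p f + lie_bracket X Y p g"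
      using f g s(1)[OF f] s(2)[OF f] s(1)[OF g] s(2)[OF g] tangent_vector_add[OF t(1)] tangent_vector_add[OF t(2)]
      by (simp add: lie_bracket_def)
    show "lie_bracket X Y p (\<lambda>x. f x * g x) = f p * lie_bracket X Y p g + g p * lie_bracket X Y p f"
      using f g s(1)[OF f] s(2)[OF f] s(1)[OF g] s(2)[OF g] tangent_vector_add[OF t(1)] tangent_vector_add[OF t(2)]
        tangent_vector_mult[OF t(1)] tangent_vector_mult[OF t(2)]
      by (simp add: lie_bracket_def smooth_functions_mult algebra_simps)
  next
    \<comment> \<open>On functions that are not smooth the bracket gets the required value 0,
      because both fields have the default value 0 there at every point.\<close>
    fix f assume "f \<notin> smooth_functions A"
    then have "(\<lambda>q. X q f) = (\<lambda>q. 0)" "(\<lambda>q. Y q f) = (\<lambda>q. 0)"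
      using tangent_vector_not_smooth[OF t(1)] tangent_vector_not_smooth[OF t(2)] by auto
    then show "lie_bracket X Y p f = 0" using tangent_vector_const[OF t(1)] tangent_vector_const[OF t(2)]
      by (simp add: lie_bracket_def)
  qed
next
  fix f assume "f \<in> smooth_functions A"
  then show "(\<lambda>p. lie_bracket X Y p f) \<in> smooth_functions A"
    unfolding lie_bracket_def using vector_field_smooth[OF X] vector_field_smooth[OF Y]
    by (intro smooth_functions_diff) blast+
qed

end

section \<open>Immersed submanifolds\<close>

lemma sum_fun_apply: "(\<Sum>i\<in>I. f i) x = (\<Sum>i\<in>I. f i x)"
  by (induction I rule: infinite_finite_induct) auto

lemma push_add: "push A' \<iota> (u + v) = push A' \<iota> u + push A' \<iota> v"
  by (auto simp: push_def plus_fun_def)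

lemma push_scaleR: "push A' \<iota> (r *\<^sub>R u) = r *\<^sub>R push A' \<iota> u"
  by (auto simp: push_def scaleR_fun_def)

lemma linear_push: "linear (push A' \<iota>)"
  by (rule linearI) (simp_all add: push_add push_scaleR)

locale immersed_manifold = sub: manifold A + amb: manifold A'
  for A :: "('b::{t2_space, second_countable_topology}, 'f::euclidean_space) chart set"
    and A' :: "('a::{t2_space, second_countable_topology}, 'e::euclidean_space) chart set" +
  fixes \<iota> :: "'b \<Rightarrow> 'a"
  assumes immersion: "immersion A A' \<iota>"
begin

abbreviation "pf \<equiv> push A' \<iota>"

lemma immersion_continuous: "continuous_on UNIV \<iota>"
  using immersion by (simp add: immersion_def smooth_map_def)

lemma vimage_open: "open S \<Longrightarrow> open (\<iota> -` S)"
  using open_vimage[OF _ immersion_continuous] by simp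

lemma inj_pf: "inj_on pf (tangent_space A q)"
  using immersion by (simp add: immersion_def)

lemma local_representation_smooth:
  "c \<in> A \<Longrightarrow> d \<in> A' \<Longrightarrow> smooth_on (snd d \<circ> \<iota> \<circ> chart_inv c) (snd c ` (fst c \<inter> \<iota> -` fst d))"
  using immersion by (simp add: immersion_def smooth_map_def)

lemma pullback_smooth_near:
  assumes "smooth_near A' f (\<iota> q)"
  shows "smooth_near A (f \<circ> \<iota>) q"
proof -
  obtain c where c: "c \<in> A" "admissible_chart A c" "q \<in> fst c" using sub.atlas_cover .
  obtain d where d: "d \<in> A'" "admissible_chart A' d" "\<iota> q \<in> fst d" using amb.atlas_cover .
  note ch = sub.admissible_is_chart[OF c(2)] amb.admissible_is_chart[OF d(2)]
  obtain S where S: "open S" "\<iota> q \<in> S" "S \<subseteq> fst d" "smooth_on (f \<circ> chart_inv d) (snd d ` S)"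
    using amb.smooth_near_chart[OF assms d(2,3)] .
  define T where "T = fst c \<inter> \<iota> -` S"
  have T: "open T" "q \<in> T" "T \<subseteq> fst c"
    using vimage_open[OF S(1)] chart_open(1)[OF ch(1)] S c by (auto simp: T_def)
  have o: "open (snd c ` T)" by (rule chart_image_open[OF ch(1) T(1,3)])
  have "smooth_on (\<lambda>x. (f \<circ> chart_inv d) ((snd d \<circ> \<iota> \<circ> chart_inv c) x)) (snd c ` T)"
    by (rule smooth_on_compose[OF o smooth_on_subset[OF local_representation_smooth[OF c(1) d(1)]] S(4)])
      (use S(3) in \<open>auto simp: T_def chart_inv_chart[OF ch(1)]\<close>)
  then have "smooth_on ((f \<circ> \<iota>) \<circ> chart_inv c) (snd c ` T)"
  proof (rule smooth_on_cong_open[OF o, rotated])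
    fix x assume "x \<in> snd c ` T"
    then obtain r where r: "r \<in> T" "x = snd c r" by blast
    then have "r \<in> fst c" "\<iota> r \<in> fst d" using S(3) by (auto simp: T_def)
    then show "(f \<circ> chart_inv d) ((snd d \<circ> \<iota> \<circ> chart_inv c) x) = ((f \<circ> \<iota>) \<circ> chart_inv c) x"
      by (simp add: r(2) chart_inv_chart[OF ch(1)] chart_inv_chart[OF ch(2)])
  qed
  then show ?thesis by (rule smooth_nearI[OF c(2) T])
qed

lemma pullback_smooth: "f \<in> smooth_functions A' \<Longrightarrow> f \<circ> \<iota> \<in> smooth_functions A"
  by (simp add: sub.smooth_functions_iff amb.smooth_functions_iff pullback_smooth_near)

lemma pullback_smooth': "f \<in> smooth_functions A' \<Longrightarrow> (\<lambda>q. f (\<iota> q)) \<in> smooth_functions A"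
  using pullback_smooth[of f] by (simp add: comp_def)

lemma pf_apply: "f \<in> smooth_functions A' \<Longrightarrow> pf v f = v (f \<circ> \<iota>)"
  by (simp add: push_def)

lemma pf_tangent:
  assumes v: "v \<in> tangent_space A q"
  shows "pf v \<in> tangent_space A' (\<iota> q)"
  unfolding tangent_space_def
proof (intro CollectI conjI ballI allI impI)
  fix f g :: "'a \<Rightarrow> real" and r :: real assume f: "f \<in> smooth_functions A'"
  note pb = pullback_smooth[OF f]
  have "(\<lambda>x. r * f x) \<in> smooth_functions A'"
    by (rule amb.smooth_functions_mult[OF amb.smooth_functions_const f])
  then show "pf v (\<lambda>x. r * f x) = r * pf v f"
    using f tangent_vector_scale[OF v pb, of r] by (simp add: push_def comp_def)
  assume g: "g \<in> smooth_functions A'"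
  show "pf v (\<lambda>x. f x + g x) = pf v f + pf v g"
    using f g amb.smooth_functions_add[OF f g] tangent_vector_add[OF v pb pullback_smooth[OF g]]
    by (simp add: push_def comp_def)
  show "pf v (\<lambda>x. f x * g x) = f (\<iota> q) * pf v g + g (\<iota> q) * pf v f"
    using f g amb.smooth_functions_mult[OF f g] tangent_vector_mult[OF v pb pullback_smooth[OF g]]
    by (simp add: push_def comp_def)
qed (simp add: push_def)

lemma pf_eq_0:
  assumes "v \<in> tangent_space A q" "pf v = 0"
  shows "v = 0"
  using inj_onD[OF inj_pf _ assms(1) tangent_space_0] assms(2) linear_0[OF linear_push[of A' \<iota>]] by simp

text \<open>The chain rule. It translates injectivity of the differential on derivations into
  injectivity of the Jacobian of the local representation.\<close>

lemma pf_coord_vector: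
  assumes c: "c \<in> A" "q \<in> fst c" and d: "d \<in> A'" "\<iota> q \<in> fst d"
  shows "pf (coord_vector A c q v) =
    coord_vector A' d (\<iota> q) (frechet_derivative (snd d \<circ> \<iota> \<circ> chart_inv c) (at (snd c q)) v)"
proof
  fix f
  let ?F = "snd d \<circ> \<iota> \<circ> chart_inv c" and ?x = "snd c q"
  note ch = sub.admissible_is_chart[OF sub.atlas_admissible[OF c(1)]]
    amb.admissible_is_chart[OF amb.atlas_admissible[OF d(1)]]
  define T where "T = fst c \<inter> \<iota> -` fst d"
  have T: "open T" "q \<in> T" "T \<subseteq> fst c"
    using vimage_open[OF chart_open(1)[OF ch(2)]] chart_open(1)[OF ch(1)] c d by (auto simp: T_def)
  show "pf (coord_vector A c q v) f = coord_vector A' d (\<iota> q) (frechet_derivative ?F (at ?x) v) f"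
  proof (cases "f \<in> smooth_functions A'")
    case f: True
    have Fx: "?F ?x = snd d (\<iota> q)" using c chart_inv_chart[OF ch(1)] by simp
    have 1: "(?F has_derivative frechet_derivative ?F (at ?x)) (at ?x)"
      using T(2) by (intro smooth_on_has_derivative[OF local_representation_smooth[OF c(1) d(1)]]) (auto simp: T_def)
    have 2: "((f \<circ> chart_inv d) has_derivative frechet_derivative (f \<circ> chart_inv d) (at (snd d (\<iota> q)))) (at (?F ?x))"
      unfolding Fx using d(2)
      by (intro smooth_on_has_derivative[OF amb.smooth_functions_chart[OF f amb.atlas_admissible[OF d(1)]]]) auto
    have "((\<lambda>x. (f \<circ> chart_inv d) (?F x)) has_derivative
        (\<lambda>v. frechet_derivative (f \<circ> chart_inv d) (at (snd d (\<iota> q))) (frechet_derivative ?F (at ?x) v))) (at ?x)"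
      by (rule has_derivative_compose[OF 1 2])
    then have "((f \<circ> \<iota> \<circ> chart_inv c) has_derivative
        (\<lambda>v. frechet_derivative (f \<circ> chart_inv d) (at (snd d (\<iota> q))) (frechet_derivative ?F (at ?x) v))) (at ?x)"
    proof (rule has_derivative_transform_within_open[OF _ chart_image_open[OF ch(1) T(1,3)]])
      show "?x \<in> snd c ` T" using T by blast
      fix x assume "x \<in> snd c ` T"
      then obtain r where r: "r \<in> T" "x = snd c r" by blast
      then have "r \<in> fst c" "\<iota> r \<in> fst d" by (auto simp: T_def)
      then show "(f \<circ> chart_inv d) (?F x) = (f \<circ> \<iota> \<circ> chart_inv c) x"
        by (simp add: r(2) chart_inv_chart[OF ch(1)] chart_inv_chart[OF ch(2)])
    qed
    from frechet_derivative_at[OF this] show ?thesis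
      using f pullback_smooth[OF f] by (simp add: pf_apply coord_vector_def) metis
  qed (simp add: push_def coord_vector_def)
qed

text \<open>An immersion has a smooth left inverse locally: a linear left inverse L of the Jacobian
  makes L composed with the local representation a local diffeomorphism. Composing f with the left
  inverse extends it off the submanifold.\<close>

lemma smooth_function_extension:
  assumes f: "smooth_near A f q"
  obtains f' S where "f' \<in> smooth_functions A'" "open S" "q \<in> S" "\<And>r. r \<in> S \<Longrightarrow> f' (\<iota> r) = f r"
proof -
  obtain c where c: "c \<in> A" "admissible_chart A c" "q \<in> fst c" using sub.atlas_cover .
  obtain d where d: "d \<in> A'" "admissible_chart A' d" "\<iota> q \<in> fst d" using amb.atlas_cover .
  note ch = sub.admissible_is_chart[OF c(2)] amb.admissible_is_chart[OF d(2)]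
  let ?F = "snd d \<circ> \<iota> \<circ> chart_inv c" and ?x = "snd c q"
  define \<Omega> where "\<Omega> = snd c ` (fst c \<inter> \<iota> -` fst d)"
  have \<Omega>: "open \<Omega>" "?x \<in> \<Omega>"
    using c d vimage_open[OF chart_open(1)[OF ch(2)]] chart_open(1)[OF ch(1)]
    by (auto simp: \<Omega>_def intro!: chart_image_open[OF ch(1)])
  have F: "smooth_on ?F \<Omega>" unfolding \<Omega>_def by (rule local_representation_smooth[OF c(1) d(1)])
  let ?DF = "frechet_derivative ?F (at ?x)"
  have DF: "(?F has_derivative ?DF) (at ?x)" by (rule smooth_on_has_derivative[OF F \<Omega>(2)])
  have lin: "linear ?DF" by (rule has_derivative_linear[OF DF])
  have "inj ?DF"
    unfolding linear_injective_0[OF lin]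
  proof (intro allI impI)
    fix v assume v: "?DF v = 0"
    have "pf (coord_vector A c q v) = coord_vector A' d (\<iota> q) 0"
      using pf_coord_vector[OF c(1,3) d(1,3), of v] v by simp
    then have "coord_vector A c q v = 0"
      using linear_0[OF amb.linear_coord_vector[OF d(2,3)]] sub.coord_vector_tangent[OF c(2,3)]
      by (intro pf_eq_0) auto
    then have "coord_vector A c q v = coord_vector A c q 0"
      using linear_0[OF sub.linear_coord_vector[OF c(2,3)]] by simp
    then show "v = 0" using sub.inj_coord_vector[OF c(2,3)] by (simp add: inj_eq)
  qed
  then obtain L where L: "linear L" "L \<circ> ?DF = id"
    using linear_injective_left_inverse[OF lin] by blast
  have bL: "bounded_linear L" using L(1) by (simp add: linear_conv_bounded_linear)
  define \<Phi> where "\<Phi> x = L (?F x)" for x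
  have \<Phi>: "smooth_on \<Phi> \<Omega>" unfolding \<Phi>_def by (rule smooth_on_compose_bounded_linear[OF \<Omega>(1) bL F])
  have "(\<Phi> has_derivative (\<lambda>v. L (?DF v))) (at ?x)"
    unfolding \<Phi>_def by (rule bounded_linear.has_derivative[OF bL DF])
  moreover have "L (?DF v) = v" for v using L(2) by (metis comp_apply id_apply)
  ultimately have D\<Phi>: "frechet_derivative \<Phi> (at ?x) = (\<lambda>v. v)"
    using frechet_derivative_at[of \<Phi> "\<lambda>v. L (?DF v)" ?x] by auto
  obtain U V g where g: "open U" "U \<subseteq> \<Omega>" "?x \<in> U" "open V" "homeomorphism U V \<Phi> g" "smooth_on g V"
    by (rule smooth_inverse_function[OF \<Omega> \<Phi> D\<Phi>])
  have g\<Phi>: "g (\<Phi> x) = x" "\<Phi> x \<in> V" if "x \<in> U" for x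
    using homeomorphism_apply1[OF g(5) that] homeomorphism_image1[OF g(5)] that by auto
  obtain T where T: "open T" "q \<in> T" "T \<subseteq> fst c" "smooth_on (f \<circ> chart_inv c) (snd c ` T)"
    using sub.smooth_near_chart[OF f c(2,3)] .
  define V' where "V' = V \<inter> g -` (snd c ` T)"
  have V': "open V'"
    unfolding V'_def
    by (rule continuous_open_preimage[OF smooth_on_continuous_on[OF g(6)] g(4) chart_image_open[OF ch(1) T(1,3)]])
  define N where "N = L -` V'"
  have N: "open N" unfolding N_def using open_vimage[OF V'] linear_continuous_on[OF bL] by blast
  define W where "W = {p \<in> fst d. snd d p \<in> N}"
  \<comment> \<open>In the ambient coordinates the extension is constant along the kernel of
    L.\<close>
  define f0 where "f0 p = f (chart_inv c (g (L (snd d p))))" for p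
  have W: "open W" "W \<subseteq> fst d" using chart_vimage_open[OF ch(2) N] by (auto simp: W_def)
  have \<Phi>L: "L (snd d (\<iota> r)) = \<Phi> (snd c r)" if "r \<in> fst c" for r
    using that by (simp add: \<Phi>_def chart_inv_chart[OF ch(1)])
  have qW: "\<iota> q \<in> W"
    using d(3) g\<Phi>[OF g(3)] T(2) \<Phi>L[OF c(3)] by (auto simp: W_def N_def V'_def)
  have "smooth_near A' f0 p" if p: "p \<in> W" for p
  proof (rule smooth_nearI[OF d(2) W(1) p W(2)])
    have o: "open (snd d ` W)" by (rule chart_image_open[OF ch(2) W])
    have WN: "snd d ` W \<subseteq> N" by (auto simp: W_def)
    have sg: "smooth_on (\<lambda>y. g (L y)) (snd d ` W)"
      by (rule smooth_on_compose[OF o smooth_on_bounded_linear[OF o bL] g(6)])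
        (use WN in \<open>auto simp: N_def V'_def\<close>)
    have "smooth_on (\<lambda>y. (f \<circ> chart_inv c) (g (L y))) (snd d ` W)"
      by (rule smooth_on_compose[OF o sg T(4)]) (use WN in \<open>auto simp: N_def V'_def\<close>)
    then show "smooth_on (f0 \<circ> chart_inv d) (snd d ` W)"
      by (rule smooth_on_cong_open[OF o, rotated])
        (use W(2) chart_inv_chart[OF ch(2)] in \<open>auto simp: f0_def\<close>)
  qed
  then obtain f' S where f': "f' \<in> smooth_functions A'" "open S" "\<iota> q \<in> S" "S \<subseteq> W" "\<And>p. p \<in> S \<Longrightarrow> f' p = f0 p"
    using amb.smooth_function_extension[OF W(1) qW] by blast
  define R where "R = {r \<in> fst c. snd c r \<in> U} \<inter> \<iota> -` S"
  have "open R" unfolding R_def by (intro open_Int chart_vimage_open[OF ch(1) g(1)] vimage_open[OF f'(2)])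
  moreover have "q \<in> R" using c g(3) f'(3) by (simp add: R_def)
  moreover have "f' (\<iota> r) = f r" if "r \<in> R" for r
    using that f'(5)[of "\<iota> r"] \<Phi>L[of r] g\<Phi>(1)[of "snd c r"] chart_inv_chart[OF ch(1), of r]
    by (auto simp: R_def f0_def)
  ultimately show ?thesis using that f'(1) by blast
qed

text \<open>The components of the pushed field in an ambient coordinate frame are smooth functions
  on the submanifold. Each is extended separately, and the frame fields themselves are made
  global.\<close>

lemma vector_field_extends:
  assumes X: "X \<in> vector_fields A"
  obtains X' where "extends_near A' \<iota> q X X'"
proof -
  obtain d where d: "d \<in> A'" "admissible_chart A' d" "\<iota> q \<in> fst d" using amb.atlas_cover .
  obtain y S where y: "\<And>b. y b \<in> smooth_functions A'" and S: "open S" "\<iota> q \<in> S" "S \<subseteq> fst d"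
      "\<And>p b. p \<in> S \<Longrightarrow> y b p = snd d p \<bullet> b"
    using amb.coordinate_functions[OF d(2,3)] by blast
  have "\<exists>E T. E \<in> vector_fields A' \<and> open T \<and> \<iota> q \<in> T \<and> (\<forall>p\<in>T. E p = coord_vector A' d p b)" for b
    using amb.local_vector_field[OF d(2,3) open_UNIV smooth_on_const[of b] UNIV_I] by blast
  then obtain E T where E: "\<And>b. E b \<in> vector_fields A'" "\<And>b. open (T b)" "\<And>b. \<iota> q \<in> T b"
      "\<And>b p. p \<in> T b \<Longrightarrow> E b p = coord_vector A' d p b" by metis
  have Xy: "(\<lambda>r. X r (y b \<circ> \<iota>)) \<in> smooth_functions A" for b
    by (rule vector_field_smooth[OF X pullback_smooth[OF y]])
  have "\<exists>f' R. f' \<in> smooth_functions A' \<and> open R \<and> q \<in> R \<and> (\<forall>r\<in>R. f' (\<iota> r) = X r (y b \<circ> \<iota>))" for b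
    using smooth_function_extension[OF sub.smooth_near[OF Xy]] by metis
  then obtain a R where a: "\<And>b. a b \<in> smooth_functions A'" "\<And>b. open (R b)" "\<And>b. q \<in> R b"
      "\<And>b r. r \<in> R b \<Longrightarrow> a b (\<iota> r) = X r (y b \<circ> \<iota>)" by metis
  define X' where "X' = (\<Sum>b\<in>Basis. (\<lambda>p. a b p *\<^sub>R E b p))"
  have "X' \<in> vector_fields A'"
    unfolding X'_def by (intro amb.vector_fields_sum amb.vector_fields_mult a E)
  moreover define Q where "Q = \<iota> -` (S \<inter> (\<Inter>b\<in>Basis. T b)) \<inter> (\<Inter>b\<in>Basis. R b)"
  have "open Q" unfolding Q_def
    by (intro open_Int vimage_open open_INT finite_Basis ballI S E a)
  moreover have "q \<in> Q" using S E a by (simp add: Q_def)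
  moreover have "X' (\<iota> r) = pf (X r)" if r: "r \<in> Q" for r
  proof -
    have rS: "\<iota> r \<in> S" using r by (simp add: Q_def)
    have "pf (X r) = coord_vector A' d (\<iota> r) (\<Sum>b\<in>Basis. pf (X r) (y b) *\<^sub>R b)"
      by (rule amb.tangent_vector_coordinates[OF d(2) y S(1) rS S(3,4) pf_tangent[OF vector_field_tangent[OF X]]])
    also have "\<dots> = (\<Sum>b\<in>Basis. pf (X r) (y b) *\<^sub>R coord_vector A' d (\<iota> r) b)"
      using amb.linear_coord_vector[OF d(2), of "\<iota> r"] rS S(3) by (simp add: linear_sum linear_cmul subset_iff)
    also have "\<dots> = (\<Sum>b\<in>Basis. a b (\<iota> r) *\<^sub>R E b (\<iota> r))"
      using r a(4) E(4) by (intro sum.cong) (auto simp: Q_def pf_apply y)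
    also have "\<dots> = X' (\<iota> r)" by (simp add: X'_def sum_fun_apply)
    finally show ?thesis by simp
  qed
  ultimately show ?thesis using that[of X'] unfolding extends_near_def by blast
qed

lemma extends_nearD:
  assumes "extends_near A' \<iota> q X X'"
  shows "X' \<in> vector_fields A'" "X' (\<iota> q) = pf (X q)"
  using assms by (auto simp: extends_near_def)

lemma pf_local_apply:
  assumes v: "v \<in> tangent_space A q" and f: "f \<in> smooth_functions A'" and g: "g \<in> smooth_functions A"
    and S: "open S" "q \<in> S" "\<And>r. r \<in> S \<Longrightarrow> f (\<iota> r) = g r"
  shows "pf v f = v g"
  using sub.tangent_vector_local[OF v pullback_smooth[OF f] g S(1,2)] S(3) by (simp add: pf_apply f)

lemma extends_near_apply:
  assumes X: "X \<in> vector_fields A" and X': "extends_near A' \<iota> q X X'" and v: "v \<in> tangent_space A q"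
    and f: "f \<in> smooth_functions A'"
  shows "pf v (\<lambda>p. X' p f) = v (\<lambda>r. X r (f \<circ> \<iota>))"
proof -
  obtain S where S: "open S" "q \<in> S" "\<And>r. r \<in> S \<Longrightarrow> X' (\<iota> r) = pf (X r)"
    using X' by (auto simp: extends_near_def)
  show ?thesis
  proof (rule pf_local_apply[OF v _ _ S(1,2)])
    show "(\<lambda>p. X' p f) \<in> smooth_functions A'"
      by (rule vector_field_smooth[OF extends_nearD(1)[OF X'] f])
    show "(\<lambda>r. X r (f \<circ> \<iota>)) \<in> smooth_functions A"
      by (rule vector_field_smooth[OF X pullback_smooth[OF f]])
  qed (simp add: S(3) pf_apply f)
qed

text \<open>Brackets of \<iota>-related fields are \<iota>-related: applying an extension of Y to f
  and restricting along \<iota> is the same as applying Y to the restriction of f.\<close>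

lemma lie_bracket_extension:
  assumes X: "X \<in> vector_fields A" "extends_near A' \<iota> q X X'"
    and Y: "Y \<in> vector_fields A" "extends_near A' \<iota> q Y Y'"
  shows "lie_bracket X' Y' (\<iota> q) = pf (lie_bracket X Y q)"
proof
  fix f
  show "lie_bracket X' Y' (\<iota> q) f = pf (lie_bracket X Y q) f"
  proof (cases "f \<in> smooth_functions A'")
    case f: True
    show ?thesis
      using extends_near_apply[OF Y vector_field_tangent[OF X(1)] f]
        extends_near_apply[OF X vector_field_tangent[OF Y(1)] f]
      by (simp add: lie_bracket_def extends_nearD(2)[OF X(2)] extends_nearD(2)[OF Y(2)] pf_apply f)
  next
    case False
    have "lie_bracket X' Y' (\<iota> q) \<in> tangent_space A' (\<iota> q)"
      by (rule vector_field_tangent[OF amb.lie_bracket_vector_field[OF extends_nearD(1)[OF X(2)] extends_nearD(1)[OF Y(2)]]])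
    from tangent_vector_not_smooth[OF this False] show ?thesis using False by (simp add: push_def)
  qed
qed

text \<open>Meant for fields that are defined pointwise by inverting \<open>pf\<close>, whose
  smoothness is not visible intrinsically. It is read off from ambient extensions, with f extended
  too.\<close>

lemma vector_fieldI_extension:
  assumes t: "\<And>q. X q \<in> tangent_space A q" and e: "\<And>q. \<exists>X'. extends_near A' \<iota> q X X'"
  shows "X \<in> vector_fields A"
  unfolding vector_fields_def
proof (intro CollectI conjI allI ballI t)
  fix f assume f: "f \<in> smooth_functions A"
  have "smooth_near A (\<lambda>p. X p f) q" for q
  proof -
    obtain X' where X': "extends_near A' \<iota> q X X'" using e by blast
    obtain S where S: "open S" "q \<in> S" "\<And>r. r \<in> S \<Longrightarrow> X' (\<iota> r) = pf (X r)"
      using X' by (auto simp: extends_near_def)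
    obtain f' T where f': "f' \<in> smooth_functions A'" "open T" "q \<in> T" "\<And>r. r \<in> T \<Longrightarrow> f' (\<iota> r) = f r"
      using smooth_function_extension[OF sub.smooth_near[OF f]] by blast
    have "smooth_near A (\<lambda>r. X' (\<iota> r) f') q"
      by (rule sub.smooth_near[OF pullback_smooth'[OF vector_field_smooth[OF extends_nearD(1)[OF X'] f'(1)]]])
    then show ?thesis
    proof (rule sub.smooth_near_cong)
      show "open (S \<inter> T)" "q \<in> S \<inter> T" using S f' by auto
      fix r assume r: "r \<in> S \<inter> T"
      have "pf (X r) f' = X r f"
        by (rule pf_local_apply[OF t f'(1) f f'(2)]) (use r f'(4) in auto)
      then show "X' (\<iota> r) f' = X r f" using S(3) r by simp
    qed
  qed
  then show "(\<lambda>p. X p f) \<in> smooth_functions A" by (simp add: sub.smooth_functions_iff)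
qed

end

section \<open>Lorentzian metrics and the second fundamental form\<close>

locale lorentzian_manifold = manifold A
  for A :: "('a::{t2_space, second_countable_topology}, 'e::euclidean_space) chart set" +
  fixes g :: "'a \<Rightarrow> 'a tvec \<Rightarrow> 'a tvec \<Rightarrow> real"
  assumes lorentzian: "lorentzian_metric A g"
begin

lemma metric_sym: "u \<in> tangent_space A p \<Longrightarrow> v \<in> tangent_space A p \<Longrightarrow> g p u v = g p v u"
  using lorentzian by (simp add: lorentzian_metric_def)

lemma metric_add_left:
  "u \<in> tangent_space A p \<Longrightarrow> v \<in> tangent_space A p \<Longrightarrow> w \<in> tangent_space A p \<Longrightarrow>
    g p (u + v) w = g p u w + g p v w"
  using lorentzian by (simp add: lorentzian_metric_def)

lemma metric_scale_left:
  "u \<in> tangent_space A p \<Longrightarrow> w \<in> tangent_space A p \<Longrightarrow> g p (r *\<^sub>R u) w = r * g p u w"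
  using lorentzian by (simp add: lorentzian_metric_def)

lemma metric_smooth:
  "X \<in> vector_fields A \<Longrightarrow> Y \<in> vector_fields A \<Longrightarrow> (\<lambda>p. g p (X p) (Y p)) \<in> smooth_functions A"
  using lorentzian by (simp add: lorentzian_metric_def)

lemma metric_add_right:
  "u \<in> tangent_space A p \<Longrightarrow> v \<in> tangent_space A p \<Longrightarrow> w \<in> tangent_space A p \<Longrightarrow>
    g p w (u + v) = g p w u + g p w v"
  using metric_add_left[of u p v w] metric_sym[of w p] tangent_space_add by metis

lemma metric_scale_right:
  "u \<in> tangent_space A p \<Longrightarrow> w \<in> tangent_space A p \<Longrightarrow> g p w (r *\<^sub>R u) = r * g p w u"
  using metric_scale_left[of u p w r] metric_sym[of w p] tangent_space_scale by metis

lemma metric_zero_left: "w \<in> tangent_space A p \<Longrightarrow> g p 0 w = 0"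
  using metric_scale_left[OF tangent_space_0, of w p 0] by simp

lemma metric_zero_right: "w \<in> tangent_space A p \<Longrightarrow> g p w 0 = 0"
  using metric_scale_right[OF tangent_space_0, of w p 0] by simp

lemma metric_diff_left:
  assumes "u \<in> tangent_space A p" "v \<in> tangent_space A p" "w \<in> tangent_space A p"
  shows "g p (u - v) w = g p u w - g p v w"
  using metric_add_left[of "u - v" p v w] assms tangent_space_diff by fastforce

lemma metric_sum_left:
  assumes "w \<in> tangent_space A p" "\<And>i. i \<in> I \<Longrightarrow> u i \<in> tangent_space A p"
  shows "g p (\<Sum>i\<in>I. u i) w = (\<Sum>i\<in>I. g p (u i) w)"
  using assms(2)
  by (induction I rule: infinite_finite_induct)
    (auto simp: metric_zero_left metric_add_left tangent_space_sum assms(1))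

lemma metric_orthogonal_span:
  assumes "n \<in> tangent_space A p" "S \<subseteq> tangent_space A p" "\<And>s. s \<in> S \<Longrightarrow> g p n s = 0" "u \<in> span S"
  shows "u \<in> tangent_space A p \<and> g p n u = 0"
proof -
  have "subspace {u \<in> tangent_space A p. g p n u = 0}"
    unfolding subspace_def using assms(1)
    by (auto simp: tangent_space_0 metric_zero_right metric_add_right metric_scale_right
        tangent_space_add tangent_space_scale)
  then show ?thesis using span_minimal[of S "{u \<in> tangent_space A p. g p n u = 0}"] assms(2-4) by blast
qed

lemma tangent_space_finite_span:
  obtains S where "finite S" "tangent_space A p = span S"
proof -
  obtain c where c: "c \<in> A" "admissible_chart A c" "p \<in> fst c" using atlas_cover .
  have "span (coord_vector A c p ` Basis) = coord_vector A c p ` span Basis"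
    by (rule span_linear_image[OF linear_coord_vector[OF c(2,3)]])
  then have "tangent_space A p = span (coord_vector A c p ` Basis)"
    using tangent_space_eq_coord_vectors[OF c(2,3)] by (simp add: span_Basis)
  then show ?thesis using that by (meson finite_Basis finite_imageI)
qed

text \<open>The orthogonal complement of a timelike vector is positive definite. The signature of
  the metric enters here, through the reverse Cauchy-Schwarz inequality.\<close>

lemma orthogonal_to_timelike:
  assumes \<xi>: "\<xi> \<in> tangent_space A p" "g p \<xi> \<xi> = -1" and v: "v \<in> tangent_space A p"
    and o: "g p v \<xi> = 0" and nonpos: "g p v v \<le> 0"
  shows "v = 0"
proof -
  obtain B e where B: "e \<in> B" "independent B" "span B = tangent_space A p" "g p e e = -1"
    "\<And>b. b \<in> B - {e} \<Longrightarrow> g p b b = 1" "\<And>b b'. b \<in> B \<Longrightarrow> b' \<in> B \<Longrightarrow> b \<noteq> b' \<Longrightarrow> g p b b' = 0"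
    using lorentzian unfolding lorentzian_metric_def by metis
  obtain S where "finite S" "tangent_space A p = span S" by (rule tangent_space_finite_span)
  \<comment> \<open>The basis in the definition of the metric is only required to be independent;
    its finiteness comes from the finite dimension of the tangent space.\<close>
  then have fin: "finite B" using B(2,3) independent_span_bound[of S B] span_superset by blast
  have BT: "b \<in> tangent_space A p" if "b \<in> B" for b using B(3) span_base[OF that] by simp
  obtain a where a: "v = (\<Sum>b\<in>B. a b *\<^sub>R b)" using v B(3) span_finite[OF fin] by auto
  obtain x where x: "\<xi> = (\<Sum>b\<in>B. x b *\<^sub>R b)" using \<xi>(1) B(3) span_finite[OF fin] by auto
  have coef: "g p (\<Sum>b\<in>B. s b *\<^sub>R b) w = (\<Sum>b\<in>B. s b * g p b w)" if "w \<in> tangent_space A p" for s w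
    using that BT by (subst metric_sum_left) (auto simp: metric_scale_left tangent_space_scale)
  have gb: "g p b (\<Sum>b\<in>B. t b *\<^sub>R b) = t b * g p b b" if b: "b \<in> B" for b t
  proof -
    have "g p b (\<Sum>b\<in>B. t b *\<^sub>R b) = g p (\<Sum>b\<in>B. t b *\<^sub>R b) b"
      using b BT by (intro metric_sym tangent_space_sum tangent_space_scale) auto
    also have "\<dots> = (\<Sum>b'\<in>B. t b' * g p b' b)" using coef BT[OF b] by blast
    also have "\<dots> = (\<Sum>b'\<in>{b}. t b' * g p b' b)"
      using b B(6) fin by (intro sum.mono_neutral_right) auto
    finally show ?thesis by simp
  qed
  have form: "g p (\<Sum>b\<in>B. s b *\<^sub>R b) (\<Sum>b\<in>B. t b *\<^sub>R b) = (\<Sum>b\<in>B - {e}. s b * t b) - s e * t e" for s t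
  proof -
    have "g p (\<Sum>b\<in>B. s b *\<^sub>R b) (\<Sum>b\<in>B. t b *\<^sub>R b) = (\<Sum>b\<in>B. s b * (t b * g p b b))"
      using BT gb by (subst coef) (auto intro!: tangent_space_sum tangent_space_scale)
    also have "\<dots> = s e * (t e * g p e e) + (\<Sum>b\<in>B - {e}. s b * (t b * g p b b))"
      by (rule sum.remove[OF fin B(1)])
    also have "(\<Sum>b\<in>B - {e}. s b * (t b * g p b b)) = (\<Sum>b\<in>B - {e}. s b * t b)"
      using B(5) by (intro sum.cong) auto
    finally show ?thesis using B(4) by simp
  qed
  define aa where "aa = (\<Sum>b\<in>B - {e}. (a b)\<^sup>2)"
  define xx where "xx = (\<Sum>b\<in>B - {e}. (x b)\<^sup>2)"
  have 1: "(\<Sum>b\<in>B - {e}. a b * x b) = a e * x e" using o form[of a x] by (simp add: a x)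
  have 2: "xx = (x e)\<^sup>2 - 1" using \<xi>(2) form[of x x] by (simp add: x xx_def power2_eq_square)
  have 3: "aa \<le> (a e)\<^sup>2" using nonpos form[of a a] by (simp add: a aa_def power2_eq_square)
  have xx0: "xx \<ge> 0" unfolding xx_def by (rule sum_nonneg) simp
  have aa0: "aa \<ge> 0" unfolding aa_def by (rule sum_nonneg) simp
  \<comment> \<open>Orthogonality and Cauchy-Schwarz on the spacelike part bound the square of a e
    times x e by the square of a e times the square of x e minus 1. So a e is 0, and then so is the
    spacelike part.\<close>
  have "(a e * x e)\<^sup>2 \<le> aa * xx"
    using Cauchy_Schwarz_ineq_sum[of a x "B - {e}"] by (simp add: 1 aa_def xx_def)
  also have "\<dots> \<le> (a e)\<^sup>2 * xx" using 3 xx0 by (rule mult_right_mono)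
  finally have "(a e)\<^sup>2 \<le> 0" by (simp add: 2 power_mult_distrib algebra_simps)
  then have ae: "a e = 0" by simp
  then have "aa = 0" using 3 aa0 by simp
  then have "a b = 0" if "b \<in> B - {e}" for b
    using that fin unfolding aa_def by (simp add: sum_nonneg_eq_0_iff)
  then have "a b = 0" if "b \<in> B" for b using ae that by (cases "b = e") auto
  then show ?thesis by (simp add: a)
qed

text \<open>Gram-Schmidt as an induction over a spanning set. The metric is indefinite, so the
  division by \<open>g p s' s'\<close> rests on the positivity assumed on P.\<close>

lemma orthogonal_projection:
  assumes "finite S" and P: "subspace P" "P \<subseteq> tangent_space A p"
    and pos: "\<And>u. u \<in> P \<Longrightarrow> g p u u \<le> 0 \<Longrightarrow> u = 0" and "S \<subseteq> P" and "z \<in> tangent_space A p"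
  shows "\<exists>u\<in>span S. \<forall>s\<in>S. g p (z - u) s = 0"
  using assms(1,5,6)
proof (induction S arbitrary: z)
  case empty
  then show ?case by simp
next
  case (insert s S)
  have SP: "S \<subseteq> P" "s \<in> P" and ST: "S \<subseteq> tangent_space A p" "s \<in> tangent_space A p"
    using insert.prems P(2) by auto
  have sub: "span S \<subseteq> P" using SP(1) P(1) by (simp add: span_minimal)
  obtain s0 where s0: "s0 \<in> span S" "\<And>x. x \<in> S \<Longrightarrow> g p (s - s0) x = 0"
    using insert.IH[OF SP(1) ST(2)] by blast
  obtain z0 where z0: "z0 \<in> span S" "\<And>x. x \<in> S \<Longrightarrow> g p (z - z0) x = 0"
    using insert.IH[OF SP(1) insert.prems(2)] by blast
  define s' where "s' = s - s0"
  have s': "s' \<in> P" "s' \<in> tangent_space A p"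
    using SP(2) s0(1) sub P subspace_diff[OF P(1)] by (auto simp: s'_def)
  have T: "z0 \<in> tangent_space A p" "s0 \<in> tangent_space A p" "z - z0 \<in> tangent_space A p"
    using z0(1) s0(1) sub P(2) insert.prems(2) by (auto intro: tangent_space_diff)
  have mono: "span S \<subseteq> span (insert s S)" by (intro span_mono) auto
  have zs0: "g p (z - z0) s0 = 0"
    using metric_orthogonal_span[OF T(3) ST(1) z0(2) s0(1)] by blast
  show ?case
  \<comment> \<open>S may be dependent. If s already lies in the span of the earlier vectors, the
    previous projection still works.\<close>
  proof (cases "s' = 0")
    case True
    then have "g p (z - z0) s = 0" using zs0 by (simp add: s'_def)
    then show ?thesis using z0 mono by blast
  next
    case False
    define k where "k = g p (z - z0) s' / g p s' s'"
    define u where "u = z0 + k *\<^sub>R s'"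
    have nz: "g p s' s' \<noteq> 0" using pos[OF s'(1)] False by auto
    have zu: "z - u = (z - z0) - k *\<^sub>R s'" by (simp add: u_def)
    have ks: "k *\<^sub>R s' \<in> tangent_space A p" by (rule tangent_space_scale[OF s'(2)])
    have orth: "g p (z - u) x = g p (z - z0) x - k * g p s' x" if "x \<in> tangent_space A p" for x
      unfolding zu using metric_diff_left[OF T(3) ks that] metric_scale_left[OF s'(2) that] by simp
    have "g p (z - u) x = 0" if "x \<in> S" for x
      using orth[of x] that ST(1) z0(2) s0(2) by (auto simp: s'_def)
    moreover have "g p (z - u) s = 0"
    proof -
      have "g p (z - u) s' = 0" using orth[OF s'(2)] nz by (simp add: k_def)
      moreover have "g p s' s0 = 0"
        using metric_orthogonal_span[OF s'(2) ST(1) _ s0(1)] s0(2) by (simp add: s'_def)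
      then have "g p (z - u) s0 = 0" using orth[OF T(2)] zs0 by simp
      moreover have "g p (z - u) s = g p (z - u) (s' + s0)" by (simp add: s'_def)
      ultimately show ?thesis
        using metric_add_right[OF s'(2) T(2), of "z - u"] T(3) ks by (simp add: zu tangent_space_diff)
    qed
    moreover have "u \<in> span (insert s S)"
    proof -
      have "s' \<in> span (insert s S)"
        unfolding s'_def using s0(1) mono by (intro span_diff) (auto intro: span_base)
      then show ?thesis unfolding u_def using z0(1) mono by (intro span_add span_scale) auto
    qed
    ultimately show ?thesis by blast
  qed
qed

end

section \<open>The Gauss decomposition along a submanifold with a timelike tangent field\<close>

locale submanifold_tangent_timelike =
  immersed_manifold A A' \<iota> + amb: lorentzian_manifold A' g
  for A :: "('b::{t2_space, second_countable_topology}, 'f::euclidean_space) chart set"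
    and A' :: "('a::{t2_space, second_countable_topology}, 'e::euclidean_space) chart set"
    and \<iota> :: "'b \<Rightarrow> 'a" and g :: "'a \<Rightarrow> 'a tvec \<Rightarrow> 'a tvec \<Rightarrow> real" +
  fixes \<xi> :: "'a vfield" and nabla :: "'a connection"
  assumes LC: "levi_civita A' g nabla"
    and \<xi>_field: "\<xi> \<in> vector_fields A'" and \<xi>_timelike: "g p (\<xi> p) (\<xi> p) = -1"
    and \<xi>_tangent: "\<xi> (\<iota> q) \<in> pf ` tangent_space A q"
begin

abbreviation "TM q \<equiv> pf ` tangent_space A q"

lemma subspace_TM: "subspace (TM q)"
  by (rule linear_subspace_image[OF linear_push subspace_tangent_space])

lemma TM_tangent: "u \<in> TM q \<Longrightarrow> u \<in> tangent_space A' (\<iota> q)"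
  using pf_tangent by auto

lemma normal_tangent: "n \<in> normal_space A A' \<iota> g q \<Longrightarrow> n \<in> tangent_space A' (\<iota> q)"
  by (simp add: normal_space_def)

lemma normal_orthogonal: "n \<in> normal_space A A' \<iota> g q \<Longrightarrow> u \<in> TM q \<Longrightarrow> g (\<iota> q) n u = 0"
  by (auto simp: normal_space_def)

lemma normal_diff:
  assumes "m \<in> normal_space A A' \<iota> g q" "n \<in> normal_space A A' \<iota> g q"
  shows "m - n \<in> normal_space A A' \<iota> g q"
  using assms
  by (auto simp: normal_space_def amb.metric_diff_left pf_tangent tangent_space_diff)

text \<open>It suffices to test v against \<xi> and against v itself.\<close>

lemma metric_nondegenerate:
  assumes v: "v \<in> tangent_space A' p" and 0: "\<And>w. w \<in> tangent_space A' p \<Longrightarrow> g p v w = 0"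
  shows "v = 0"
  using amb.orthogonal_to_timelike[OF vector_field_tangent[OF \<xi>_field] \<xi>_timelike v]
    0[OF v] 0[OF vector_field_tangent[OF \<xi>_field]] by simp

text \<open>Such a vector is orthogonal to itself and to the tangent vector \<xi>, so the positivity
  on the complement of \<xi> applies. This makes normal components unique.\<close>

lemma normal_TM_eq_0:
  assumes n: "n \<in> normal_space A A' \<iota> g q" "n \<in> TM q"
  shows "n = 0"
  using amb.orthogonal_to_timelike[OF vector_field_tangent[OF \<xi>_field] \<xi>_timelike normal_tangent[OF n(1)]]
    normal_orthogonal[OF n(1) \<xi>_tangent] normal_orthogonal[OF n] by simp

text \<open>As \<open>\<xi>\<close> is timelike, its orthogonal complement in \<open>TM\<close> is positive definite, so that one can
  project to it.\<close>

lemma normal_component_exists: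
  assumes z: "z \<in> tangent_space A' (\<iota> q)"
  shows "\<exists>n. n \<in> normal_space A A' \<iota> g q \<and> z - n \<in> TM q"
proof -
  let ?p = "\<iota> q"
  note \<xi>T = vector_field_tangent[OF \<xi>_field, of ?p]
  obtain c where c: "c \<in> A" "admissible_chart A c" "q \<in> fst c" using sub.atlas_cover .
  \<comment> \<open>Orthogonal projection off \<xi>; the plus sign is due to
    \<open>g p (\<xi> p) (\<xi> p) = -1\<close>.\<close>
  define pr where "pr w = w + g ?p w (\<xi> ?p) *\<^sub>R \<xi> ?p" for w
  have pr_orth: "g ?p (pr w) (\<xi> ?p) = 0" and pr_T: "pr w \<in> tangent_space A' ?p"
    if "w \<in> tangent_space A' ?p" for w
    using that \<xi>T \<xi>_timelike
    by (simp_all add: pr_def amb.metric_add_left amb.metric_scale_left tangent_space_add tangent_space_scale)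
  have pr_TM: "pr w \<in> TM q" if "w \<in> TM q" for w
    unfolding pr_def using that \<xi>_tangent subspace_TM by (intro subspace_add subspace_scale)
  define P where "P = {w \<in> TM q. g ?p w (\<xi> ?p) = 0}"
  have P: "subspace P"
    unfolding subspace_def
  proof (intro conjI ballI allI)
    show "0 \<in> P" by (simp add: P_def subspace_0[OF subspace_TM] amb.metric_zero_left \<xi>T)
    show "x + y \<in> P" if "x \<in> P" "y \<in> P" for x y
      using that subspace_add[OF subspace_TM, of x q y] by (simp add: P_def amb.metric_add_left TM_tangent \<xi>T)
    show "r *\<^sub>R x \<in> P" if "x \<in> P" for r x
      using that subspace_scale[OF subspace_TM, of x q r] by (simp add: P_def amb.metric_scale_left TM_tangent \<xi>T)
  qed
  define t where "t b = pf (coord_vector A c q b)" for b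
  have t: "t b \<in> TM q" for b using sub.coord_vector_tangent[OF c(2,3)] by (simp add: t_def)
  define S where "S = (\<lambda>b. pr (t b)) ` (Basis :: 'f set)"
  have SP: "S \<subseteq> P" using t pr_TM pr_orth TM_tangent by (auto simp: S_def P_def)
  have PT: "P \<subseteq> tangent_space A' ?p" using TM_tangent by (auto simp: P_def)
  have fin: "finite S" by (simp add: S_def)
  have pos: "w = 0" if "w \<in> P" "g ?p w w \<le> 0" for w
    using amb.orthogonal_to_timelike[OF \<xi>T \<xi>_timelike _ _ that(2)] that(1) TM_tangent by (auto simp: P_def)
  obtain u where u: "u \<in> span S" "\<And>s. s \<in> S \<Longrightarrow> g ?p (pr z - u) s = 0"
    using amb.orthogonal_projection[OF fin P PT pos SP pr_T[OF z]] by blast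
  have uP: "u \<in> P" using u(1) span_minimal[OF SP P] by blast
  have uT: "u \<in> tangent_space A' ?p" using uP PT by blast
  define n where "n = pr z - u"
  have nT: "n \<in> tangent_space A' ?p" unfolding n_def by (rule tangent_space_diff[OF pr_T[OF z] uT])
  have n\<xi>: "g ?p n (\<xi> ?p) = 0"
    unfolding n_def using amb.metric_diff_left[OF pr_T[OF z] uT \<xi>T] pr_orth[OF z] uP by (simp add: P_def)
  have nt: "g ?p n (t b) = 0" if "b \<in> Basis" for b
  proof -
    have "g ?p n (pr (t b)) = 0" using u(2) that by (simp add: n_def S_def)
    then show ?thesis
      using n\<xi> nT \<xi>T TM_tangent[OF t[of b]]
      by (simp add: pr_def amb.metric_add_right amb.metric_scale_right tangent_space_scale)
  qed
  have "g ?p n (pf v) = 0" if v: "v \<in> tangent_space A q" for v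
  proof -
    obtain w where "v = coord_vector A c q w"
      using v sub.tangent_space_eq_coord_vectors[OF c(2,3)] by blast
    then have "v = (\<Sum>b\<in>Basis. (w \<bullet> b) *\<^sub>R coord_vector A c q b)"
      using linear_sum[OF sub.linear_coord_vector[OF c(2,3)], of "\<lambda>b. (w \<bullet> b) *\<^sub>R b" Basis]
      by (simp add: euclidean_representation linear_cmul[OF sub.linear_coord_vector[OF c(2,3)]])
    then have "pf v = (\<Sum>b\<in>Basis. (w \<bullet> b) *\<^sub>R t b)"
      by (simp add: t_def linear_sum[OF linear_push] push_scaleR)
    then have "pf v \<in> span (t ` Basis)"
      by (simp add: span_sum span_scale span_base)
    then show ?thesis
      using amb.metric_orthogonal_span[OF nT, of "t ` Basis"] nt TM_tangent[OF t] by blast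
  qed
  then have "n \<in> normal_space A A' \<iota> g q" using nT by (simp add: normal_space_def)
  \<comment> \<open>Replacing z by its projection changes it by a multiple of \<xi>, which is
    tangent, so n is a normal component of z itself.\<close>
  moreover have "z - n = u - g ?p z (\<xi> ?p) *\<^sub>R \<xi> ?p" by (simp add: n_def pr_def)
  then have "z - n \<in> TM q"
    using uP subspace_diff[OF subspace_TM _ subspace_scale[OF subspace_TM \<xi>_tangent], of u] by (simp add: P_def)
  ultimately show ?thesis by blast
qed

lemma
  assumes "X \<in> vector_fields A'" "Y \<in> vector_fields A'"
  shows nabla_field: "nabla X Y \<in> vector_fields A'"
    and nabla_add_left: "\<And>X'. X' \<in> vector_fields A' \<Longrightarrow> nabla (X + X') Y = nabla X Y + nabla X' Y"
    and nabla_add_right: "\<And>Y'. Y' \<in> vector_fields A' \<Longrightarrow> nabla X (Y + Y') = nabla X Y + nabla X Y'"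
    and nabla_torsion_free: "nabla X Y = nabla Y X + lie_bracket X Y"
    and nabla_metric: "\<And>Z p. Z \<in> vector_fields A' \<Longrightarrow>
      X p (\<lambda>q. g q (Y q) (Z q)) = g p (nabla X Y p) (Z p) + g p (Y p) (nabla X Z p)"
proof -
  have t: "nabla X Y - nabla Y X = lie_bracket X Y"
    using LC assms by (simp add: levi_civita_def)
  show "nabla X Y = nabla Y X + lie_bracket X Y" by (simp flip: t)
qed (use LC assms in \<open>auto simp: levi_civita_def affine_connection_def\<close>)

text \<open>Metric compatibility with an arbitrary W: the function g(Z, W) vanishes along the
  submanifold and X is tangent to it, so the left side is 0, and nondegeneracy concludes. In this
  way no coordinate formula for the connection is involved.\<close>

lemma nabla_vanishing_right:
  assumes Z: "Z \<in> vector_fields A'" "open S" "q \<in> S" "\<And>r. r \<in> S \<Longrightarrow> Z (\<iota> r) = 0"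
    and X: "X \<in> vector_fields A'" "X (\<iota> q) \<in> TM q"
  shows "nabla X Z (\<iota> q) = 0"
proof (rule metric_nondegenerate)
  let ?p = "\<iota> q"
  show "nabla X Z ?p \<in> tangent_space A' ?p" by (rule vector_field_tangent[OF nabla_field[OF X(1) Z(1)]])
  fix w assume "w \<in> tangent_space A' ?p"
  then obtain W where W: "W \<in> vector_fields A'" "W ?p = w" using amb.tangent_vector_extension by blast
  obtain x where x: "x \<in> tangent_space A q" "X ?p = pf x" using X(2) by blast
  have "pf x (\<lambda>p. g p (Z p) (W p)) = x (\<lambda>r. 0)"
    by (rule pf_local_apply[OF x(1) amb.metric_smooth[OF Z(1) W(1)] sub.smooth_functions_const Z(2,3)])
      (simp add: Z(4) amb.metric_zero_left vector_field_tangent[OF W(1)])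
  then have "X ?p (\<lambda>p. g p (Z p) (W p)) = 0"
    using x sub.tangent_vector_const[OF x(1)] by simp
  then show "g ?p (nabla X Z ?p) w = 0"
    using nabla_metric[OF X(1) Z(1) W(1), of ?p] W(2) Z(3,4)
    by (simp add: amb.metric_zero_left vector_field_tangent[OF nabla_field[OF X(1) W(1)]])
qed

text \<open>By vanishing torsion, the claim reduces to the other slot and to the bracket. The
  bracket is 0 at q because Z is 0 there and \<open>Z p f\<close> vanishes along the submanifold, to
  which X is tangent.\<close>

lemma nabla_vanishing_left:
  assumes Z: "Z \<in> vector_fields A'" "open S" "q \<in> S" "\<And>r. r \<in> S \<Longrightarrow> Z (\<iota> r) = 0"
    and X: "X \<in> vector_fields A'" "X (\<iota> q) \<in> TM q"
  shows "nabla Z X (\<iota> q) = 0"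
proof -
  obtain x where x: "x \<in> tangent_space A q" "X (\<iota> q) = pf x" using X(2) by blast
  have "lie_bracket Z X (\<iota> q) f = 0" for f
  proof (cases "f \<in> smooth_functions A'")
    case f: True
    have "pf x (\<lambda>p. Z p f) = x (\<lambda>r. 0)"
      by (rule pf_local_apply[OF x(1) vector_field_smooth[OF Z(1) f] sub.smooth_functions_const Z(2,3)])
        (simp add: Z(4))
    then show ?thesis
      using x Z(3,4) sub.tangent_vector_const[OF x(1)] by (simp add: lie_bracket_def)
  next
    case False
    then show ?thesis
      using tangent_vector_not_smooth[OF vector_field_tangent[OF amb.lie_bracket_vector_field[OF Z(1) X(1)]]] by blast
  qed
  then have "lie_bracket Z X (\<iota> q) = 0" by (simp add: fun_eq_iff)
  then show ?thesis
    using nabla_torsion_free[OF Z(1) X(1)] nabla_vanishing_right[OF Z X] by simp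
qed

text \<open>Two extensions of the same field differ by a field that vanishes along the submanifold
  near q, so the two preceding lemmas apply, one for each slot.\<close>

lemma nabla_extension_unique:
  assumes t: "X q \<in> tangent_space A q" "Y q \<in> tangent_space A q"
    and X: "extends_near A' \<iota> q X X1" "extends_near A' \<iota> q X X2"
    and Y: "extends_near A' \<iota> q Y Y1" "extends_near A' \<iota> q Y Y2"
  shows "nabla X1 Y1 (\<iota> q) = nabla X2 Y2 (\<iota> q)"
proof -
  note f = extends_nearD(1)[OF X(1)] extends_nearD(1)[OF X(2)] extends_nearD(1)[OF Y(1)] extends_nearD(1)[OF Y(2)]
  have vanish: "\<exists>S. open S \<and> q \<in> S \<and> (\<forall>r\<in>S. (Z1 - Z2) (\<iota> r) = 0)"
    if e: "extends_near A' \<iota> q Z Z1" "extends_near A' \<iota> q Z Z2" for Z Z1 Z2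
  proof -
    obtain S1 where S1: "open S1" "q \<in> S1" "\<And>r. r \<in> S1 \<Longrightarrow> Z1 (\<iota> r) = pf (Z r)"
      using e(1) unfolding extends_near_def by blast
    obtain S2 where S2: "open S2" "q \<in> S2" "\<And>r. r \<in> S2 \<Longrightarrow> Z2 (\<iota> r) = pf (Z r)"
      using e(2) unfolding extends_near_def by blast
    have "(Z1 - Z2) (\<iota> r) = 0" if "r \<in> S1 \<inter> S2" for r
      using S1(3)[of r] S2(3)[of r] that by (simp add: fun_diff_def zero_fun_def)
    then show ?thesis using S1(1,2) S2(1,2) by (intro exI[of _ "S1 \<inter> S2"]) blast
  qed
  obtain S where S: "open S" "q \<in> S" "\<And>r. r \<in> S \<Longrightarrow> (X1 - X2) (\<iota> r) = 0" using vanish[OF X] by blast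
  obtain T where T: "open T" "q \<in> T" "\<And>r. r \<in> T \<Longrightarrow> (Y1 - Y2) (\<iota> r) = 0" using vanish[OF Y] by blast
  have "X2 (\<iota> q) \<in> TM q" "Y1 (\<iota> q) \<in> TM q"
    using t extends_nearD(2)[OF X(2)] extends_nearD(2)[OF Y(1)] by blast+
  then have "nabla (X1 - X2) Y1 (\<iota> q) = 0" "nabla X2 (Y1 - Y2) (\<iota> q) = 0"
    using nabla_vanishing_left[OF amb.vector_fields_diff[OF f(1,2)] S f(3)]
      nabla_vanishing_right[OF amb.vector_fields_diff[OF f(3,4)] T f(2)] by blast+
  moreover have "nabla X1 Y1 = nabla (X1 - X2) Y1 + nabla X2 Y1"
    using nabla_add_left[OF amb.vector_fields_diff[OF f(1,2)] f(3) f(2)] by simp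
  moreover have "nabla X2 Y1 = nabla X2 (Y1 - Y2) + nabla X2 Y2"
    using nabla_add_right[OF f(2) amb.vector_fields_diff[OF f(3,4)] f(4)] by simp
  ultimately show ?thesis by (simp only: plus_fun_apply add_0_left)
qed

text \<open>The definite description is meaningful: a normal component exists, it is unique, and it
  does not depend on the extensions. Any chosen pair of extensions may then be used to compute
  it.\<close>

lemma second_fundamental_form:
  assumes t: "X q \<in> tangent_space A q" "Y q \<in> tangent_space A q"
    and X: "extends_near A' \<iota> q X X'" and Y: "extends_near A' \<iota> q Y Y'"
  shows "second_fundamental_form A A' \<iota> g nabla X Y q \<in> normal_space A A' \<iota> g q"
    and "nabla X' Y' (\<iota> q) - second_fundamental_form A A' \<iota> g nabla X Y q \<in> TM q"
proof -
  let ?R = "\<lambda>n. n \<in> normal_space A A' \<iota> g q \<and> (\<exists>X' Y'. extends_near A' \<iota> q X X' \<and>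
    extends_near A' \<iota> q Y Y' \<and> nabla X' Y' (\<iota> q) - n \<in> TM q)"
  let ?h = "second_fundamental_form A A' \<iota> g nabla X Y q"
  have R: "?R n \<longleftrightarrow> n \<in> normal_space A A' \<iota> g q \<and> nabla X' Y' (\<iota> q) - n \<in> TM q" for n
    using X Y nabla_extension_unique[of X q Y, OF t _ X _ Y] by metis
  have "\<exists>!n. ?R n"
  proof (rule ex_ex1I)
    show "\<exists>n. ?R n"
      unfolding R
      by (rule normal_component_exists[OF vector_field_tangent[OF nabla_field[OF extends_nearD(1)[OF X] extends_nearD(1)[OF Y]]]])
    fix m n assume "?R m" "?R n"
    then have mn: "m \<in> normal_space A A' \<iota> g q" "n \<in> normal_space A A' \<iota> g q"
      "nabla X' Y' (\<iota> q) - m \<in> TM q" "nabla X' Y' (\<iota> q) - n \<in> TM q" unfolding R by auto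
    have "m - n \<in> TM q" using subspace_diff[OF subspace_TM mn(4,3)] by simp
    then show "m = n" using normal_TM_eq_0[OF normal_diff[OF mn(1,2)]] by simp
  qed
  from theI'[OF this] have "?R ?h" unfolding second_fundamental_form_def .
  then show "?h \<in> normal_space A A' \<iota> g q" "nabla X' Y' (\<iota> q) - ?h \<in> TM q" unfolding R by auto
qed

text \<open>Since only 0 is both tangent and normal, an equation between values of the second
  fundamental form becomes a tangency condition on covariant derivatives, and no normal component
  has to be computed.\<close>

lemma second_fundamental_form_eq_iff:
  assumes t: "X q \<in> tangent_space A q" "Y q \<in> tangent_space A q" "Z q \<in> tangent_space A q" "W q \<in> tangent_space A q"
    and e: "extends_near A' \<iota> q X X'" "extends_near A' \<iota> q Y Y'" "extends_near A' \<iota> q Z Z'" "extends_near A' \<iota> q W W'"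
  shows "second_fundamental_form A A' \<iota> g nabla X Y q = second_fundamental_form A A' \<iota> g nabla Z W q \<longleftrightarrow>
    nabla X' Y' (\<iota> q) - nabla Z' W' (\<iota> q) \<in> TM q"
proof -
  define a where "a = nabla X' Y' (\<iota> q)"
  define b where "b = nabla Z' W' (\<iota> q)"
  define m where "m = second_fundamental_form A A' \<iota> g nabla X Y q"
  define n where "n = second_fundamental_form A A' \<iota> g nabla Z W q"
  have m: "m \<in> normal_space A A' \<iota> g q" "a - m \<in> TM q"
    using second_fundamental_form[of X q Y, OF t(1,2) e(1,2)] by (simp_all add: m_def a_def)
  have n: "n \<in> normal_space A A' \<iota> g q" "b - n \<in> TM q"
    using second_fundamental_form[of Z q W, OF t(3,4) e(3,4)] by (simp_all add: n_def b_def)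
  have d: "(a - m) - (b - n) \<in> TM q" by (rule subspace_diff[OF subspace_TM m(2) n(2)])
  have "m = n \<longleftrightarrow> a - b \<in> TM q"
  proof
    assume "m = n"
    then show "a - b \<in> TM q" using d by simp
  next
    assume ab: "a - b \<in> TM q"
    have "m - n \<in> TM q" using subspace_diff[OF subspace_TM ab d] by (simp add: algebra_simps)
    then show "m = n" using normal_TM_eq_0[OF normal_diff[OF m(1) n(1)]] by simp
  qed
  then show ?thesis by (simp add: m_def n_def a_def b_def)
qed

end

section \<open>Symmetry of the second fundamental form and involutivity\<close>

text \<open>The equivalence is pointwise and for a single pair of sections; both sides mean that
  \<phi> of the bracket is tangent to the submanifold at q.\<close>

lemma second_fundamental_form_symmetric_iff:
  fixes A' :: "('a::{t2_space, second_countable_topology}, 'e::euclidean_space) chart set"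
    and A :: "('b::{t2_space, second_countable_topology}, 'f::euclidean_space) chart set"
  assumes LP: "LP_Sasakian A' \<phi> \<xi> \<eta> g nabla" and CR: "CR_submanifold A A' \<iota> \<phi> \<xi> g D"
    and hor: "xi_horizontal A' \<iota> \<xi> D"
    and X: "X \<in> sections A D" and Y: "Y \<in> sections A D"
  shows "second_fundamental_form A A' \<iota> g nabla (phi_field A A' \<iota> \<phi> X) Y q =
      second_fundamental_form A A' \<iota> g nabla (phi_field A A' \<iota> \<phi> Y) X q \<longleftrightarrow> lie_bracket X Y q \<in> D q"
proof -
  have \<phi>: "tensor_1_1 A' \<phi>" and \<xi>: "\<xi> \<in> vector_fields A'" and LC: "levi_civita A' g nabla"
    and \<eta>\<xi>: "\<And>p. \<eta> p (\<xi> p) = -1" and lor: "lorentzian_metric A' g"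
    and \<phi>\<phi>_field: "\<And>U p. U \<in> vector_fields A' \<Longrightarrow> \<phi> p (\<phi> p (U p)) = U p + \<eta> p (U p) *\<^sub>R \<xi> p"
    and g\<xi>_field: "\<And>U p. U \<in> vector_fields A' \<Longrightarrow> g p (U p) (\<xi> p) = \<eta> p (U p)"
    and nabla_\<phi>: "\<And>U V p. U \<in> vector_fields A' \<Longrightarrow> V \<in> vector_fields A' \<Longrightarrow>
      nabla U (\<lambda>q. \<phi> q (V q)) p - \<phi> p (nabla U V p) = g p (U p) (V p) *\<^sub>R \<xi> p + \<eta> p (V p) *\<^sub>R U p
        + (2 * \<eta> p (U p) * \<eta> p (V p)) *\<^sub>R \<xi> p"
    using LP unfolding LP_Sasakian_def by auto
  have sub: "submanifold A A' \<iota>" and \<xi>t: "\<And>q. \<xi> (\<iota> q) \<in> push A' \<iota> ` tangent_space A q"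
    and dist: "distribution A D" and \<phi>D: "\<And>q u. u \<in> D q \<Longrightarrow> \<phi> (\<iota> q) (push A' \<iota> u) \<in> push A' \<iota> ` D q"
    and D0: "\<And>q. D q \<inter> orthogonal_complement A A' \<iota> g D q = {0}"
    and Dsum: "\<And>q. {u + w | u w. u \<in> D q \<and> w \<in> orthogonal_complement A A' \<iota> g D q} = tangent_space A q"
    and \<phi>n: "\<And>q w. w \<in> orthogonal_complement A A' \<iota> g D q \<Longrightarrow> \<phi> (\<iota> q) (push A' \<iota> w) \<in> normal_space A A' \<iota> g q"
    using CR unfolding CR_submanifold_def by auto
  have timelike: "g p (\<xi> p) (\<xi> p) = -1" for p using g\<xi>_field[OF \<xi>] \<eta>\<xi> by simp
  interpret submanifold_tangent_timelike A A' \<iota> g \<xi> nabla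
    using sub lor LC \<xi> timelike \<xi>t by unfold_locales (auto simp: submanifold_def)
  have \<phi>_add: "\<phi> p (u + v) = \<phi> p u + \<phi> p v" if "u \<in> tangent_space A' p" "v \<in> tangent_space A' p" for p u v
    using \<phi> that by (simp add: tensor_1_1_def)
  have \<phi>_T: "\<phi> p u \<in> tangent_space A' p" if "u \<in> tangent_space A' p" for p u
    using \<phi> that by (simp add: tensor_1_1_def)
  have \<phi>_0: "\<phi> p 0 = 0" for p
    using \<phi>_add[OF tangent_space_0 tangent_space_0, of p] by simp
  have \<phi>_diff: "\<phi> p (u - v) = \<phi> p u - \<phi> p v" if "u \<in> tangent_space A' p" "v \<in> tangent_space A' p" for p u v
    using \<phi>_add[OF tangent_space_diff[OF that] that(2)] by simp
  have \<phi>_field: "(\<lambda>p. \<phi> p (U p)) \<in> vector_fields A'" if "U \<in> vector_fields A'" for U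
    using \<phi> that by (simp add: tensor_1_1_def)
  \<comment> \<open>The structure identities are given for fields; as every tangent vector is the
    value of a field, they hold for vectors.\<close>
  have \<phi>\<phi>: "\<phi> p (\<phi> p u) = u + \<eta> p u *\<^sub>R \<xi> p" and g\<xi>: "g p u (\<xi> p) = \<eta> p u"
    if u: "u \<in> tangent_space A' p" for p u
  proof -
    obtain U where "U \<in> vector_fields A'" "U p = u" using amb.tangent_vector_extension[OF u] .
    then show "\<phi> p (\<phi> p u) = u + \<eta> p u *\<^sub>R \<xi> p" "g p u (\<xi> p) = \<eta> p u"
      using \<phi>\<phi>_field[of U p] g\<xi>_field[of U p] by auto
  qed
  have D: "subspace (D q)" "D q \<subseteq> tangent_space A q" for q
    using dist by (auto simp: distribution_def)
  have XY: "X \<in> vector_fields A" "Y \<in> vector_fields A" "\<And>q. X q \<in> D q" "\<And>q. Y q \<in> D q"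
    using X Y by (auto simp: sections_def)
  let ?P = "\<lambda>X. phi_field A A' \<iota> \<phi> X"
  have P: "pf (?P Z r) = \<phi> (\<iota> r) (pf (Z r))" "?P Z r \<in> tangent_space A r" if "Z r \<in> D r" for Z r
  proof -
    have m: "\<phi> (\<iota> r) (pf (Z r)) \<in> pf ` tangent_space A r" using \<phi>D[OF that] D(2) by blast
    show "pf (?P Z r) = \<phi> (\<iota> r) (pf (Z r))" unfolding phi_field_def by (rule f_inv_into_f[OF m])
    show "?P Z r \<in> tangent_space A r" unfolding phi_field_def by (rule inv_into_into[OF m])
  qed
  \<comment> \<open>\<phi> applied to an extension of Z extends \<phi> Z. This also gives the
    smoothness of \<open>phi_field\<close>, which is defined pointwise by an inverse.\<close>
  have P_extends: "extends_near A' \<iota> r (?P Z) (\<lambda>p. \<phi> p (Z' p))"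
    if Z: "extends_near A' \<iota> r Z Z'" "\<And>q. Z q \<in> D q" for Z Z' r
  proof -
    obtain S where S: "open S" "r \<in> S" "\<And>s. s \<in> S \<Longrightarrow> Z' (\<iota> s) = pf (Z s)"
      using Z(1) unfolding extends_near_def by blast
    have "\<phi> (\<iota> s) (Z' (\<iota> s)) = pf (?P Z s)" if "s \<in> S" for s
      using S(3)[OF that] P(1)[of Z s, OF Z(2)] by simp
    then show ?thesis
      unfolding extends_near_def using S(1,2) \<phi>_field[OF extends_nearD(1)[OF Z(1)]] by blast
  qed
  have P_field: "?P Z \<in> vector_fields A" if Z: "Z \<in> vector_fields A" "\<And>q. Z q \<in> D q" for Z
  proof (rule vector_fieldI_extension)
    fix r
    show "?P Z r \<in> tangent_space A r" by (rule P(2)[of Z r, OF Z(2)])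
    obtain Z' where "extends_near A' \<iota> r Z Z'" by (rule vector_field_extends[OF Z(1)])
    from P_extends[OF this Z(2)] show "\<exists>X'. extends_near A' \<iota> r (?P Z) X'" by blast
  qed
  obtain X' where X': "extends_near A' \<iota> q X X'" by (rule vector_field_extends[OF XY(1)])
  obtain Y' where Y': "extends_near A' \<iota> q Y Y'" by (rule vector_field_extends[OF XY(2)])
  note f = extends_nearD(1)[OF X'] extends_nearD(1)[OF Y']
  let ?p = "\<iota> q"
  let ?\<phi>X = "\<lambda>p. \<phi> p (X' p)" and ?\<phi>Y = "\<lambda>p. \<phi> p (Y' p)"
  note e = P_extends[OF X' XY(3)] P_extends[OF Y' XY(4)]
  note TM = subspace_TM[of q]
  have T: "X' ?p \<in> TM q" "Y' ?p \<in> TM q" "\<xi> ?p \<in> TM q"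
    using extends_nearD(2)[OF X'] extends_nearD(2)[OF Y'] \<xi>_tangent
      vector_field_tangent[OF XY(1)] vector_field_tangent[OF XY(2)] by auto
  \<comment> \<open>Brackets of fields on the submanifold stay tangent. Hence exchanging the two
    arguments of the connection changes it only by a tangent vector.\<close>
  have b: "lie_bracket ?\<phi>X Y' ?p \<in> TM q" "lie_bracket ?\<phi>Y X' ?p \<in> TM q"
    using lie_bracket_extension[OF P_field[OF XY(1,3)] e(1) XY(2) Y']
      lie_bracket_extension[OF P_field[OF XY(2,4)] e(2) XY(1) X']
      vector_field_tangent[OF sub.lie_bracket_vector_field[OF P_field[OF XY(1,3)] XY(2)]]
      vector_field_tangent[OF sub.lie_bracket_vector_field[OF P_field[OF XY(2,4)] XY(1)]] by auto
  define B where "B = lie_bracket X Y q"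
  have B: "B \<in> tangent_space A q"
    unfolding B_def by (rule vector_field_tangent[OF sub.lie_bracket_vector_field[OF XY(1,2)]])
  have "nabla X' Y' ?p - nabla Y' X' ?p = pf B"
    using nabla_torsion_free[OF f] lie_bracket_extension[OF XY(1) X' XY(2) Y'] by (simp add: B_def)
  then have \<phi>B: "\<phi> ?p (nabla X' Y' ?p) - \<phi> ?p (nabla Y' X' ?p) = \<phi> ?p (pf B)"
    using \<phi>_diff[OF vector_field_tangent[OF nabla_field[OF f]] vector_field_tangent[OF nabla_field[OF f(2,1)]], symmetric]
    by simp
  \<comment> \<open>What survives of the right side of the structure equation after
    antisymmetrising: its multiples of \<xi> are symmetric in the two fields and cancel.\<close>
  define R where "R = \<eta> ?p (Y' ?p) *\<^sub>R X' ?p - \<eta> ?p (X' ?p) *\<^sub>R Y' ?p"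
  have 1: "nabla X' ?\<phi>Y ?p = \<phi> ?p (nabla X' Y' ?p) + (g ?p (X' ?p) (Y' ?p) *\<^sub>R \<xi> ?p + \<eta> ?p (Y' ?p) *\<^sub>R X' ?p
      + (2 * \<eta> ?p (X' ?p) * \<eta> ?p (Y' ?p)) *\<^sub>R \<xi> ?p)"
    using nabla_\<phi>[OF f, of ?p] unfolding diff_eq_eq by (simp only: add.commute)
  have 2: "nabla Y' ?\<phi>X ?p = \<phi> ?p (nabla Y' X' ?p) + (g ?p (Y' ?p) (X' ?p) *\<^sub>R \<xi> ?p + \<eta> ?p (X' ?p) *\<^sub>R Y' ?p
      + (2 * \<eta> ?p (Y' ?p) * \<eta> ?p (X' ?p)) *\<^sub>R \<xi> ?p)"
    using nabla_\<phi>[OF f(2,1), of ?p] unfolding diff_eq_eq by (simp only: add.commute)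
  have 3: "g ?p (Y' ?p) (X' ?p) = g ?p (X' ?p) (Y' ?p)"
    by (rule amb.metric_sym[OF vector_field_tangent[OF f(2)] vector_field_tangent[OF f(1)]])
  have 4: "2 * \<eta> ?p (Y' ?p) * \<eta> ?p (X' ?p) = 2 * \<eta> ?p (X' ?p) * \<eta> ?p (Y' ?p)" by simp
  have d: "nabla X' ?\<phi>Y ?p - nabla Y' ?\<phi>X ?p = \<phi> ?p (pf B) + R"
    unfolding R_def \<phi>B[symmetric] 1 2 3 4 by (simp only: diff_conv_add_uminus minus_add_distrib) simp
  have R: "R \<in> TM q" unfolding R_def using T by (intro subspace_diff[OF TM] subspace_scale[OF TM])
  define L where "L = lie_bracket ?\<phi>X Y' ?p - lie_bracket ?\<phi>Y X' ?p - R"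
  have L: "L \<in> TM q" unfolding L_def by (intro subspace_diff[OF TM] b R)
  have e1: "nabla ?\<phi>X Y' ?p = nabla Y' ?\<phi>X ?p + lie_bracket ?\<phi>X Y' ?p"
    using nabla_torsion_free[OF \<phi>_field[OF f(1)] f(2)] by (simp only: plus_fun_apply)
  have e2: "nabla ?\<phi>Y X' ?p = nabla X' ?\<phi>Y ?p + lie_bracket ?\<phi>Y X' ?p"
    using nabla_torsion_free[OF \<phi>_field[OF f(2)] f(1)] by (simp only: plus_fun_apply)
  have e3: "nabla X' ?\<phi>Y ?p = nabla Y' ?\<phi>X ?p + (\<phi> ?p (pf B) + R)"
    using d unfolding diff_eq_eq by (simp only: add.commute)
  define k where "k = nabla ?\<phi>X Y' ?p - nabla ?\<phi>Y X' ?p"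
  have k: "k = L - \<phi> ?p (pf B)"
    unfolding k_def e1 e2 e3 L_def by (simp only: diff_conv_add_uminus minus_add_distrib) simp
  have "k \<in> TM q \<longleftrightarrow> \<phi> ?p (pf B) \<in> TM q"
    using subspace_diff[OF TM L, of k] subspace_diff[OF TM L, of "\<phi> ?p (pf B)"] by (auto simp: k)
  then have "nabla ?\<phi>X Y' ?p - nabla ?\<phi>Y X' ?p \<in> TM q \<longleftrightarrow> \<phi> ?p (pf B) \<in> TM q"
    by (simp only: k_def)
  moreover have "\<phi> ?p (pf B) \<in> TM q \<longleftrightarrow> B \<in> D q"
  proof
    assume "B \<in> D q"
    then show "\<phi> ?p (pf B) \<in> TM q" using \<phi>D D(2) by blast
  next
    assume t: "\<phi> ?p (pf B) \<in> TM q"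
    obtain u w where uw: "B = u + w" "u \<in> D q" "w \<in> orthogonal_complement A A' \<iota> g D q"
      using B Dsum[of q] by blast
    have uT: "u \<in> tangent_space A q" using uw(2) D(2) by blast
    have wT: "w \<in> tangent_space A q" using uw(3) by (simp add: orthogonal_complement_def)
    have "\<phi> ?p (pf B) = \<phi> ?p (pf u) + \<phi> ?p (pf w)"
      using \<phi>_add[OF pf_tangent[OF uT] pf_tangent[OF wT]] by (simp add: uw(1) push_add)
    moreover have "\<phi> ?p (pf u) \<in> TM q" using \<phi>D[OF uw(2)] D(2) by blast
    ultimately have "\<phi> ?p (pf w) \<in> TM q" using subspace_diff[OF TM t] by (metis add_diff_cancel_left')
    \<comment> \<open>The vector is tangent by the computation and normal by the CR
      condition.\<close>
    then have "\<phi> ?p (pf w) = 0" using normal_TM_eq_0[OF \<phi>n[OF uw(3)]] by blast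
    then have "pf w + \<eta> ?p (pf w) *\<^sub>R \<xi> ?p = 0" using \<phi>\<phi>[OF pf_tangent[OF wT]] \<phi>_0 by metis
    \<comment> \<open>Here \<xi> being horizontal is used: w is orthogonal to \<open>D\<close>,
      which contains \<xi>. So \<phi> applied twice to w returns w.\<close>
    moreover have "\<eta> ?p (pf w) = 0"
    proof -
      obtain v where v: "v \<in> D q" "\<xi> ?p = pf v" using hor by (auto simp: xi_horizontal_def)
      then have "g ?p (pf w) (\<xi> ?p) = 0" using uw(3) by (simp add: orthogonal_complement_def)
      then show ?thesis using g\<xi>[OF pf_tangent[OF wT]] by simp
    qed
    ultimately have "pf w = 0" by simp
    then have "w = 0" by (rule pf_eq_0[OF wT])
    then show "B \<in> D q" using uw by simp
  qed
  moreover have "X q \<in> tangent_space A q" "Y q \<in> tangent_space A q"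
    by (rule vector_field_tangent[OF XY(1)] vector_field_tangent[OF XY(2)])+
  ultimately show ?thesis
    using second_fundamental_form_eq_iff[of "?P X" q Y "?P Y" X,
        OF P(2)[of X q, OF XY(3)] _ P(2)[of Y q, OF XY(4)] _ e(1) Y' e(2) X']
    by (simp add: B_def)
qed

section \<open>The Frobenius theorem\<close>

lemma dim_injective_image:
  fixes f :: "'e::euclidean_space \<Rightarrow> 'v::real_vector"
  assumes f: "linear f" "inj f" and W: "subspace W"
  shows "dim (f ` W) = dim W"
proof -
  obtain B where B: "B \<subseteq> W" "independent B" "W \<subseteq> span B" "card B = dim W" by (rule basis_exists)
  have "independent (f ` B)"
    by (rule linear_independent_injective_image[OF f(1) B(2)]) (rule inj_on_subset[OF f(2) subset_UNIV])
  moreover have "f ` W = span (f ` B)"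
  proof -
    have "W = span B" using B(3) span_minimal[OF B(1) W] by blast
    then show ?thesis by (simp only: span_linear_image[OF f(1)])
  qed
  ultimately have "dim (f ` W) = card (f ` B)" by (simp add: dim_span dim_eq_card_independent)
  also have "\<dots> = card B" by (rule card_image[OF inj_on_subset[OF f(2) subset_UNIV]])
  finally show ?thesis by (simp add: B(4))
qed

text \<open>The coefficients are indexed by F and not by the image, since distinct fields may
  coincide at a point. The same coefficients can then be used at neighbouring points.\<close>

lemma span_image_finite_expansion:
  fixes f :: "'i \<Rightarrow> 'v::real_vector"
  assumes "finite F" "v \<in> span (f ` F)"
  obtains k where "v = (\<Sum>i\<in>F. k i *\<^sub>R f i)"
proof -
  have "span (f ` F) \<subseteq> {\<Sum>i\<in>F. k i *\<^sub>R f i |k. True}"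
  proof (rule span_minimal)
    show "subspace {\<Sum>i\<in>F. k i *\<^sub>R f i |k. True}"
      unfolding subspace_def
    proof (intro conjI ballI allI)
      show "0 \<in> {\<Sum>i\<in>F. k i *\<^sub>R f i |k. True}"
        by (rule CollectI, rule exI[of _ "\<lambda>_. 0"]) simp
      fix x assume "x \<in> {\<Sum>i\<in>F. k i *\<^sub>R f i |k. True}"
      then obtain k where x: "x = (\<Sum>i\<in>F. k i *\<^sub>R f i)" by blast
      show "r *\<^sub>R x \<in> {\<Sum>i\<in>F. k i *\<^sub>R f i |k. True}" for r
        by (rule CollectI, rule exI[of _ "\<lambda>i. r * k i"]) (simp add: x scaleR_sum_right)
      fix y assume "y \<in> {\<Sum>i\<in>F. k i *\<^sub>R f i |k. True}"
      then obtain l where y: "y = (\<Sum>i\<in>F. l i *\<^sub>R f i)" by blast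
      show "x + y \<in> {\<Sum>i\<in>F. k i *\<^sub>R f i |k. True}"
        by (rule CollectI, rule exI[of _ "\<lambda>i. k i + l i"]) (simp add: x y scaleR_left_distrib sum.distrib)
    qed
    show "f ` F \<subseteq> {\<Sum>i\<in>F. k i *\<^sub>R f i |k. True}"
    proof (rule image_subsetI)
      fix j assume j: "j \<in> F"
      have "f j = (\<Sum>i\<in>F. (if i = j then 1 else 0) *\<^sub>R f i)"
        using sum.delta[OF assms(1), of j f] j by (simp add: if_distrib[of "\<lambda>r. r *\<^sub>R _"] cong: if_cong)
      then show "f j \<in> {\<Sum>i\<in>F. k i *\<^sub>R f i |k. True}"
        by (intro CollectI exI[of _ "\<lambda>i. if i = j then 1 else 0"]) simp
    qed
  qed
  then show ?thesis using that assms(2) by blast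
qed

lemma derivative_along_zero_segment:
  fixes h :: "'e::real_normed_vector \<Rightarrow> 'g::real_normed_vector"
  assumes h: "(h has_derivative h') (at x)" and "open S" "x \<in> S"
    and z: "\<And>t. x + t *\<^sub>R u \<in> S \<Longrightarrow> h (x + t *\<^sub>R u) = 0"
  shows "h' u = 0"
proof -
  let ?l = "\<lambda>t::real. x + t *\<^sub>R u"
  have 1: "(?l has_derivative (\<lambda>t. t *\<^sub>R u)) (at 0)" by (auto intro!: derivative_eq_intros)
  have "((\<lambda>t. h (?l t)) has_derivative (\<lambda>t. h' (t *\<^sub>R u))) (at 0)"
    by (rule has_derivative_compose[OF 1]) (use h in simp)
  then have "((\<lambda>t. 0) has_derivative (\<lambda>t. h' (t *\<^sub>R u))) (at (0::real))"
  proof (rule has_derivative_transform_within_open)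
    show "open (?l -` S)" by (intro open_vimage assms(2) continuous_intros)
    show "0 \<in> ?l -` S" using assms(3) by simp
  qed (use z in auto)
  then have "(\<lambda>t::real. h' (t *\<^sub>R u)) = (\<lambda>t. 0)"
    by (rule has_derivative_unique) (rule has_derivative_const)
  from fun_cong[OF this, of 1] show ?thesis by simp
qed

section \<open>Chart changes, and integrability implies involutivity\<close>

context manifold
begin

text \<open>A diffeomorphism between open sets of the model space yields a new chart of the maximal
  atlas. This is how the slice charts of the leaves arise; the transformation of coordinate vectors
  identifies the tangent spaces of the slices.\<close>

lemma
  assumes c: "admissible_chart A c" and \<Omega>: "open \<Omega>" "open \<Omega>'" "smooth_on \<Psi> \<Omega>" "smooth_on \<Psi>' \<Omega>'"
    "\<And>x. x \<in> \<Omega> \<Longrightarrow> \<Psi> x \<in> \<Omega>' \<and> \<Psi>' (\<Psi> x) = x" "\<And>y. y \<in> \<Omega>' \<Longrightarrow> \<Psi>' y \<in> \<Omega> \<and> \<Psi> (\<Psi>' y) = y"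
  defines "d \<equiv> ({r \<in> fst c. snd c r \<in> \<Omega>}, \<lambda>r. \<Psi> (snd c r))"
  shows chart_change_admissible: "admissible_chart A d"
    and chart_change_coord_vector: "\<And>r w. r \<in> fst c \<Longrightarrow> snd c r \<in> \<Omega> \<Longrightarrow>
      coord_vector A d r w = coord_vector A c r (frechet_derivative \<Psi>' (at (\<Psi> (snd c r))) w)"
proof -
  note ch = admissible_is_chart[OF c]
  let ?U = "{r \<in> fst c. snd c r \<in> \<Omega>}"
  have fd: "fst d = ?U" and sd: "snd d = (\<lambda>r. \<Psi> (snd c r))" by (simp_all add: d_def)
  have U: "open ?U" by (rule chart_vimage_open[OF ch \<Omega>(1)])
  have inj: "inj_on (snd d) ?U"
  proof (rule inj_onI)
    fix r s assume rs: "r \<in> ?U" "s \<in> ?U" "snd d r = snd d s"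
    then have "\<Psi>' (\<Psi> (snd c r)) = \<Psi>' (\<Psi> (snd c s))" by (simp add: sd)
    then have "snd c r = snd c s" using \<Omega>(5) rs by simp
    then show "r = s" using chart_inv_chart[OF ch] rs by (metis (no_types, lifting) mem_Collect_eq)
  qed
  have im: "snd d ` ?U = \<Omega>' \<inter> \<Psi>' -` (snd c ` fst c)"
  proof
    show "snd d ` ?U \<subseteq> \<Omega>' \<inter> \<Psi>' -` (snd c ` fst c)" using \<Omega>(5) by (auto simp: sd)
    show "\<Omega>' \<inter> \<Psi>' -` (snd c ` fst c) \<subseteq> snd d ` ?U"
    proof
      fix y assume y: "y \<in> \<Omega>' \<inter> \<Psi>' -` (snd c ` fst c)"
      then obtain r where r: "r \<in> fst c" "\<Psi>' y = snd c r" by auto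
      then have "r \<in> ?U" "snd d r = y" using \<Omega>(6)[of y] y by (auto simp: sd)
      then show "y \<in> snd d ` ?U" by blast
    qed
  qed
  have oim: "open (snd d ` ?U)"
    unfolding im by (rule continuous_open_preimage[OF smooth_on_continuous_on[OF \<Omega>(4)] \<Omega>(2) chart_open(2)[OF ch]])
  have inv: "chart_inv d y = chart_inv c (\<Psi>' y)" if "y \<in> snd d ` ?U" for y
  proof -
    obtain r where r: "r \<in> ?U" "y = snd d r" using \<open>y \<in> snd d ` ?U\<close> by blast
    have "chart_inv d y = r" unfolding chart_inv_def r(2) fd using inj r(1) by (rule inv_into_f_f)
    moreover have "chart_inv c (\<Psi>' y) = r"
      using r \<Omega>(5)[of "snd c r"] chart_inv_chart[OF ch] by (auto simp: sd)
    ultimately show ?thesis by simp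
  qed
  have cd: "continuous_on ?U (snd d)"
    unfolding sd
    by (rule continuous_on_compose2[OF smooth_on_continuous_on[OF \<Omega>(3)] continuous_on_subset[OF chart_continuous(1)[OF ch]]]) auto
  have ci: "continuous_on (snd d ` ?U) (chart_inv d)"
  proof -
    have "continuous_on (snd d ` ?U) (\<lambda>y. chart_inv c (\<Psi>' y))"
      by (rule continuous_on_compose2[OF chart_continuous(2)[OF ch] continuous_on_subset[OF smooth_on_continuous_on[OF \<Omega>(4)]]])
        (auto simp: im)
    then show ?thesis using inv by (simp cong: continuous_on_cong)
  qed
  have d: "is_chart d"
    unfolding is_chart_def fd homeomorphism_def
  proof (intro conjI ballI U oim cd ci)
    show i: "chart_inv d (snd d r) = r" if "r \<in> ?U" for r
      unfolding chart_inv_def fd using inj that by (rule inv_into_f_f)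
    show "snd d (chart_inv d y) = y" if "y \<in> snd d ` ?U" for y
      unfolding chart_inv_def fd using that by (rule f_inv_into_f)
    show "chart_inv d ` snd d ` ?U = ?U" using i by force
  qed simp
  have smooth\<Psi>': "smooth_on \<Psi>' (snd d ` T)" if "T \<subseteq> ?U" for T
    by (rule smooth_on_subset[OF \<Omega>(4)]) (use \<Omega>(5) that in \<open>auto simp: sd\<close>)
  have \<Psi>'d: "\<Psi>' (snd d r) = snd c r" if "r \<in> ?U" for r using \<Omega>(5) that by (simp add: sd)
  show "admissible_chart A d"
    unfolding admissible_chart_def
  proof (intro conjI ballI d)
    fix b assume b: "b \<in> A"
    note chb = admissible_is_chart[OF atlas_admissible[OF b]]
    define T where "T = ?U \<inter> fst b"
    have T: "open T" "T \<subseteq> ?U" "T \<subseteq> fst b" "T \<subseteq> fst c" using U chart_open(1)[OF chb] by (auto simp: T_def)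
    have o: "open (snd d ` T)" by (rule chart_image_open[OF d T(1)]) (use T(2) fd in simp)
    have \<Psi>'dT: "\<Psi>' (snd d r) = snd c r" if "r \<in> T" for r using \<Psi>'d T(2) that by blast
    have cb: "smooth_on (snd b \<circ> chart_inv c) (snd c ` (fst c \<inter> fst b))"
      using admissible_transition[OF c atlas_admissible[OF b]] by (simp add: smooth_transition_def)
    have bc: "smooth_on (snd c \<circ> chart_inv b) (snd b ` (fst b \<inter> fst c))"
      using admissible_transition[OF atlas_admissible[OF b] c] by (simp add: smooth_transition_def)
    have "smooth_on (\<lambda>y. (snd b \<circ> chart_inv c) (\<Psi>' y)) (snd d ` T)"
      by (rule smooth_on_compose[OF o smooth\<Psi>'[OF T(2)] cb]) (use T(3,4) \<Psi>'dT in auto)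
    then have "smooth_on (snd b \<circ> chart_inv d) (snd d ` T)"
      by (rule smooth_on_cong_open[OF o, rotated]) (use inv T(2) in auto)
    then show "smooth_transition d b" by (simp add: smooth_transition_def fd T_def)
    have ob: "open (snd b ` T)" by (rule chart_image_open[OF chb T(1,3)])
    have bT: "chart_inv b (snd b r) = r" if "r \<in> T" for r using chart_inv_chart[OF chb] T(3) that by blast
    have "smooth_on (\<lambda>x. \<Psi> ((snd c \<circ> chart_inv b) x)) (snd b ` T)"
      by (rule smooth_on_compose[OF ob smooth_on_subset[OF bc] \<Omega>(3)]) (use T bT in auto)
    then have "smooth_on (snd d \<circ> chart_inv b) (snd b ` T)"
      by (rule smooth_on_cong_open[OF ob, rotated]) (simp add: sd)
    then show "smooth_transition b d" by (simp add: smooth_transition_def fd T_def Int_commute)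
  qed
  fix r w assume r: "r \<in> fst c" "snd c r \<in> \<Omega>"
  then have rU: "r \<in> ?U" by simp
  show "coord_vector A d r w = coord_vector A c r (frechet_derivative \<Psi>' (at (\<Psi> (snd c r))) w)"
  proof
    fix f
    show "coord_vector A d r w f = coord_vector A c r (frechet_derivative \<Psi>' (at (\<Psi> (snd c r))) w) f"
    proof (cases "f \<in> smooth_functions A")
      case f: True
      let ?y = "\<Psi> (snd c r)" and ?h = "f \<circ> chart_inv c"
      have y: "?y \<in> snd d ` ?U" "\<Psi>' ?y = snd c r" using rU \<Omega>(5) by (auto simp: sd)
      have 1: "(\<Psi>' has_derivative frechet_derivative \<Psi>' (at ?y)) (at ?y)"
        by (rule smooth_on_has_derivative[OF smooth\<Psi>'[OF subset_refl] y(1)])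
      have 2: "(?h has_derivative frechet_derivative ?h (at (snd c r))) (at (\<Psi>' ?y))"
        unfolding y(2) using r by (intro smooth_on_has_derivative[OF smooth_functions_chart[OF f c]]) auto
      have "((\<lambda>y. ?h (\<Psi>' y)) has_derivative
          (\<lambda>v. frechet_derivative ?h (at (snd c r)) (frechet_derivative \<Psi>' (at ?y) v))) (at ?y)"
        by (rule has_derivative_compose[OF 1 2])
      then have "((f \<circ> chart_inv d) has_derivative
          (\<lambda>v. frechet_derivative ?h (at (snd c r)) (frechet_derivative \<Psi>' (at ?y) v))) (at ?y)"
        by (rule has_derivative_transform_within_open[OF _ oim y(1)]) (simp add: inv)
      from frechet_derivative_at[OF this]
      have "frechet_derivative (f \<circ> chart_inv d) (at ?y) w =
          frechet_derivative ?h (at (snd c r)) (frechet_derivative \<Psi>' (at ?y) w)" by metis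
      then show ?thesis using f by (simp add: coord_vector_def sd)
    qed (simp add: coord_vector_def)
  qed
qed

text \<open>In a slice chart the components of a section transverse to W vanish on the slice. The
  other section is tangent to the slice, so it annihilates them; thus both terms of the bracket have
  no transverse component at q.\<close>

lemma integrable_imp_involutive:
  assumes int: "integrable_distribution A D" and X: "X \<in> sections A D" and Y: "Y \<in> sections A D"
  shows "lie_bracket X Y q \<in> D q"
proof -
  obtain N where N: "q \<in> N" "integral_manifold A D N" using int unfolding integrable_distribution_def by blast
  obtain c W where c: "admissible_chart A c" "q \<in> fst c" and W: "subspace W"
    and slice: "N \<inter> fst c = {r \<in> fst c. snd c r - snd c q \<in> W}"
    and DW: "\<And>r. r \<in> N \<inter> fst c \<Longrightarrow> D r = coord_vector A c r ` W"
    using N(2)[unfolded integral_manifold_def, rule_format, OF N(1)] by blast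
  note ch = admissible_is_chart[OF c(1)]
  obtain y S where y: "\<And>b. y b \<in> smooth_functions A" and S: "open S" "q \<in> S" "S \<subseteq> fst c"
    "\<And>r b. r \<in> S \<Longrightarrow> y b r = snd c r \<bullet> b" using coordinate_functions[OF c] by blast
  have V: "X \<in> vector_fields A" "Y \<in> vector_fields A" "\<And>r. X r \<in> D r" "\<And>r. Y r \<in> D r"
    using X Y by (auto simp: sections_def)
  have zero: "Z (\<lambda>r. V r (y b)) = 0"
    if Z: "Z \<in> D q" and V: "V \<in> vector_fields A" "\<And>r. V r \<in> D r" and b: "\<And>w. w \<in> W \<Longrightarrow> w \<bullet> b = 0" for Z V b
  proof -
    define f where "f = (\<lambda>r. V r (y b))"
    have f: "f \<in> smooth_functions A" unfolding f_def by (rule vector_field_smooth[OF V(1) y])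
    have f0: "f r = 0" if r: "r \<in> N \<inter> S" for r
    proof -
      have "r \<in> N \<inter> fst c" using r S(3) by blast
      then obtain u where u: "u \<in> W" "V r = coord_vector A c r u" using V(2)[of r] DW by blast
      have "V r (y b) = u \<bullet> b"
        unfolding u(2) by (rule coord_vector_coordinate_function[OF c(1) y S(1) _ S(3,4)]) (use r in auto)
      then show ?thesis using b[OF u(1)] by (simp add: f_def)
    qed
    obtain u where u: "u \<in> W" "Z = coord_vector A c q u" using Z DW[of q] N(1) c(2) by blast
    have "frechet_derivative (f \<circ> chart_inv c) (at (snd c q)) u = 0"
    proof (rule derivative_along_zero_segment[where S="snd c ` S" and u=u and h="f \<circ> chart_inv c" and x="snd c q"])
      show "((f \<circ> chart_inv c) has_derivative frechet_derivative (f \<circ> chart_inv c) (at (snd c q))) (at (snd c q))"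
        using c(2) by (intro smooth_on_has_derivative[OF smooth_functions_chart[OF f c(1)]]) auto
      show "open (snd c ` S)" by (rule chart_image_open[OF ch S(1,3)])
      show "snd c q \<in> snd c ` S" using S(2) by blast
      fix t assume "snd c q + t *\<^sub>R u \<in> snd c ` S"
      then obtain r where r: "r \<in> S" "snd c r = snd c q + t *\<^sub>R u" by (metis imageE)
      then have "snd c r - snd c q \<in> W" using subspace_scale[OF W u(1)] by simp
      then have "r \<in> N \<inter> fst c" unfolding slice using r(1) S(3) by blast
      then have "f r = 0" using f0 r(1) by blast
      moreover have "chart_inv c (snd c r) = r" using r(1) S(3) by (intro chart_inv_chart[OF ch]) auto
      ultimately show "(f \<circ> chart_inv c) (snd c q + t *\<^sub>R u) = 0" by (simp flip: r(2))
    qed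
    then show ?thesis using f by (simp add: u(2) coord_vector_def f_def)
  qed
  obtain w where w: "lie_bracket X Y q = coord_vector A c q w"
    using vector_field_tangent[OF lie_bracket_vector_field[OF V(1,2)]] tangent_space_eq_coord_vectors[OF c] by blast
  have orth: "w \<bullet> b = 0" if "\<And>w. w \<in> W \<Longrightarrow> w \<bullet> b = 0" for b
  proof -
    have "w \<bullet> b = lie_bracket X Y q (y b)"
      unfolding w by (rule coord_vector_coordinate_function[OF c(1) y S, symmetric])
    also have "\<dots> = 0"
      unfolding lie_bracket_def using zero[OF V(3) V(2,4) that] zero[OF V(4) V(1,3) that] by simp
    finally show ?thesis .
  qed
  \<comment> \<open>The part w2 is orthogonal to W, so \<open>orth\<close> may be applied to w2
    itself and shows that w2 is 0.\<close>
  obtain w1 w2 where w12: "w1 \<in> span W" "\<And>v. v \<in> span W \<Longrightarrow> orthogonal w2 v" "w = w1 + w2"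
    using orthogonal_subspace_decomp_exists[of W w] by blast
  have "w \<bullet> w2 = 0"
    using w12(2)[OF span_base] by (intro orth) (simp add: orthogonal_def inner_commute)
  moreover have "w1 \<bullet> w2 = 0" using w12(2)[OF w12(1)] by (simp add: orthogonal_def inner_commute)
  ultimately have "w2 = 0" by (simp add: w12(3) inner_add_left)
  then have "w \<in> W" using w12 W by (simp add: span_eq_iff[THEN iffD2])
  then show ?thesis using DW[of q] N(1) c(2) w by simp
qed

end

text \<open>Normalising a frame of \<open>W x\<close> by its projection \<open>P\<close> to \<open>W x\<^sub>0\<close> makes the frame fields
  \<open>E x h\<close> commute if the distribution is involutive.\<close>

lemma smooth_subspace_family:
  fixes a :: "'i \<Rightarrow> 'e::euclidean_space \<Rightarrow> 'e"
  assumes "finite F" and S: "open S" "x0 \<in> S" and a: "\<And>i. i \<in> F \<Longrightarrow> smooth_on (a i) S"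
    and dimW: "\<And>x. x \<in> S \<Longrightarrow> dim (span ((\<lambda>i. a i x) ` F)) = k"
  shows "\<exists>(P :: 'e \<Rightarrow> 'e) (E :: 'e \<Rightarrow> 'e \<Rightarrow>\<^sub>L 'e) T.
    linear P \<and> range P = span ((\<lambda>i. a i x0) ` F) \<and> (\<forall>v. P (P v) = P v) \<and>
    open T \<and> x0 \<in> T \<and> T \<subseteq> S \<and> smooth_on E T \<and> (\<forall>x h. blinfun_apply (E x) (P h) = blinfun_apply (E x) h) \<and>
    (\<forall>x\<in>T. (\<forall>h. blinfun_apply (E x) h \<in> span ((\<lambda>i. a i x) ` F) \<and> P (blinfun_apply (E x) h) = P h) \<and>
      (\<forall>w\<in>span ((\<lambda>i. a i x) ` F). blinfun_apply (E x) w = w))"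
proof -
  define W where "W x = span ((\<lambda>i. a i x) ` F)" for x
  have sW: "subspace (W x)" for x by (simp add: W_def)
  obtain U where U: "U \<subseteq> W x0" "pairwise orthogonal U" "\<And>u. u \<in> U \<Longrightarrow> norm u = 1" "independent U"
      "card U = dim (W x0)" "span U = W x0"
    using orthonormal_basis_subspace[OF sW[of x0]] by metis
  have fU: "finite U" using U(4) by (rule independent_imp_finite)
  define P where "P v = (\<Sum>u\<in>U. (v \<bullet> u) *\<^sub>R u)" for v
  have linP: "linear P"
    unfolding P_def by (intro linearI) (simp_all add: inner_add_left scaleR_add_left sum.distrib scaleR_sum_right)
  have bP: "bounded_linear P" using linP by (simp add: linear_conv_bounded_linear)
  have P_in: "P v \<in> W x0" for v
    unfolding P_def U(6)[symmetric] by (intro span_sum span_scale span_base)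
  have P_id: "P w = w" if "w \<in> W x0" for w
    unfolding P_def by (rule orthonormal_basis_expand[OF U(2,3) _ fU]) (use that U(6) in auto)
  have "\<exists>k. u = (\<Sum>i\<in>F. k i *\<^sub>R a i x0)" if "u \<in> U" for u
    using span_image_finite_expansion[OF assms(1), of u "\<lambda>i. a i x0"] U(1) that by (auto simp: W_def)
  then obtain \<kappa> where \<kappa>: "\<And>u. u \<in> U \<Longrightarrow> u = (\<Sum>i\<in>F. \<kappa> u i *\<^sub>R a i x0)" by metis
  \<comment> \<open>An orthonormal basis at x0 is continued to nearby points by keeping its
    coefficients in the generating fields.\<close>
  define e where "e u x = (\<Sum>i\<in>F. \<kappa> u i *\<^sub>R a i x)" for u x
  have e0: "e u x0 = u" if "u \<in> U" for u using \<kappa>[OF that] by (simp add: e_def)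
  have eW: "e u x \<in> W x" for u x
    unfolding e_def W_def by (intro span_sum span_scale span_base) auto
  have se: "smooth_on (e u) S" for u
    unfolding e_def by (intro smooth_on_sum S smooth_on_scaleR smooth_on_const a)
  \<comment> \<open>\<open>N x\<close> sends each u in U to \<open>P (e u x)\<close> and fixes the
    orthogonal complement of \<open>W x0\<close>. It is the identity at x0, hence invertible nearby;
    its inverse G corrects the frame so that P takes it back to U.\<close>
  define N where "N x = id_blinfun + (\<Sum>u\<in>U. blinfun_scaleR_left (P (e u x - u)) o\<^sub>L blinfun_inner_left u)" for x
  have N: "N x v = v + (\<Sum>u\<in>U. (v \<bullet> u) *\<^sub>R P (e u x - u))" for x v
    by (simp add: N_def blinfun.add_left blinfun.sum_left)
  have sN: "smooth_on N S"
  proof (rule smooth_on_blinfun_componentwise[OF S(1)])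
    fix b :: 'e
    show "smooth_on (\<lambda>x. N x b) S"
      unfolding N
      by (intro smooth_on_add smooth_on_sum S smooth_on_scaleR smooth_on_const
          smooth_on_compose_bounded_linear[OF S(1) bP] smooth_on_diff se)
  qed
  have N0: "N x0 = id_blinfun"
    by (rule blinfun_eqI) (simp add: N e0 linear_0[OF linP])
  define T where "T = S \<inter> N -` ball id_blinfun (1/2)"
  have T: "open T" "x0 \<in> T" "T \<subseteq> S"
    using continuous_open_preimage[OF smooth_on_continuous_on[OF sN] S(1) open_ball] S(2)
    by (auto simp: T_def N0)
  have near: "norm (N x - id_blinfun) \<le> 1/2" if "x \<in> T" for x
    using that by (auto simp: T_def dist_norm norm_minus_commute)
  obtain G where G: "smooth_on G T" "\<And>x. x \<in> T \<Longrightarrow> N x o\<^sub>L G x = id_blinfun"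
      "\<And>x. x \<in> T \<Longrightarrow> G x o\<^sub>L N x = id_blinfun"
    using smooth_operator_inverse[OF T(1) smooth_on_subset[OF sN T(3)] near] by blast
  have NG: "N x (G x v) = v" if "x \<in> T" for x v
    using G(2)[OF that] by (metis blinfun_apply_blinfun_compose blinfun_apply_id_blinfun)
  define E where "E x = (\<Sum>u\<in>U. blinfun_scaleR_left (e u x) o\<^sub>L (blinfun_inner_left u o\<^sub>L (G x o\<^sub>L Blinfun P)))" for x
  have E: "E x h = (\<Sum>u\<in>U. (G x (P h) \<bullet> u) *\<^sub>R e u x)" for x h
    by (simp add: E_def blinfun.sum_left bounded_linear_Blinfun_apply[OF bP])
  have sE: "smooth_on E T"
  proof (rule smooth_on_blinfun_componentwise[OF T(1)])
    fix b :: 'e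
    have "smooth_on (\<lambda>x. G x (P b)) T"
      by (rule smooth_on_compose_bounded_linear[OF T(1) blinfun.bounded_linear_left G(1)])
    then show "smooth_on (\<lambda>x. E x b) T"
      unfolding E by (intro smooth_on_sum T smooth_on_scaleR smooth_on_inner_const smooth_on_subset[OF se T(3)])
  qed
  have EW: "E x h \<in> W x" for x h
    unfolding E using eW by (intro subspace_sum[OF sW] subspace_scale[OF sW])
  have PE: "P (E x h) = P h" if x: "x \<in> T" for x h
  proof -
    define z where "z = G x (P h)"
    have Nz: "z + (\<Sum>u\<in>U. (z \<bullet> u) *\<^sub>R P (e u x - u)) = P h" using NG[OF x, of "P h"] by (simp add: N z_def)
    then have "z = P h - (\<Sum>u\<in>U. (z \<bullet> u) *\<^sub>R P (e u x - u))" by (simp add: eq_diff_eq)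
    then have "z \<in> W x0"
      using subspace_diff[OF sW P_in subspace_sum[OF sW subspace_scale[OF sW P_in]]] by metis
    then have Pz: "P z = z" by (rule P_id)
    have "P (E x h) = (\<Sum>u\<in>U. (z \<bullet> u) *\<^sub>R P (e u x))"
      by (simp add: E linear_sum[OF linP] linear_cmul[OF linP] z_def)
    also have "\<dots> = (\<Sum>u\<in>U. (z \<bullet> u) *\<^sub>R P (e u x - u) + (z \<bullet> u) *\<^sub>R u)"
    proof (rule sum.cong[OF refl])
      fix u assume "u \<in> U"
      then have "P u = u" using P_id U(1) by blast
      then show "(z \<bullet> u) *\<^sub>R P (e u x) = (z \<bullet> u) *\<^sub>R P (e u x - u) + (z \<bullet> u) *\<^sub>R u"
        by (simp add: linear_diff[OF linP] scaleR_diff_right)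
    qed
    also have "\<dots> = (\<Sum>u\<in>U. (z \<bullet> u) *\<^sub>R P (e u x - u)) + P z" by (simp add: sum.distrib P_def)
    also have "\<dots> = P h" using Nz Pz by (simp add: add.commute)
    finally show ?thesis .
  qed
  have PP: "P (P v) = P v" for v by (rule P_id[OF P_in])
  have EP: "E x (P h) = E x h" for x h by (simp add: E PP)
  \<comment> \<open>E x is injective on \<open>W x0\<close> because P undoes it, so constancy of the
    dimension makes its image all of \<open>W x\<close>.\<close>
  have EE: "E x w = w" if x: "x \<in> T" and w: "w \<in> W x" for x w
  proof -
    have inj: "inj_on (E x) (span (W x0))"
    proof (rule inj_onI)
      fix v w assume vw: "v \<in> span (W x0)" "w \<in> span (W x0)" "E x v = E x w"
      then have "P v = P w" using PE[OF x] by metis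
      then show "v = w" using vw P_id sW by (metis span_eq_iff)
    qed
    have lin: "linear (E x)" by (simp add: bounded_linear.linear blinfun.bounded_linear_right)
    have "dim (E x ` W x0) = dim (W x0)" by (rule dim_image_eq[OF lin inj])
    also have "\<dots> = dim (W x)" using dimW[OF S(2)] dimW[of x] x T(3) by (auto simp: W_def)
    finally have "E x ` W x0 = W x"
      using EW by (intro subspace_dim_equal linear_subspace_image[OF lin sW] sW) auto
    then obtain h where h: "w = E x h" using w by blast
    then have "E x w = E x (P (E x h))" by (simp add: EP)
    also have "\<dots> = E x h" by (simp add: PE[OF x] EP)
    finally show ?thesis by (simp add: h)
  qed
  have "range P = W x0"
  proof
    show "range P \<subseteq> W x0" using P_in by blast
    show "W x0 \<subseteq> range P"
    proof
      fix w assume "w \<in> W x0"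
      from P_id[OF this] show "w \<in> range P" by (metis rangeI)
    qed
  qed
  then show ?thesis
    using linP PP T sE EW PE EE EP unfolding W_def
    by (intro exI[of _ P] exI[of _ E] exI[of _ T]) blast
qed

section \<open>Involutivity implies integrability\<close>

context manifold
begin

text \<open>Involutivity becomes the symmetry hypothesis of the total differential equation for the
  normalised frame E. Its solution parametrises the leaf through q0 as a graph over
  \<open>W x0\<close>, and a shear of the coordinates that flattens this graph is the slice
  chart.\<close>

lemma involutive_imp_integrable:
  assumes D: "distribution A D"
    and inv: "\<And>X Y q. X \<in> sections A D \<Longrightarrow> Y \<in> sections A D \<Longrightarrow> lie_bracket X Y q \<in> D q"
  shows "integrable_distribution A D"
  unfolding integrable_distribution_def
proof
  fix q0
  obtain c where c: "c \<in> A" "admissible_chart A c" "q0 \<in> fst c" using atlas_cover .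
  note ch = admissible_is_chart[OF c(2)]
  define x0 where "x0 = snd c q0"
  obtain y S1 where y: "\<And>b. y b \<in> smooth_functions A" and S1: "open S1" "q0 \<in> S1" "S1 \<subseteq> fst c"
    "\<And>r b. r \<in> S1 \<Longrightarrow> y b r = snd c r \<bullet> b" using coordinate_functions[OF c(2,3)] by blast
  have Dsub: "subspace (D q)" "D q \<subseteq> tangent_space A q" for q using D by (auto simp: distribution_def)
  obtain k where k: "\<And>q. dim (D q) = k" using D by (auto simp: distribution_def)
  obtain S2 F where F: "open S2" "q0 \<in> S2" "finite F" "F \<subseteq> vector_fields A"
      "\<And>r. r \<in> S2 \<Longrightarrow> D r = span ((\<lambda>X. X r) ` F)"
    using D[unfolded distribution_def] by metis
  define S where "S = S1 \<inter> S2"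
  have S: "open S" "q0 \<in> S" "S \<subseteq> S1" "S \<subseteq> S2" "S \<subseteq> fst c" using S1 F by (auto simp: S_def)
  define O1 where "O1 = snd c ` S"
  have O1: "open O1" "x0 \<in> O1" using chart_image_open[OF ch S(1,5)] S(2) by (auto simp: O1_def x0_def)
  have O1D: "chart_inv c x \<in> S" "snd c (chart_inv c x) = x" if "x \<in> O1" for x
    using that S(5) chart_inv_chart[OF ch] by (auto simp: O1_def subset_iff)
  \<comment> \<open>Coordinate expressions of the generating fields: from here on the distribution
    is the family W of subspaces of the model space.\<close>
  define a where "a X x = (\<Sum>b\<in>Basis. X (chart_inv c x) (y b) *\<^sub>R b)" for X :: "'a vfield" and x
  define W where "W x = span ((\<lambda>X. a X x) ` F)" for x
  have coordinates: "v = coord_vector A c r (\<Sum>b\<in>Basis. v (y b) *\<^sub>R b)" if "r \<in> S1" "v \<in> tangent_space A r" for r v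
    by (rule tangent_vector_coordinates[OF c(2) y S1(1) that(1) S1(3,4) that(2)])
  have coordinate_apply: "coord_vector A c r w (y b) = w \<bullet> b" if "r \<in> S1" for r w b
    by (rule coord_vector_coordinate_function[OF c(2) y S1(1) that S1(3,4)])
  have DW: "D r = coord_vector A c r ` W (snd c r)" if r: "r \<in> S" for r
  proof -
    have rc: "r \<in> fst c" "r \<in> S1" using r S by auto
    have "X r = coord_vector A c r (a X (snd c r))" if "X \<in> F" for X
      using coordinates[OF rc(2) vector_field_tangent, of X] that F(4) chart_inv_chart[OF ch rc(1)]
      by (auto simp: a_def)
    then have "(\<lambda>X. X r) ` F = coord_vector A c r ` (\<lambda>X. a X (snd c r)) ` F"
      unfolding image_image by (intro image_cong) auto
    then show ?thesis
      using F(5)[of r] r S(4) by (auto simp: W_def span_linear_image[OF linear_coord_vector[OF c(2) rc(1)]])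
  qed
  have dimW: "dim (span ((\<lambda>X. a X x) ` F)) = k" if x: "x \<in> O1" for x
  proof -
    have r: "chart_inv c x \<in> S" "chart_inv c x \<in> fst c" using O1D[OF x] S(5) by auto
    have "dim (W x) = dim (coord_vector A c (chart_inv c x) ` W x)"
      by (rule dim_injective_image[OF linear_coord_vector[OF c(2) r(2)] inj_coord_vector[OF c(2) r(2)], symmetric])
        (simp add: W_def)
    also have "\<dots> = k" using DW[OF r(1)] O1D(2)[OF x] k by metis
    finally show ?thesis by (simp add: W_def)
  qed
  have sa: "smooth_on (a X) O1" if "X \<in> F" for X
  proof -
    have "smooth_on (\<lambda>x. ((\<lambda>r. X r (y b)) \<circ> chart_inv c) x) O1" for b
      using F(4) that S(5) unfolding O1_def
      by (intro smooth_on_subset[OF smooth_functions_chart[OF vector_field_smooth[OF _ y] c(2)]]) auto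
    then show ?thesis
      unfolding a_def comp_def by (intro smooth_on_sum O1 smooth_on_scaleR smooth_on_const)
  qed
  obtain P :: "'e \<Rightarrow> 'e" and E :: "'e \<Rightarrow> 'e \<Rightarrow>\<^sub>L 'e" and T
    where P: "linear P" "range P = W x0" "\<And>v. P (P v) = P v"
    and T: "open T" "x0 \<in> T" "T \<subseteq> O1" and sE: "smooth_on E T"
    and EW: "\<And>x h. x \<in> T \<Longrightarrow> E x h \<in> W x" and PE: "\<And>x h. x \<in> T \<Longrightarrow> P (E x h) = P h"
    and EE: "\<And>x w. x \<in> T \<Longrightarrow> w \<in> W x \<Longrightarrow> E x w = w" and EP: "\<And>x h. E x (P h) = E x h"
    using smooth_subspace_family[OF F(3) O1 sa dimW, folded W_def] by blast
  have bP: "bounded_linear P" using P(1) by (simp add: linear_conv_bounded_linear)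
  have sEh: "smooth_on (\<lambda>x. E x h) T" for h
    by (rule smooth_on_compose_bounded_linear[OF T(1) blinfun.bounded_linear_left sE])
  have DE: "((\<lambda>x. E x h) has_derivative (\<lambda>v. frechet_derivative E (at x) v h)) (at x)" if "x \<in> T" for x h
    by (rule bounded_linear.has_derivative[OF blinfun.bounded_linear_left smooth_on_has_derivative[OF sE that]])

  text \<open>The local fields with coordinates \<open>E x h\<close> project to the constant \<open>P h\<close>. Hence their brackets
    lie both in \<open>W x\<close> and in the kernel of \<open>P\<close>, so they vanish.\<close>

  have sym: "frechet_derivative E (at x) (E x h) t = frechet_derivative E (at x) (E x t) h"
    if x: "x \<in> T" for x h t
  proof -
    define p where "p = chart_inv c x"
    have p: "p \<in> S" "snd c p = x" "p \<in> fst c" "p \<in> S1" using O1D[of x] x T(3) S by (auto simp: p_def)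
    have px: "snd c p \<in> T" using p x by simp
    have ex: "\<exists>X R. X \<in> sections A D \<and> open R \<and> p \<in> R \<and> (\<forall>q\<in>R. X q = coord_vector A c q (E (snd c q) h))" for h
    proof -
      obtain X R where X: "X \<in> vector_fields A" "open R" "p \<in> R" "\<forall>q\<in>R. X q = coord_vector A c q (E (snd c q) h)"
        "\<forall>q. X q = 0 \<or> q \<in> fst c \<and> snd c q \<in> T \<and> X q \<in> span {coord_vector A c q (E (snd c q) h)}"
        using local_vector_field[OF c(2) p(3) T(1) sEh px] by blast
      have "X q \<in> D q" for q
      proof (cases "X q = 0")
        case True
        then show ?thesis using subspace_0[OF Dsub(1)] by simp
      next
        case False
        then have q: "q \<in> fst c" "snd c q \<in> T" "X q \<in> span {coord_vector A c q (E (snd c q) h)}" using X(5) by auto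
        have "q \<in> S" using O1D(1)[of "snd c q"] q(2) T(3) chart_inv_chart[OF ch q(1)] by auto
        then have "coord_vector A c q (E (snd c q) h) \<in> D q" using DW EW[OF q(2)] by blast
        then show ?thesis using q(3) span_minimal[OF _ Dsub(1)] by blast
      qed
      then show ?thesis using X by (auto simp: sections_def)
    qed
    obtain X R where X: "X \<in> sections A D" "open R" "p \<in> R" "\<forall>q\<in>R. X q = coord_vector A c q (E (snd c q) h)"
      using ex by blast
    obtain Y R' where Y: "Y \<in> sections A D" "open R'" "p \<in> R'" "\<forall>q\<in>R'. Y q = coord_vector A c q (E (snd c q) t)"
      using ex by blast
    have comp: "coord_vector A c p v (\<lambda>r. Z r (y b)) = frechet_derivative E (at x) v t \<bullet> b"
      if Z: "Z \<in> vector_fields A" "open Q" "p \<in> Q" "\<forall>q\<in>Q. Z q = coord_vector A c q (E (snd c q) t)" for Z Q t v b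
    proof -
      let ?f = "\<lambda>r. Z r (y b)"
      define Q' where "Q' = Q \<inter> S \<inter> {r \<in> fst c. snd c r \<in> T}"
      have Q': "open Q'" "p \<in> Q'" "Q' \<subseteq> fst c"
        using Z S p px chart_vimage_open[OF ch T(1)] by (auto simp: Q'_def)
      have "frechet_derivative (?f \<circ> chart_inv c) (at x) = frechet_derivative (\<lambda>x. E x t \<bullet> b) (at x)"
      proof (rule frechet_derivative_cong_open[OF chart_image_open[OF ch Q'(1,3)]])
        show "x \<in> snd c ` Q'" using Q'(2) p(2) by blast
        fix z assume "z \<in> snd c ` Q'"
        then obtain r where r: "r \<in> Q'" "z = snd c r" by blast
        then have "r \<in> S1" "Z r = coord_vector A c r (E z t)" "chart_inv c z = r"
          using Z(4) S(3) chart_inv_chart[OF ch, of r] by (auto simp: Q'_def)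
        then show "(?f \<circ> chart_inv c) z = E z t \<bullet> b" using coordinate_apply by simp
      qed
      also have "\<dots> = (\<lambda>v. frechet_derivative E (at x) v t \<bullet> b)"
        using frechet_derivative_at[OF bounded_linear.has_derivative[OF bounded_linear_inner_left DE[OF x]]] by metis
      finally show ?thesis
        using vector_field_smooth[OF Z(1) y, of b] by (simp add: coord_vector_def p(2))
    qed
    have V: "X \<in> vector_fields A" "Y \<in> vector_fields A" using X(1) Y(1) by (auto simp: sections_def)
    let ?v = "frechet_derivative E (at x) (E x h) t" and ?w = "frechet_derivative E (at x) (E x t) h"
    \<comment> \<open>In coordinates the bracket is the derivative of Y along X minus that of X
      along Y, here for the fields E x t and E x h.\<close>
    have "lie_bracket X Y p (y b) = (?v - ?w) \<bullet> b" for b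
      using comp[OF V(2) Y(2-4), of "E x h" b] comp[OF V(1) X(2-4), of "E x t" b] X(3,4) Y(3,4)
      by (simp add: lie_bracket_def p(2) inner_diff_left)
    then have "lie_bracket X Y p = coord_vector A c p (\<Sum>b\<in>Basis. ((?v - ?w) \<bullet> b) *\<^sub>R b)"
      using coordinates[OF p(4) vector_field_tangent[OF lie_bracket_vector_field[OF V]]] by simp
    also have "\<dots> = coord_vector A c p (?v - ?w)" by (simp only: euclidean_representation)
    finally have "coord_vector A c p (?v - ?w) \<in> coord_vector A c p ` W x"
      using inv[OF X(1) Y(1), of p] DW[OF p(1)] p(2) by simp
    then have vw: "?v - ?w \<in> W x" using inj_coord_vector[OF c(2) p(3)] by (auto simp: inj_eq)
    have PDE: "P (frechet_derivative E (at x) v t) = 0" for v t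
    proof -
      have "((\<lambda>x. P (E x t)) has_derivative (\<lambda>v. P (frechet_derivative E (at x) v t))) (at x)"
        by (rule bounded_linear.has_derivative[OF bP DE[OF x]])
      then have "((\<lambda>x. P t) has_derivative (\<lambda>v. P (frechet_derivative E (at x) v t))) (at x)"
        by (rule has_derivative_transform_within_open[OF _ T(1) x]) (simp add: PE)
      then have "(\<lambda>v. P (frechet_derivative E (at x) v t)) = (\<lambda>v. 0)"
        by (rule has_derivative_unique) (rule has_derivative_const)
      then show ?thesis by metis
    qed
    have "?v - ?w = E x (P (?v - ?w))" using EE[OF x vw] EP by simp
    also have "\<dots> = 0" by (simp add: linear_diff[OF P(1)] PDE blinfun.zero_right)
    finally show ?thesis by simp
  qed
  \<comment> \<open>The equation is posed on the whole model space, not on \<open>W x0\<close>. This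
    is consistent since E x kills the kernel of P; the parameters inserted below all lie in the
    range of P.\<close>
  obtain \<rho> u where u: "\<rho> > 0" "u 0 = x0" "u ` ball 0 \<rho> \<subseteq> T"
    "\<And>t. t \<in> ball 0 \<rho> \<Longrightarrow> (u has_derivative E (u t)) (at t)" "smooth_on u (ball 0 \<rho>)"
    using total_differential_equation[OF T(1,2) sE sym] by blast
  \<comment> \<open>P composed with u has derivative P, because P undoes E. So the image of u over
    the range of P is a graph: its parameter is recovered by P.\<close>
  have Pu: "P (u t) = P x0 + P t" if t: "t \<in> ball 0 \<rho>" for t
  proof -
    have "((\<lambda>t. P (u t) - P t) has_derivative (\<lambda>v. 0)) (at t within ball 0 \<rho>)" if t: "t \<in> ball 0 \<rho>" for t
    proof -
      have "((\<lambda>t. P (u t) - P t) has_derivative (\<lambda>v. P (E (u t) v) - P v)) (at t)"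
        by (intro has_derivative_diff bounded_linear.has_derivative[OF bP u(4)[OF t]] bounded_linear_imp_has_derivative[OF bP])
      moreover have "u t \<in> T" using u(3) t by blast
      ultimately show ?thesis using PE by (simp add: has_derivative_at_withinI)
    qed
    then have "\<exists>d. \<forall>t\<in>ball 0 \<rho>. P (u t) - P t = d"
      by (rule has_derivative_zero_constant[OF convex_ball])
    then obtain d where d: "\<And>t. t \<in> ball 0 \<rho> \<Longrightarrow> P (u t) - P t = d" by blast
    have "P x0 = d" using d[of 0] u(1,2) by (simp add: linear_0[OF P(1)])
    then show ?thesis using d[OF t] by (simp add: diff_eq_eq)
  qed
  define \<Omega> where "\<Omega> = (\<lambda>x. P (x - x0)) -` ball 0 \<rho>"
  have o\<Omega>: "open \<Omega>"
    unfolding \<Omega>_def by (intro open_vimage open_ball continuous_intros linear_continuous_on_compose[OF _ P(1)])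
  \<comment> \<open>The deviation of the graph from the affine space through x0 parallel to
    \<open>W x0\<close>.\<close>
  define K where "K x = u (P (x - x0)) - x0 - P (x - x0)" for x
  have sp: "smooth_on (\<lambda>x. P (x - x0)) \<Omega>"
    by (intro smooth_on_compose_bounded_linear[OF o\<Omega> bP] smooth_on_diff smooth_on_id smooth_on_const o\<Omega>)
  have "smooth_on (\<lambda>x. u (P (x - x0))) \<Omega>"
    by (rule smooth_on_compose[OF o\<Omega> sp u(5)]) (auto simp: \<Omega>_def)
  then have sK: "smooth_on K \<Omega>"
    unfolding K_def by (intro smooth_on_diff smooth_on_const sp o\<Omega>)
  have PK: "P (K x) = 0" if "x \<in> \<Omega>" for x
    using Pu[of "P (x - x0)"] that by (simp add: K_def \<Omega>_def linear_diff[OF P(1)] P(3))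
  have shift: "P (x - K x - x0) = P (x - x0)" "P (x + K x - x0) = P (x - x0)" if "x \<in> \<Omega>" for x
    using PK[OF that] by (simp_all add: linear_diff[OF P(1)] linear_add[OF P(1)])
  have K_cong: "K x = K z" if "P (x - x0) = P (z - x0)" for x z using that by (simp add: K_def)
  \<comment> \<open>K takes values in the kernel of P and depends only on \<open>P (x - x0)\<close>.
    Hence the shear by K preserves this parameter, and the opposite shear is its inverse.\<close>
  define \<Psi> where "\<Psi> x = x - K x" for x
  define \<Psi>' where "\<Psi>' x = x + K x" for x
  have \<Psi>: "\<Psi> x \<in> \<Omega> \<and> \<Psi>' (\<Psi> x) = x" "\<Psi>' x \<in> \<Omega> \<and> \<Psi> (\<Psi>' x) = x" if "x \<in> \<Omega>" for x
    using shift[OF that] that K_cong[OF shift(1)[OF that]] K_cong[OF shift(2)[OF that]]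
    by (auto simp: \<Psi>_def \<Psi>'_def \<Omega>_def)
  have s\<Psi>: "smooth_on \<Psi> \<Omega>" "smooth_on \<Psi>' \<Omega>"
    unfolding \<Psi>_def \<Psi>'_def by (intro smooth_on_diff smooth_on_add smooth_on_id sK o\<Omega>)+
  define d where "d = ({r \<in> fst c. snd c r \<in> \<Omega>}, \<lambda>r. \<Psi> (snd c r))"
  have fd: "fst d = {r \<in> fst c. snd c r \<in> \<Omega>}" and sd: "snd d r = \<Psi> (snd c r)" for r by (simp_all add: d_def)
  have d: "admissible_chart A d"
    unfolding d_def by (rule chart_change_admissible[OF c(2) o\<Omega> o\<Omega> s\<Psi> \<Psi>])
  have coord_d: "coord_vector A d r w = coord_vector A c r (frechet_derivative \<Psi>' (at (\<Psi> (snd c r))) w)"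
    if "r \<in> fst c" "snd c r \<in> \<Omega>" for r w
    unfolding d_def by (rule chart_change_coord_vector[OF c(2) o\<Omega> o\<Omega> s\<Psi> \<Psi> that])
  \<comment> \<open>The leaf in the original coordinates, described by membership in the graph of u;
    the new chart d turns this condition into membership in \<open>W x0\<close>.\<close>
  define N where "N = {r \<in> fst d. snd c r = u (P (snd c r - x0))}"
  have N_iff: "r \<in> N \<longleftrightarrow> snd d r - x0 \<in> W x0" if r: "r \<in> fst d" for r
  proof -
    let ?x = "snd c r"
    have x: "?x \<in> \<Omega>" using r by (simp add: fd)
    have dx: "snd d r - x0 = (?x - u (P (?x - x0))) + P (?x - x0)" by (simp add: sd \<Psi>_def K_def)
    show ?thesis
    proof
      assume "r \<in> N"
      then have "snd d r - x0 = P (?x - x0)" unfolding dx by (simp add: N_def)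
      then show "snd d r - x0 \<in> W x0" using P(2) by (metis rangeI)
    next
      assume "snd d r - x0 \<in> W x0"
      then obtain v where "snd d r - x0 = P v" using P(2) by blast
      then have "snd d r - x0 = P (snd d r - x0)" using P(3) by simp
      also have "\<dots> = P (?x - x0)" using shift(1)[OF x] by (simp add: sd \<Psi>_def)
      finally have "?x = u (P (?x - x0))" unfolding dx by simp
      then show "r \<in> N" using r by (simp add: N_def)
    qed
  qed
  have sub_W: "subspace (W x0)" by (simp add: W_def)
  have "integral_manifold A D N"
    unfolding integral_manifold_def
  proof
    fix q assume q: "q \<in> N"
    then have qd: "q \<in> fst d" by (simp add: N_def)
    have slice: "N \<inter> fst d = {r \<in> fst d. snd d r - snd d q \<in> W x0}"
    proof -
      have e: "snd d r - snd d q = (snd d r - x0) - (snd d q - x0)" for r by simp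
      have qW: "snd d q - x0 \<in> W x0" using N_iff[OF qd] q by simp
      have "snd d r - snd d q \<in> W x0 \<longleftrightarrow> snd d r - x0 \<in> W x0" for r
        using subspace_diff[OF sub_W _ qW, of "snd d r - x0"] subspace_add[OF sub_W _ qW, of "snd d r - snd d q"]
        by auto
      then show ?thesis using N_iff by (auto simp: N_def)
    qed
    have "D r = coord_vector A d r ` W x0" if "r \<in> N \<inter> fst d" for r
    proof -
      define t where "t = P (snd c r - x0)"
      define x where "x = snd c r"
      have r: "r \<in> fst c" "x \<in> \<Omega>" "x = u t" using that by (auto simp: N_def fd t_def x_def)
      have t: "t \<in> ball 0 \<rho>" using r(2) by (simp add: \<Omega>_def t_def x_def)
      have xT: "x \<in> T" using u(3) t r(3) by blast
      have rS: "r \<in> S" using O1D(1)[of x] xT T(3) chart_inv_chart[OF ch r(1)] by (auto simp: x_def)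
      have \<Psi>x: "\<Psi> x \<in> \<Omega>" "P (\<Psi> x - x0) = t"
        using \<Psi>(1)[OF r(2)] shift(1)[OF r(2)] by (simp_all add: \<Psi>_def t_def x_def)
      have "((\<lambda>z. P (z - x0)) has_derivative P) (at (\<Psi> x))"
        by (rule bounded_linear.has_derivative[OF bP, of "\<lambda>z. z - x0" "\<lambda>v. v", simplified]) (auto intro!: derivative_eq_intros)
      moreover from this have "((\<lambda>z. u (P (z - x0))) has_derivative (\<lambda>v. E (u t) (P v))) (at (\<Psi> x))"
        by (rule has_derivative_compose) (use u(4)[OF t] \<Psi>x(2) in simp)
      ultimately have "(\<Psi>' has_derivative (\<lambda>v. v + (E (u t) (P v) - 0 - P v))) (at (\<Psi> x))"
        unfolding \<Psi>'_def K_def by (intro has_derivative_add has_derivative_diff has_derivative_ident has_derivative_const)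
      note D\<Psi>' = fun_cong[OF frechet_derivative_at[OF this]]
      have D\<Psi>': "frechet_derivative \<Psi>' (at (\<Psi> x)) w = w + (E x w - P w)" for w
        unfolding D\<Psi>'[symmetric] r(3)[symmetric] EP by simp
      \<comment> \<open>On \<open>W x0\<close> the terms w and P w in the derivative of \<Psi>'
        cancel and E x w remains, so the tangent space of the slice is the image of E x, which is
        \<open>W x\<close>.\<close>
      have "coord_vector A d r w = coord_vector A c r (E x w)" if w: "w \<in> W x0" for w
      proof -
        obtain v where "w = P v" using w P(2) by blast
        then have "P w = w" using P(3) by simp
        then show ?thesis using coord_d[of r w] r D\<Psi>'[of w] by (simp add: x_def)
      qed
      then have "coord_vector A d r ` W x0 = coord_vector A c r ` (E x ` W x0)"
        by (simp add: image_image)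
      also have "E x ` W x0 = W x"
      proof
        show "E x ` W x0 \<subseteq> W x" using EW[OF xT] by blast
        show "W x \<subseteq> E x ` W x0"
        proof
          fix w assume "w \<in> W x"
          then have "w = E x (P w)" using EE[OF xT] EP by simp
          then show "w \<in> E x ` W x0" using P(2) by blast
        qed
      qed
      finally show ?thesis using DW[OF rS] by (simp add: x_def)
    qed
    then show "\<exists>c W. admissible_chart A c \<and> q \<in> fst c \<and> subspace W \<and>
        N \<inter> fst c = {r \<in> fst c. snd c r - snd c q \<in> W} \<and> (\<forall>r\<in>N \<inter> fst c. D r = coord_vector A c r ` W)"
      using d qd sub_W slice by blast
  qed
  moreover have "q0 \<in> N"
    using c(3) u(1,2) by (simp add: N_def fd \<Omega>_def x0_def linear_0[OF P(1)])
  ultimately show "\<exists>N. q0 \<in> N \<and> integral_manifold A D N" by blast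
qed

theorem Frobenius:
  assumes "distribution A D"
  shows "integrable_distribution A D \<longleftrightarrow>
    (\<forall>X\<in>sections A D. \<forall>Y\<in>sections A D. \<forall>q. lie_bracket X Y q \<in> D q)"
  using integrable_imp_involutive involutive_imp_integrable[OF assms] by blast

end

theorem theorem17:
  fixes A' :: "('a::{t2_space, second_countable_topology}, 'e::euclidean_space) chart set"
    and A :: "('b::{t2_space, second_countable_topology}, 'f::euclidean_space) chart set"
    and \<iota> :: "'b \<Rightarrow> 'a"
    and \<phi> :: "'a \<Rightarrow> 'a tvec \<Rightarrow> 'a tvec"
    and \<xi> :: "'a vfield"
    and \<eta> :: "'a \<Rightarrow> 'a tvec \<Rightarrow> real"
    and g :: "'a \<Rightarrow> 'a tvec \<Rightarrow> 'a tvec \<Rightarrow> real"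
    and nabla nabla_bar :: "'a connection"
    and \<alpha> \<beta> :: "'a \<Rightarrow> real"
    and D :: "'b \<Rightarrow> 'b tvec set"
  assumes "LP_Sasakian A' \<phi> \<xi> \<eta> g nabla"
    and "\<alpha> \<in> smooth_functions A'" and "\<beta> \<in> smooth_functions A'"
    and "nabla_bar = generalized_symmetric_metric_connection \<phi> \<xi> \<eta> g nabla \<alpha> \<beta>"
    and "CR_submanifold A A' \<iota> \<phi> \<xi> g D"
    and "xi_horizontal A' \<iota> \<xi> D"
  shows "integrable_distribution A D \<longleftrightarrow>
    (\<forall>X\<in>sections A D. \<forall>Y\<in>sections A D. \<forall>q.
       second_fundamental_form A A' \<iota> g nabla (phi_field A A' \<iota> \<phi> X) Y q =
       second_fundamental_form A A' \<iota> g nabla (phi_field A A' \<iota> \<phi> Y) X q)"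
proof -
  interpret manifold A
    using assms(5) by unfold_locales (simp add: CR_submanifold_def submanifold_def)
  have "distribution A D" using assms(5) by (simp add: CR_submanifold_def)
  from Frobenius[OF this] show ?thesis
    by (simp add: second_fundamental_form_symmetric_iff[OF assms(1,5,6)])
qed

end
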